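(* Let $(\alpha,c)\colon H\curvearrowright N$ be a continuous cocycle action of almost unimodular groups. Then the cocycle semidirect product $H\,{}_{(\alpha,c)}\!\ltimes N$ is almost unimodular if and only if $$\left\{s\in H\colon\Delta_N\big(c(s,s^{-1})\big)\frac{d(\mu_N\circ\alpha_s)}{d\mu_N}=1\right\}$$ is open in $H$. In particular, if $H$ is discrete then $H\,{}_{(\alpha,c)}\!\ltimes N$ is always almost unimodular.
   Context: Locally compact groups are Hausdorff. $\Delta_G\colon G\to\mathbb{R}_+=(0,\infty)$ is the modular function of a locally compact group, $\mu_G(E\cdot s)=\Delta_G(s)\mu_G(E)$ for a left Haar measure $\mu_G$; $G$ is almost unimodular if $\ker\Delta_G$ is open in $G$. For locally compact groups $H,N$, a cocycle action $(\alpha,c)\colon H\curvearrowright N$ is a pair of maps $\alpha\colon H\to\operatorname{Aut}(N)$, $c\colon H\times H\to N$ with $\alpha_s\alpha_t=\mathrm{Ad}(c(s,t))\alpha_{st}$ and $c(s,t)c(st,r)=\alpha_s(c(t,r))c(s,tr)$ for $s,t,r\in H$, normalized so that $c(s,e)=c(e,s)=e$ (here $\mathrm{Ad}(x)(y)=xyx^{-1}$). It is continuous if $H\times N\ni(s,x)\mapsto\alpha_s(x)\in N$ and $H\times H\ni(s,t)\mapsto c(s,t)\in N$ are continuous. The cocycle semidirect product $H\,{}_{(\alpha,c)}\!\ltimes N$ is then the locally compact group with underlying space $H\times N$ (product topology) and operations $$(s,x)(t,y)=(st,\,c(t^{-1},s^{-1})^{-1}\alpha_{t^{-1}}(x)y),\qquad(s,x)^{-1}=(s^{-1},\,\alpha_s(x)^{-1}c(s,s^{-1})).$$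 $\mu_N$ is a left Haar measure on $N$, and $\frac{d(\mu_N\circ\alpha_s)}{d\mu_N}$ is the positive constant by which the left Haar measure $\mu_N\circ\alpha_s$ is a multiple of $\mu_N$. *)

theory Defs
  imports "HOL-Analysis.Analysis" "HOL-Algebra.Coset"
begin

text \<open>
  Groups are explicit structures of \<open>HOL-Algebra\<close> carrying an abstract topology on their
  carrier, since the cocycle semidirect product is a group structure on a product set that
  depends on the cocycle action.
\<close>

locale locally_compact_group = group G
  for G :: "('a, 'm) monoid_scheme" (structure) and T :: "'a topology" +
  assumes topspace_eq_carrier: "topspace T = carrier G"
    and continuous_mult: "continuous_map (prod_topology T T) T (\<lambda>(x, y). x \<otimes> y)"
    and continuous_inv: "continuous_map T T (\<lambda>x. inv x)"
    and Hausdorff: "Hausdorff_space T"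
    and locally_compact: "locally_compact_space T"

text \<open>
  Nonzero left-invariant Radon measures on the Borel sigma-algebra. No countability is assumed
  on the group, so the measure need not be sigma-finite; the Radon convention is outer regularity
  on all Borel sets and inner regularity on open sets.
\<close>

definition left_haar_measure ::
  "('a, 'm) monoid_scheme \<Rightarrow> 'a topology \<Rightarrow> 'a measure \<Rightarrow> bool" where
  "left_haar_measure G T M \<longleftrightarrow>
     sets M = sets (sigma (topspace T) {U. openin T U}) \<and>
     emeasure M (space M) \<noteq> 0 \<and>
     (\<forall>K. compactin T K \<longrightarrow> emeasure M K < \<infinity>) \<and>
     (\<forall>E\<in>sets M. emeasure M E = (INF U\<in>{U. openin T U \<and> E \<subseteq> U}. emeasure M U)) \<and>
     (\<forall>U. openin T U \<longrightarrow>
        emeasure M U = (SUP K\<in>{K. compactin T K \<and> K \<subseteq> U}. emeasure M K)) \<and>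
     (\<forall>x\<in>carrier G. \<forall>E\<in>sets M. emeasure M (x <#\<^bsub>G\<^esub> E) = emeasure M E)"

text \<open>
  The quantification over all left Haar measures makes the modular function depend on the
  topological group only; left Haar measures exist and are unique up to a positive factor.
\<close>

definition modular_function ::
  "('a, 'm) monoid_scheme \<Rightarrow> 'a topology \<Rightarrow> 'a \<Rightarrow> real" where
  "modular_function G T s =
     (THE r. 0 < r \<and>
        (\<forall>M. left_haar_measure G T M \<longrightarrow>
           (\<forall>E\<in>sets M. emeasure M (E #>\<^bsub>G\<^esub> s) = ennreal r * emeasure M E)))"

locale almost_unimodular = locally_compact_group G T
  for G :: "('a, 'm) monoid_scheme" (structure) and T :: "'a topology" +
  assumes openin_kernel: "openin T {s \<in> carrier G. modular_function G T s = 1}"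

definition topological_automorphisms ::
  "('a, 'm) monoid_scheme \<Rightarrow> 'a topology \<Rightarrow> ('a \<Rightarrow> 'a) set" where
  "topological_automorphisms G T = {f \<in> iso G G. homeomorphic_map T T f}"

text \<open>
  The constant \<open>d(M \<circ> f) / dM\<close>, where \<open>(M \<circ> f) E = M (f ` E)\<close>; meant for a left Haar measure
  \<open>M\<close> and a topological automorphism \<open>f\<close>.
\<close>

definition haar_ratio :: "'a measure \<Rightarrow> ('a \<Rightarrow> 'a) \<Rightarrow> real" where
  "haar_ratio M f =
     (THE r. 0 < r \<and> (\<forall>E\<in>sets M. emeasure M (f ` E) = ennreal r * emeasure M E))"

locale continuous_cocycle_action =
  H: locally_compact_group H TH + N: locally_compact_group N TN
  for H :: "('a, 'm) monoid_scheme" and TH :: "'a topology"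
    and N :: "('b, 'n) monoid_scheme" and TN :: "'b topology" +
  fixes \<alpha> :: "'a \<Rightarrow> 'b \<Rightarrow> 'b" and c :: "'a \<Rightarrow> 'a \<Rightarrow> 'b"
  assumes action_closed: "s \<in> carrier H \<Longrightarrow> \<alpha> s \<in> topological_automorphisms N TN"
    and cocycle_closed: "\<lbrakk>s \<in> carrier H; t \<in> carrier H\<rbrakk> \<Longrightarrow> c s t \<in> carrier N"
    and action_mult: "\<lbrakk>s \<in> carrier H; t \<in> carrier H; x \<in> carrier N\<rbrakk> \<Longrightarrow>
      \<alpha> s (\<alpha> t x) = c s t \<otimes>\<^bsub>N\<^esub> \<alpha> (s \<otimes>\<^bsub>H\<^esub> t) x \<otimes>\<^bsub>N\<^esub> inv\<^bsub>N\<^esub> (c s t)"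
    and cocycle: "\<lbrakk>s \<in> carrier H; t \<in> carrier H; r \<in> carrier H\<rbrakk> \<Longrightarrow>
      c s t \<otimes>\<^bsub>N\<^esub> c (s \<otimes>\<^bsub>H\<^esub> t) r = \<alpha> s (c t r) \<otimes>\<^bsub>N\<^esub> c s (t \<otimes>\<^bsub>H\<^esub> r)"
    and cocycle_one_right: "s \<in> carrier H \<Longrightarrow> c s \<one>\<^bsub>H\<^esub> = \<one>\<^bsub>N\<^esub>"
    and cocycle_one_left: "s \<in> carrier H \<Longrightarrow> c \<one>\<^bsub>H\<^esub> s = \<one>\<^bsub>N\<^esub>"
    and continuous_action: "continuous_map (prod_topology TH TN) TN (\<lambda>(s, x). \<alpha> s x)"
    and continuous_cocycle: "continuous_map (prod_topology TH TH) TN (\<lambda>(s, t). c s t)"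

text \<open>
  The inverse \<open>(s, x) \<mapsto> (s\<inverse>, \<alpha> s (x)\<inverse> c(s, s\<inverse>))\<close> is determined by the multiplication;
  the topology is the product topology.
\<close>

definition cocycle_semidirect ::
  "('a, 'm) monoid_scheme \<Rightarrow> ('b, 'n) monoid_scheme \<Rightarrow>
   ('a \<Rightarrow> 'b \<Rightarrow> 'b) \<Rightarrow> ('a \<Rightarrow> 'a \<Rightarrow> 'b) \<Rightarrow> ('a \<times> 'b) monoid" where
  "cocycle_semidirect H N \<alpha> c =
     \<lparr>carrier = carrier H \<times> carrier N,
      mult = (\<lambda>(s, x) (t, y).
        (s \<otimes>\<^bsub>H\<^esub> t,
         inv\<^bsub>N\<^esub> (c (inv\<^bsub>H\<^esub> t) (inv\<^bsub>H\<^esub> s)) \<otimes>\<^bsub>N\<^esub> \<alpha> (inv\<^bsub>H\<^esub> t) x \<otimes>\<^bsub>N\<^esub> y)),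
      one = (\<one>\<^bsub>H\<^esub>, \<one>\<^bsub>N\<^esub>)\<rparr>"

end

theory Submission
  imports Defs
begin

text \<open>
  Write \<open>mod(f)\<close> for the factor by which a topological automorphism \<open>f\<close> of \<open>N\<close> scales left Haar
  measure, and \<open>G\<close> for the semidirect product. The theorem rests on the formula
  \<open>\<Delta>\<^sub>G(t, y) = \<Delta>\<^sub>H(t) \<Delta>\<^sub>N(y) mod(\<alpha>(t\<inverse>))\<close> (\<open>semidirect_modular_function\<close>). Left translation by \<open>(s, x)\<close>
  moves the first coordinate by \<open>s\<close> and, above each \<open>t\<close>, the second one by a left translation of
  \<open>N\<close>, so \<open>f \<mapsto> \<integral>\<integral> f(t, y) dy dt\<close> is a left invariant functional; right translation by \<open>(t, y)\<close>
  acts above each \<open>s\<close> by a left translation of \<open>N\<close>, the automorphism \<open>\<alpha>(t\<inverse>)\<close> and a right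
  translation by \<open>y\<close>, which yields the three factors.

  Since \<open>\<alpha>(s) \<alpha>(s\<inverse>)\<close> is conjugation by \<open>c(s, s\<inverse>)\<close>, and conjugation by \<open>n\<close> has modulus
  \<open>\<Delta>\<^sub>N(n)\<inverse>\<close>, the quantity in the theorem is \<open>1 / mod(\<alpha>(s\<inverse>))\<close>. Its level set at \<open>1\<close> and the kernel
  of \<open>\<Delta>\<^sub>G\<close> are both open exactly when \<open>mod(\<alpha>(s\<inverse>)) = 1\<close> for all \<open>s\<close> near the identity
  (\<open>ratio_level_set_open_iff\<close>, \<open>semidirect_kernel_open_iff\<close>). The kernel is a subgroup, so only the
  identity matters; the level set need not be one, because \<open>s \<mapsto> mod(\<alpha>(s))\<close> is multiplicative only
  up to \<open>\<Delta>\<^sub>N(c(s, t))\<close>, but \<open>c(s, t)\<close> lies in the open kernel of \<open>\<Delta>\<^sub>N\<close> once \<open>t\<close> is close to the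
  identity. For discrete \<open>H\<close> the set containing only the identity is such a neighbourhood.

  To make sense of \<open>\<Delta>\<close> and \<open>mod\<close>, left Haar measures must exist and be unique up to a factor on
  groups without any countability. Existence (\<open>left_haar_measure_exists\<close>) is Weil's construction:
  normalized covering numbers have a cluster point in a compact product of intervals, an invariant
  content on compact sets, which induces a Radon measure. Uniqueness
  (\<open>left_invariant_functional_unique\<close>) compares a measure with an arbitrary left invariant positive
  functional on continuous functions of compact support, and so applies to the iterated integral
  above, which is not given by a product measure: the product of the Borel sigma-algebras can be
  smaller than the Borel sigma-algebra of the product. Functionals also give a Fubini theorem
  (\<open>functional_integral_exchange\<close>) in the absence of sigma-finiteness.
\<close>

text \<open>The symbol is freed for left cosets.\<close>

no_notation subset_mset (infix \<open><#\<close> 50)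

section \<open>The Borel sets of an abstract topology\<close>

abbreviation borel_on :: "'a topology \<Rightarrow> 'a measure" where
  "borel_on T \<equiv> sigma (topspace T) {U. openin T U}"

lemma space_borel_on [simp]: "space (borel_on T) = topspace T"
  by (auto simp: space_measure_of_conv)

lemma openin_sets_borel_on: "openin T U \<Longrightarrow> U \<in> sets (borel_on T)"
  by (subst sets_measure_of) (auto dest: openin_subset)

lemma closedin_sets_borel_on:
  assumes "closedin T C" shows "C \<in> sets (borel_on T)"
proof -
  have "topspace T - (topspace T - C) \<in> sets (borel_on T)"
    using assms openin_sets_borel_on[of T "topspace T - C"]
    by (metis closedin_def sets.compl_sets space_borel_on)
  then show ?thesis
    using assms by (simp add: closedin_def double_diff)
qed

lemma compactin_sets_borel_on: "Hausdorff_space T \<Longrightarrow> compactin T K \<Longrightarrow> K \<in> sets (borel_on T)"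
  by (simp add: closedin_sets_borel_on compactin_imp_closedin)

lemma continuous_map_measurable_borel_on:
  assumes "continuous_map S T f" shows "f \<in> borel_on S \<rightarrow>\<^sub>M borel_on T"
proof (rule measurable_measure_of)
  show "{U. openin T U} \<subseteq> Pow (topspace T)"
    by (auto dest: openin_subset)
  show "f \<in> space (borel_on S) \<rightarrow> topspace T"
    using assms by (auto simp: continuous_map_def)
  fix U assume "U \<in> {U. openin T U}"
  then have "openin S {x \<in> topspace S. f x \<in> U}"
    using assms by (auto simp: continuous_map_def)
  moreover have "f -` U \<inter> space (borel_on S) = {x \<in> topspace S. f x \<in> U}"
    by auto
  ultimately show "f -` U \<inter> space (borel_on S) \<in> sets (borel_on S)"
    by (simp add: openin_sets_borel_on)
qed

text \<open>The image under \<open>\<theta>\<close> is the preimage under its continuous inverse.\<close>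

lemma borel_homeomorphic_image:
  assumes \<theta>: "homeomorphic_map T T \<theta>" and E: "E \<in> sets (borel_on T)"
  shows "\<theta> ` E \<in> sets (borel_on T)"
proof -
  obtain \<eta> where \<eta>: "homeomorphic_maps T T \<theta> \<eta>"
    using \<theta> by (auto simp: homeomorphic_map_maps)
  have \<theta>\<eta>: "\<And>x. x \<in> topspace T \<Longrightarrow> \<eta> (\<theta> x) = x" "\<And>x. x \<in> topspace T \<Longrightarrow> \<theta> (\<eta> x) = x"
    "\<And>x. x \<in> topspace T \<Longrightarrow> \<theta> x \<in> topspace T"
    using \<eta> by (auto simp: homeomorphic_maps_def continuous_map_def)
  have sub: "x \<in> topspace T" if "x \<in> E" for x
    using sets.sets_into_space[OF E] that by auto
  have "\<eta> -` E \<inter> space (borel_on T) = \<theta> ` E"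
  proof (intro equalityI subsetI)
    fix x assume "x \<in> \<eta> -` E \<inter> space (borel_on T)"
    then show "x \<in> \<theta> ` E"
      using \<theta>\<eta>(2)[of x] by (intro image_eqI[of _ _ "\<eta> x"]) auto
  qed (use \<theta>\<eta>(1,3) sub in auto)
  moreover have "\<eta> \<in> borel_on T \<rightarrow>\<^sub>M borel_on T"
    using \<eta> by (intro continuous_map_measurable_borel_on) (simp add: homeomorphic_maps_def)
  ultimately show ?thesis
    using measurable_sets[of \<eta> "borel_on T" "borel_on T" E] E by simp
qed

lemma continuous_map_borel_measurable:
  fixes f :: "'a \<Rightarrow> real"
  assumes "continuous_map T euclidean f" shows "f \<in> borel_measurable (borel_on T)"
proof (rule borel_measurableI)
  fix S :: "real set" assume "open S"
  then have "openin T {x \<in> topspace T. f x \<in> S}"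
    using assms by (auto simp: continuous_map_def)
  moreover have "f -` S \<inter> space (borel_on T) = {x \<in> topspace T. f x \<in> S}"
    by auto
  ultimately show "f -` S \<inter> space (borel_on T) \<in> sets (borel_on T)"
    by (simp add: openin_sets_borel_on)
qed

section \<open>Continuous functions with compact support\<close>

definition Cc :: "'a topology \<Rightarrow> ('a \<Rightarrow> real) set" where
  "Cc T = {f. continuous_map T euclidean f \<and>
     (\<exists>K. compactin T K \<and> (\<forall>x\<in>topspace T - K. f x = 0))}"

lemma CcI:
  "\<lbrakk>continuous_map T euclidean f; compactin T K; \<And>x. \<lbrakk>x \<in> topspace T; x \<notin> K\<rbrakk> \<Longrightarrow> f x = 0\<rbrakk> \<Longrightarrow> f \<in> Cc T"
  by (auto simp: Cc_def)

lemma Cc_continuous: "f \<in> Cc T \<Longrightarrow> continuous_map T euclidean f"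
  by (simp add: Cc_def)

lemma CcE:
  assumes "f \<in> Cc T"
  obtains K where "compactin T K" "\<And>x. \<lbrakk>x \<in> topspace T; x \<notin> K\<rbrakk> \<Longrightarrow> f x = 0"
  using assms by (auto simp: Cc_def)

lemma Cc_cong:
  assumes "f \<in> Cc T" "\<And>x. x \<in> topspace T \<Longrightarrow> f x = g x" shows "g \<in> Cc T"
proof -
  obtain K where "compactin T K" "\<And>x. \<lbrakk>x \<in> topspace T; x \<notin> K\<rbrakk> \<Longrightarrow> f x = 0"
    by (fact CcE[OF assms(1)])
  then show ?thesis
    using continuous_map_eq[OF Cc_continuous[OF assms(1)] assms(2)] assms(2)
    by (intro CcI[of _ _ K]) auto
qed

lemma Cc_zero: "(\<lambda>x. 0) \<in> Cc T"
  by (rule CcI[of _ _ "{}"]) auto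

lemma Cc_add:
  assumes "f \<in> Cc T" "g \<in> Cc T" shows "(\<lambda>x. f x + g x) \<in> Cc T"
proof -
  obtain K where K: "compactin T K" "\<And>x. \<lbrakk>x \<in> topspace T; x \<notin> K\<rbrakk> \<Longrightarrow> f x = 0"
    by (fact CcE[OF assms(1)])
  obtain L where L: "compactin T L" "\<And>x. \<lbrakk>x \<in> topspace T; x \<notin> L\<rbrakk> \<Longrightarrow> g x = 0"
    by (fact CcE[OF assms(2)])
  show ?thesis
    using assms[THEN Cc_continuous] K L
    by (intro CcI[of _ _ "K \<union> L"] continuous_map_add compactin_Un) auto
qed

lemma Cc_mult_continuous:
  assumes "f \<in> Cc T" "continuous_map T euclidean g" shows "(\<lambda>x. f x * g x) \<in> Cc T"
proof -
  obtain K where "compactin T K" "\<And>x. \<lbrakk>x \<in> topspace T; x \<notin> K\<rbrakk> \<Longrightarrow> f x = 0"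
    by (fact CcE[OF assms(1)])
  then show ?thesis
    using Cc_continuous[OF assms(1)] assms(2)
    by (intro CcI[of _ _ K] continuous_map_real_mult) auto
qed

lemma Cc_cmult: "f \<in> Cc T \<Longrightarrow> (\<lambda>x. a * f x) \<in> Cc T"
  using Cc_mult_continuous[of f T "\<lambda>_. a"] by (simp add: mult.commute)

lemma Cc_diff: "f \<in> Cc T \<Longrightarrow> g \<in> Cc T \<Longrightarrow> (\<lambda>x. f x - g x) \<in> Cc T"
  using Cc_add[of f T "\<lambda>x. -1 * g x"] Cc_cmult[of g T "-1"] by simp

lemma Cc_sum: "(\<And>i. i \<in> I \<Longrightarrow> f i \<in> Cc T) \<Longrightarrow> (\<lambda>x. \<Sum>i\<in>I. f i x) \<in> Cc T"
  by (induction I rule: infinite_finite_induct) (auto intro: Cc_zero Cc_add)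

lemma Cc_homeomorphic:
  assumes "f \<in> Cc T" "homeomorphic_map S T \<theta>" shows "(\<lambda>x. f (\<theta> x)) \<in> Cc S"
proof -
  obtain \<eta> where \<eta>: "homeomorphic_maps S T \<theta> \<eta>"
    using assms(2) by (auto simp: homeomorphic_map_maps)
  obtain K where K: "compactin T K" "\<And>x. \<lbrakk>x \<in> topspace T; x \<notin> K\<rbrakk> \<Longrightarrow> f x = 0"
    by (fact CcE[OF assms(1)])
  show ?thesis
  proof (rule CcI[of _ _ "\<eta> ` K"])
    show "continuous_map S euclidean (\<lambda>x. f (\<theta> x))"
      using continuous_map_compose[of S T \<theta> euclidean f] \<eta> assms(1)
      by (auto simp: homeomorphic_maps_def o_def Cc_continuous)
    show "compactin S (\<eta> ` K)"
      using K(1) \<eta> image_compactin by (auto simp: homeomorphic_maps_def)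
    show "f (\<theta> x) = 0" if "x \<in> topspace S" "x \<notin> \<eta> ` K" for x
    proof (rule K(2))
      show "\<theta> x \<in> topspace T"
        using \<eta> that(1) by (auto simp: homeomorphic_maps_def continuous_map_def)
      show "\<theta> x \<notin> K"
        using \<eta> that by (metis homeomorphic_maps_def image_eqI)
    qed
  qed
qed

text \<open>
  Urysohn's lemma in a locally compact Hausdorff space, cut off inside a compact neighbourhood
  of \<open>K\<close>.
\<close>

lemma Cc_bump:
  assumes T: "Hausdorff_space T" "locally_compact_space T"
    and K: "compactin T K" and U: "openin T U" "K \<subseteq> U"
  obtains f where "f \<in> Cc T" "\<And>x. x \<in> topspace T \<Longrightarrow> 0 \<le> f x \<and> f x \<le> 1"
    "\<And>x. x \<in> K \<Longrightarrow> f x = 1" "\<And>x. \<lbrakk>x \<in> topspace T; x \<notin> U\<rbrakk> \<Longrightarrow> f x = 0"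
proof -
  obtain V L where V: "openin T V" "compactin T L" "closedin T L" "K \<subseteq> V" "V \<subseteq> L"
    using T K locally_compact_space_compact_closed_compact[of T] by blast
  have cr: "completely_regular_space T"
    using T locally_compact_Hausdorff_imp_regular_space
      locally_compact_regular_imp_completely_regular_space by blast
  have "closedin T (topspace T - U \<inter> V)" "disjnt K (topspace T - U \<inter> V)"
    using U V by (auto simp: disjnt_def)
  then obtain f where f: "continuous_map T (subtopology euclideanreal {0..1}) f"
    "f ` (topspace T - U \<inter> V) \<subseteq> {0}" "f ` K \<subseteq> {1}"
    using Urysohn_completely_regular_compact_closed[OF zero_le_one cr K] by metis
  show thesis
  proof (rule that)
    show "f \<in> Cc T"
    proof (rule CcI[of _ _ L])
      show "continuous_map T euclidean f"
        using f(1) by (simp add: continuous_map_in_subtopology)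
      show "f x = 0" if "x \<in> topspace T" "x \<notin> L" for x
      proof -
        have "x \<in> topspace T - U \<inter> V" using V(5) that by blast
        then show ?thesis using f(2) by (simp add: image_subset_iff)
      qed
    qed (rule V(2))
    show "0 \<le> f x \<and> f x \<le> 1" if "x \<in> topspace T" for x
      using f(1) that by (auto simp: continuous_map_in_subtopology)
    show "f x = 1" if "x \<in> K" for x
      using f(3) that by auto
    show "f x = 0" if "x \<in> topspace T" "x \<notin> U" for x
      using f(2) that by auto
  qed
qed

definition positive_functional :: "'a topology \<Rightarrow> (('a \<Rightarrow> real) \<Rightarrow> real) \<Rightarrow> bool" where
  "positive_functional T J \<longleftrightarrow>
     (\<forall>f\<in>Cc T. \<forall>g\<in>Cc T. J (\<lambda>x. f x + g x) = J f + J g) \<and>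
     (\<forall>f\<in>Cc T. \<forall>a. J (\<lambda>x. a * f x) = a * J f) \<and>
     (\<forall>f\<in>Cc T. (\<forall>x\<in>topspace T. 0 \<le> f x) \<longrightarrow> 0 \<le> J f)"

context
  fixes T :: "'a topology" and J :: "('a \<Rightarrow> real) \<Rightarrow> real"
  assumes J: "positive_functional T J"
begin

lemma functional_add: "f \<in> Cc T \<Longrightarrow> g \<in> Cc T \<Longrightarrow> J (\<lambda>x. f x + g x) = J f + J g"
  using J by (simp add: positive_functional_def)

lemma functional_cmult: "f \<in> Cc T \<Longrightarrow> J (\<lambda>x. a * f x) = a * J f"
  using J by (simp add: positive_functional_def)

lemma functional_nonneg: "f \<in> Cc T \<Longrightarrow> (\<And>x. x \<in> topspace T \<Longrightarrow> 0 \<le> f x) \<Longrightarrow> 0 \<le> J f"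
  using J by (simp add: positive_functional_def)

lemma functional_zero: "J (\<lambda>x. 0) = 0"
  using functional_cmult[OF Cc_zero, of 0] by simp

lemma functional_diff: "f \<in> Cc T \<Longrightarrow> g \<in> Cc T \<Longrightarrow> J (\<lambda>x. f x - g x) = J f - J g"
  using functional_add[of f "\<lambda>x. -1 * g x"] functional_cmult[of g "-1"] Cc_cmult[of g T "-1"] by simp

lemma functional_mono:
  assumes "f \<in> Cc T" "g \<in> Cc T" "\<And>x. x \<in> topspace T \<Longrightarrow> f x \<le> g x"
  shows "J f \<le> J g"
  using functional_nonneg[OF Cc_diff[OF assms(2,1)]] functional_diff[OF assms(2,1)] assms(3) by simp

text \<open>Positivity forces a functional to ignore the values of a function outside the space.\<close>

lemma functional_cong:
  assumes "f \<in> Cc T" "g \<in> Cc T" "\<And>x. x \<in> topspace T \<Longrightarrow> f x = g x"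
  shows "J f = J g"
  using functional_mono[of f g] functional_mono[of g f] assms by fastforce

lemma functional_sum:
  "(\<And>i. i \<in> I \<Longrightarrow> f i \<in> Cc T) \<Longrightarrow> J (\<lambda>x. \<Sum>i\<in>I. f i x) = (\<Sum>i\<in>I. J (f i))"
  by (induction I rule: infinite_finite_induct) (auto simp: functional_zero functional_add Cc_sum)

text \<open>
  A positive functional is bounded on the functions supported in a fixed compact set: compare
  with a multiple of a bump that is \<open>1\<close> on this set.
\<close>

lemma functional_bound:
  assumes T: "Hausdorff_space T" "locally_compact_space T" and K: "compactin T K"
  obtains B where "0 \<le> B"
    "\<And>f e. \<lbrakk>f \<in> Cc T; \<And>x. x \<in> K \<Longrightarrow> \<bar>f x\<bar> \<le> e;
       \<And>x. \<lbrakk>x \<in> topspace T; x \<notin> K\<rbrakk> \<Longrightarrow> f x = 0; 0 \<le> e\<rbrakk> \<Longrightarrow> \<bar>J f\<bar> \<le> e * B"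
proof -
  obtain b where b: "b \<in> Cc T" "\<And>x. x \<in> topspace T \<Longrightarrow> 0 \<le> b x \<and> b x \<le> 1" "\<And>x. x \<in> K \<Longrightarrow> b x = 1"
    using Cc_bump[OF T K openin_topspace] K compactin_subset_topspace by metis
  show thesis
  proof (rule that[of "J b"])
    show "0 \<le> J b"
      using functional_nonneg b by auto
    fix f e assume f: "f \<in> Cc T" "\<And>x. x \<in> K \<Longrightarrow> \<bar>f x\<bar> \<le> e"
      "\<And>x. \<lbrakk>x \<in> topspace T; x \<notin> K\<rbrakk> \<Longrightarrow> f x = 0" and e: "(0::real) \<le> e"
    have *: "\<bar>f x\<bar> \<le> e * b x" if "x \<in> topspace T" for x
      by (cases "x \<in> K") (use f b e that in auto)
    have "J f \<le> J (\<lambda>x. e * b x)"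
      using f(1) b(1) * by (intro functional_mono Cc_cmult) fastforce+
    moreover have "J (\<lambda>x. - e * b x) \<le> J f"
      using f(1) b(1) * by (intro functional_mono Cc_cmult) fastforce+
    ultimately show "\<bar>J f\<bar> \<le> e * J b"
      using functional_cmult[OF b(1), of e] functional_cmult[OF b(1), of "-e"] by simp
  qed
qed

end

section \<open>Radon measures\<close>

definition radon_measure :: "'a topology \<Rightarrow> 'a measure \<Rightarrow> bool" where
  "radon_measure T M \<longleftrightarrow>
     sets M = sets (borel_on T) \<and>
     (\<forall>K. compactin T K \<longrightarrow> emeasure M K < \<infinity>) \<and>
     (\<forall>E\<in>sets M. emeasure M E = (INF U\<in>{U. openin T U \<and> E \<subseteq> U}. emeasure M U)) \<and>
     (\<forall>U. openin T U \<longrightarrow>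
        emeasure M U = (SUP K\<in>{K. compactin T K \<and> K \<subseteq> U}. emeasure M K))"

lemma left_haar_measure_iff_radon:
  "left_haar_measure G T M \<longleftrightarrow> radon_measure T M \<and> emeasure M (space M) \<noteq> 0 \<and>
     (\<forall>x\<in>carrier G. \<forall>E\<in>sets M. emeasure M (x <#\<^bsub>G\<^esub> E) = emeasure M E)"
  unfolding left_haar_measure_def radon_measure_def by blast

context
  fixes T :: "'a topology" and M :: "'a measure"
  assumes T: "Hausdorff_space T" "locally_compact_space T"
    and M: "radon_measure T M"
begin

lemma radon_sets: "sets M = sets (borel_on T)"
  using M by (simp add: radon_measure_def)

lemma radon_space: "space M = topspace T"
  using sets_eq_imp_space_eq[OF radon_sets] by simp

lemma radon_open: "openin T U \<Longrightarrow> U \<in> sets M"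
  by (simp add: radon_sets openin_sets_borel_on)

lemma radon_compact: "compactin T K \<Longrightarrow> K \<in> sets M"
  using T by (simp add: radon_sets compactin_sets_borel_on)

lemma radon_compact_finite: "compactin T K \<Longrightarrow> emeasure M K < \<infinity>"
  using M by (simp add: radon_measure_def)

lemma radon_measurable: "f \<in> Cc T \<Longrightarrow> f \<in> borel_measurable M"
  using continuous_map_borel_measurable[OF Cc_continuous] radon_sets measurable_cong_sets by blast

lemma radon_integrable:
  assumes f: "f \<in> Cc T" shows "integrable M f"
proof -
  obtain K where K: "compactin T K" "\<And>x. \<lbrakk>x \<in> topspace T; x \<notin> K\<rbrakk> \<Longrightarrow> f x = 0"
    by (fact CcE[OF f])
  have "compact (f ` K)"
    using image_compactin[OF K(1) Cc_continuous[OF f]] by simp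
  then obtain B where "\<And>x. x \<in> K \<Longrightarrow> norm (f x) \<le> B"
    using bounded_iff compact_imp_bounded by (metis imageI)
  then show ?thesis
    using K f radon_space
    by (intro integrableI_bounded_set[of K _ _ B] radon_compact radon_measurable radon_compact_finite) auto
qed

lemma radon_positive_functional: "positive_functional T (\<lambda>f. \<integral>x. f x \<partial>M)"
  unfolding positive_functional_def
  by (auto intro!: Bochner_Integration.integral_add radon_integrable Bochner_Integration.integral_nonneg simp: radon_space)

lemma radon_nn_integral:
  assumes "f \<in> Cc T" "\<And>x. x \<in> topspace T \<Longrightarrow> 0 \<le> f x"
  shows "(\<integral>\<^sup>+x. ennreal (f x) \<partial>M) = ennreal (\<integral>x. f x \<partial>M)"
  using assms radon_space by (intro nn_integral_eq_integral radon_integrable) auto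

lemma radon_bump_bounds:
  assumes K: "compactin T K" and U: "openin T U"
    and f: "f \<in> Cc T" "\<And>x. x \<in> topspace T \<Longrightarrow> 0 \<le> f x \<and> f x \<le> 1"
    "\<And>x. x \<in> K \<Longrightarrow> f x = 1" "\<And>x. \<lbrakk>x \<in> topspace T; x \<notin> U\<rbrakk> \<Longrightarrow> f x = 0"
  shows "emeasure M K \<le> ennreal (\<integral>x. f x \<partial>M)" "ennreal (\<integral>x. f x \<partial>M) \<le> emeasure M U"
proof -
  have "emeasure M K = (\<integral>\<^sup>+x. indicator K x \<partial>M)"
    by (simp add: radon_compact K)
  also have "\<dots> \<le> (\<integral>\<^sup>+x. ennreal (f x) \<partial>M)"
    using f(3) by (intro nn_integral_mono) (auto split: split_indicator)
  finally show "emeasure M K \<le> ennreal (\<integral>x. f x \<partial>M)"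
    using radon_nn_integral[of f] f by simp
  have "(\<integral>\<^sup>+x. ennreal (f x) \<partial>M) \<le> (\<integral>\<^sup>+x. indicator U x \<partial>M)"
    using f(2,4) radon_space by (intro nn_integral_mono) (auto split: split_indicator)
  also have "\<dots> = emeasure M U"
    by (simp add: radon_open U)
  finally show "ennreal (\<integral>x. f x \<partial>M) \<le> emeasure M U"
    using radon_nn_integral[of f] f by simp
qed

end

text \<open>
  By regularity a Radon measure is determined by its integrals of bump functions: these
  approximate compact subsets of an open set from above and the open set from below.
\<close>

lemma radon_measure_proportional:
  assumes T: "Hausdorff_space T" "locally_compact_space T"
    and M: "radon_measure T M" and M': "radon_measure T M'"
    and r: "0 < r" and int: "\<And>f. f \<in> Cc T \<Longrightarrow> (\<integral>x. f x \<partial>M) = r * (\<integral>x. f x \<partial>M')"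
    and E: "E \<in> sets M"
  shows "emeasure M E = ennreal r * emeasure M' E"
proof -
  have le: "emeasure M1 U \<le> ennreal q * emeasure M2 U"
    if M1: "radon_measure T M1" and M2: "radon_measure T M2" and q: "0 < q"
      and int: "\<And>f. f \<in> Cc T \<Longrightarrow> (\<integral>x. f x \<partial>M1) = q * (\<integral>x. f x \<partial>M2)" and U: "openin T U"
    for M1 M2 q U
  proof -
    have "emeasure M1 U = (SUP K\<in>{K. compactin T K \<and> K \<subseteq> U}. emeasure M1 K)"
      using M1 U by (simp add: radon_measure_def)
    also have "\<dots> \<le> ennreal q * emeasure M2 U"
    proof (rule SUP_least, clarify)
      fix K assume K: "compactin T K" "K \<subseteq> U"
      obtain f where f: "f \<in> Cc T" "\<And>x. x \<in> topspace T \<Longrightarrow> 0 \<le> f x \<and> f x \<le> 1"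
        "\<And>x. x \<in> K \<Longrightarrow> f x = 1" "\<And>x. \<lbrakk>x \<in> topspace T; x \<notin> U\<rbrakk> \<Longrightarrow> f x = 0"
        using Cc_bump[OF T K(1) U K(2)] by metis
      have "emeasure M1 K \<le> ennreal (\<integral>x. f x \<partial>M1)"
        by (rule radon_bump_bounds[OF T M1 K(1) U f])
      also have "\<dots> = ennreal q * ennreal (\<integral>x. f x \<partial>M2)"
        using int[OF f(1)] q by (simp add: ennreal_mult')
      also have "\<dots> \<le> ennreal q * emeasure M2 U"
        by (intro mult_left_mono radon_bump_bounds[OF T M2 K(1) U f]) auto
      finally show "emeasure M1 K \<le> ennreal q * emeasure M2 U" .
    qed
    finally show ?thesis .
  qed
  have inv: "ennreal r * (ennreal (1 / r) * a) = a" for a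
    using r by (simp add: mult.assoc[symmetric] ennreal_mult[symmetric])
  have inv': "ennreal (1 / r) * (ennreal r * a) = a" for a
    using r by (simp add: mult.assoc[symmetric] ennreal_mult[symmetric])
  have eq: "emeasure M U = ennreal r * emeasure M' U" if U: "openin T U" for U
  proof (rule antisym)
    show "emeasure M U \<le> ennreal r * emeasure M' U"
      by (rule le[OF M M' r int U])
    have "emeasure M' U \<le> ennreal (1 / r) * emeasure M U"
      by (rule le[OF M' M _ _ U]) (use r int in auto)
    then show "ennreal r * emeasure M' U \<le> emeasure M U"
      using mult_left_mono[of "emeasure M' U" "ennreal (1 / r) * emeasure M U" "ennreal r"] inv by simp
  qed
  have E': "E \<in> sets M'"
    using E M M' by (simp add: radon_measure_def)
  have outer: "emeasure M E = (INF U\<in>{U. openin T U \<and> E \<subseteq> U}. emeasure M U)"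
    "emeasure M' E = (INF U\<in>{U. openin T U \<and> E \<subseteq> U}. emeasure M' U)"
    using E E' M M' by (auto simp: radon_measure_def)
  show ?thesis
  proof (rule antisym)
    have "ennreal (1 / r) * emeasure M E \<le> emeasure M' E"
      unfolding outer(2)
    proof (rule INF_greatest, clarify)
      fix U assume U: "openin T U" "E \<subseteq> U"
      have "emeasure M E \<le> emeasure M U"
        unfolding outer(1) using U by (intro INF_lower) auto
      then show "ennreal (1 / r) * emeasure M E \<le> emeasure M' U"
        using mult_left_mono[of "emeasure M E" "emeasure M U" "ennreal (1 / r)"] eq[OF U(1)] inv' by simp
    qed
    then show "emeasure M E \<le> ennreal r * emeasure M' E"
      using mult_left_mono[of "ennreal (1 / r) * emeasure M E" "emeasure M' E" "ennreal r"] inv by simp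
    show "ennreal r * emeasure M' E \<le> emeasure M E"
      unfolding outer(1)
    proof (rule INF_greatest, clarify)
      fix U assume U: "openin T U" "E \<subseteq> U"
      have "emeasure M' E \<le> emeasure M' U"
        unfolding outer(2) using U by (intro INF_lower) auto
      then show "ennreal r * emeasure M' E \<le> emeasure M U"
        using eq[OF U(1)] by (simp add: mult_left_mono)
    qed
  qed
qed

section \<open>Slices of functions on a product and Fubini's theorem\<close>

lemma Cc_prod_support:
  assumes "F \<in> Cc (prod_topology X Y)"
  obtains K L where "compactin X K" "compactin Y L"
    "\<And>s y. \<lbrakk>s \<in> topspace X; y \<in> topspace Y; s \<notin> K \<or> y \<notin> L\<rbrakk> \<Longrightarrow> F (s, y) = 0"
proof -
  obtain C where C: "compactin (prod_topology X Y) C"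
    "\<And>z. \<lbrakk>z \<in> topspace (prod_topology X Y); z \<notin> C\<rbrakk> \<Longrightarrow> F z = 0"
    by (fact CcE[OF assms])
  show thesis
  proof (rule that[of "fst ` C" "snd ` C"])
    show "compactin X (fst ` C)" "compactin Y (snd ` C)"
      using C(1) image_compactin continuous_map_fst continuous_map_snd by blast+
    show "F (s, y) = 0" if "s \<in> topspace X" "y \<in> topspace Y" "s \<notin> fst ` C \<or> y \<notin> snd ` C" for s y
      using C(2)[of "(s, y)"] that by force
  qed
qed

lemma Cc_tensor:
  assumes f: "f \<in> Cc X" and g: "g \<in> Cc Y"
  shows "(\<lambda>(s, y). f s * g y) \<in> Cc (prod_topology X Y)"
proof -
  obtain K where K: "compactin X K" "\<And>x. \<lbrakk>x \<in> topspace X; x \<notin> K\<rbrakk> \<Longrightarrow> f x = 0"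
    by (fact CcE[OF f])
  obtain L where L: "compactin Y L" "\<And>x. \<lbrakk>x \<in> topspace Y; x \<notin> L\<rbrakk> \<Longrightarrow> g x = 0"
    by (fact CcE[OF g])
  have "continuous_map (prod_topology X Y) euclidean (\<lambda>z. f (fst z) * g (snd z))"
    using continuous_map_compose[OF continuous_map_fst Cc_continuous[OF f]]
      continuous_map_compose[OF continuous_map_snd Cc_continuous[OF g]]
    by (intro continuous_map_real_mult) (auto simp: o_def)
  moreover have "compactin (prod_topology X Y) (K \<times> L)"
    using K L by (simp add: compactin_Times)
  ultimately show ?thesis
    using K(2) L(2) by (intro CcI[of _ _ "K \<times> L"]) (force simp: case_prod_beta')+
qed

lemma Cc_swap:
  assumes "F \<in> Cc (prod_topology X Y)"
  shows "(\<lambda>(y, s). F (s, y)) \<in> Cc (prod_topology Y X)"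
  using Cc_homeomorphic[OF assms homeomorphic_map_swap] by (simp add: case_prod_beta')

text \<open>
  The tube lemma: \<open>F\<close> is close to its value on the slice in a neighbourhood of
  \<open>{s0} \<times> L\<close>, which contains a product \<open>U \<times> V\<close>; outside \<open>L\<close> both functions vanish.
\<close>

lemma slices_uniformly_close:
  assumes F: "continuous_map (prod_topology X Y) euclideanreal F" and L: "compactin Y L"
    and supp: "\<And>s y. \<lbrakk>s \<in> topspace X; y \<in> topspace Y; y \<notin> L\<rbrakk> \<Longrightarrow> F (s, y) = 0"
    and s0: "s0 \<in> topspace X" and e: "0 < e"
  obtains U where "openin X U" "s0 \<in> U"
    "\<And>s y. \<lbrakk>s \<in> U; y \<in> topspace Y\<rbrakk> \<Longrightarrow> \<bar>F (s, y) - F (s0, y)\<bar> < e"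
proof -
  define W where "W = {z \<in> topspace (prod_topology X Y). \<bar>F z - F (s0, snd z)\<bar> < e}"
  have "continuous_map (prod_topology X Y) (prod_topology X Y) (\<lambda>z. (s0, snd z))"
    using s0 by (intro continuous_map_pairedI continuous_map_snd) simp
  then have "continuous_map (prod_topology X Y) euclideanreal (\<lambda>z. F (s0, snd z))"
    using continuous_map_compose[OF _ F] by (fastforce simp: o_def)
  then have cont: "continuous_map (prod_topology X Y) euclideanreal (\<lambda>z. \<bar>F z - F (s0, snd z)\<bar>)"
    using F by (intro continuous_map_real_abs continuous_map_diff)
  have "W = {z \<in> topspace (prod_topology X Y). \<bar>F z - F (s0, snd z)\<bar> \<in> {..<e}}"
    by (auto simp: W_def)
  then have W: "openin (prod_topology X Y) W"
    using openin_continuous_map_preimage[OF cont, of "{..<e}"] by simp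
  have "{s0} \<times> L \<subseteq> W"
    using s0 L e compactin_subset_topspace by (fastforce simp: W_def)
  then obtain U V where UV: "openin X U" "openin Y V" "s0 \<in> U" "L \<subseteq> V" "U \<times> V \<subseteq> W"
    using Wallace_theorem_prod_topology[of X "{s0}" Y L W] s0 L W by auto
  show thesis
  proof (rule that[of U])
    fix s y assume s: "s \<in> U" and y: "y \<in> topspace Y"
    have "s \<in> topspace X"
      using UV(1) s openin_subset by blast
    show "\<bar>F (s, y) - F (s0, y)\<bar> < e"
    proof (cases "y \<in> L")
      case True
      then show ?thesis using UV s y by (force simp: W_def)
    next
      case False
      then show ?thesis using supp[of s y] supp[of s0 y] \<open>s \<in> topspace X\<close> s0 y e by simp
    qed
  qed (use UV in auto)
qed

lemma Cc_slice:
  assumes F: "F \<in> Cc (prod_topology X Y)" and s: "s \<in> topspace X"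
  shows "(\<lambda>y. F (s, y)) \<in> Cc Y"
proof -
  obtain K L where KL: "compactin X K" "compactin Y L"
    "\<And>s y. \<lbrakk>s \<in> topspace X; y \<in> topspace Y; s \<notin> K \<or> y \<notin> L\<rbrakk> \<Longrightarrow> F (s, y) = 0"
    by (fact Cc_prod_support[OF F])
  have "continuous_map Y (prod_topology X Y) (\<lambda>y. (s, y))"
    using s by (intro continuous_map_pairedI) auto
  then have "continuous_map Y euclideanreal (\<lambda>y. F (s, y))"
    using continuous_map_compose[OF _ Cc_continuous[OF F]] by (fastforce simp: o_def)
  then show ?thesis
    using KL s by (intro CcI[of _ _ L]) auto
qed

lemma Cc_slice_functional:
  assumes Y: "Hausdorff_space Y" "locally_compact_space Y"
    and J: "positive_functional Y J" and F: "F \<in> Cc (prod_topology X Y)"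
  shows "(\<lambda>s. J (\<lambda>y. F (s, y))) \<in> Cc X"
proof -
  obtain K L where KL: "compactin X K" "compactin Y L"
    "\<And>s y. \<lbrakk>s \<in> topspace X; y \<in> topspace Y; s \<notin> K \<or> y \<notin> L\<rbrakk> \<Longrightarrow> F (s, y) = 0"
    by (fact Cc_prod_support[OF F])
  obtain B where B: "0 \<le> B"
    "\<And>f e. \<lbrakk>f \<in> Cc Y; \<And>x. x \<in> L \<Longrightarrow> \<bar>f x\<bar> \<le> e;
       \<And>x. \<lbrakk>x \<in> topspace Y; x \<notin> L\<rbrakk> \<Longrightarrow> f x = 0; 0 \<le> e\<rbrakk> \<Longrightarrow> \<bar>J f\<bar> \<le> e * B"
    by (fact functional_bound[OF J Y KL(2)])
  show ?thesis
  proof (rule CcI[OF _ KL(1)])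
    show "continuous_map X euclideanreal (\<lambda>s. J (\<lambda>y. F (s, y)))"
      unfolding Met_TC.continuous_map_to_metric[unfolded mtopology_is_euclidean mball_eq_ball]
    proof (intro ballI allI impI)
      fix s0 and e :: real assume s0: "s0 \<in> topspace X" and e: "0 < e"
      \<comment> \<open>\<open>B\<close> may be \<open>0\<close>.\<close>
      define d where "d = e / (B + 1)"
      have d: "0 < d" "d * B < e"
        using e B(1) by (auto simp: d_def field_simps add_pos_nonneg)
      obtain U where U: "openin X U" "s0 \<in> U"
        "\<And>s y. \<lbrakk>s \<in> U; y \<in> topspace Y\<rbrakk> \<Longrightarrow> \<bar>F (s, y) - F (s0, y)\<bar> < d"
        by (rule slices_uniformly_close[OF Cc_continuous[OF F] KL(2) _ s0 d(1)]) (use KL(3) in blast)+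
      have "\<bar>J (\<lambda>y. F (s, y)) - J (\<lambda>y. F (s0, y))\<bar> < e" if s: "s \<in> U" for s
      proof -
        have s': "s \<in> topspace X"
          using U(1) s openin_subset by blast
        have L: "L \<subseteq> topspace Y"
          using KL(2) compactin_subset_topspace by blast
        have "\<bar>J (\<lambda>y. F (s, y) - F (s0, y))\<bar> \<le> d * B"
          using KL(3) s' s0 d(1) L
          by (intro B(2) Cc_diff Cc_slice[OF F]) (auto intro!: less_imp_le U(3)[OF s])
        then show ?thesis
          using functional_diff[OF J Cc_slice[OF F s'] Cc_slice[OF F s0]] d(2) by simp
      qed
      then show "\<exists>U. openin X U \<and> s0 \<in> U \<and> (\<forall>s\<in>U. J (\<lambda>y. F (s, y)) \<in> ball (J (\<lambda>y. F (s0, y))) e)"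
        using U by (auto simp: dist_real_def abs_minus_commute)
    qed
    show "J (\<lambda>y. F (s, y)) = 0" if s: "s \<in> topspace X" "s \<notin> K" for s
      using functional_cong[OF J Cc_slice[OF F s(1)] Cc_zero] functional_zero[OF J] KL(3) s by auto
  qed
qed

text \<open>
  Makes a finite open cover of a compact set disjoint, so that functions constant on the
  pieces can be integrated term by term.
\<close>

lemma finite_measurable_partition:
  assumes "finite S" "K \<in> sets M" "\<And>a. a \<in> S \<Longrightarrow> U a \<in> sets M" "K \<subseteq> (\<Union>a\<in>S. U a)"
  obtains B where "\<And>a. a \<in> S \<Longrightarrow> B a \<in> sets M" "\<And>a. a \<in> S \<Longrightarrow> B a \<subseteq> U a \<inter> K"
    "disjoint_family_on B S" "(\<Union>a\<in>S. B a) = K"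
  using assms
proof (induction S arbitrary: K thesis rule: finite_induct)
  case empty
  show ?case by (rule empty.prems(1)) (use empty.prems in \<open>auto simp: disjoint_family_on_def\<close>)
next
  case (insert a S)
  have "K - U a \<in> sets M" "\<And>a. a \<in> S \<Longrightarrow> U a \<in> sets M" "K - U a \<subseteq> (\<Union>a\<in>S. U a)"
    using insert.prems by auto
  with insert.IH obtain B where B: "\<And>a. a \<in> S \<Longrightarrow> B a \<in> sets M"
    "\<And>b. b \<in> S \<Longrightarrow> B b \<subseteq> U b \<inter> (K - U a)" "disjoint_family_on B S" "(\<Union>a\<in>S. B a) = K - U a"
    by metis
  show ?case
  proof (rule insert.prems(1)[of "B(a := K \<inter> U a)"])
    show "(B(a := K \<inter> U a)) b \<in> sets M" if "b \<in> insert a S" for b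
      using that B insert.prems by auto
    show "(B(a := K \<inter> U a)) b \<subseteq> U b \<inter> K" if "b \<in> insert a S" for b
      using that B(2) by auto
    show "disjoint_family_on (B(a := K \<inter> U a)) (insert a S)"
      using B(2,3) insert.hyps by (fastforce simp: disjoint_family_on_def)
    show "(\<Union>b\<in>insert a S. (B(a := K \<inter> U a)) b) = K"
      using B(4) insert.hyps by (auto split: if_splits)
  qed
qed

lemma sum_indicator_disjoint_family:
  fixes g :: "'b \<Rightarrow> real"
  assumes "finite S" "disjoint_family_on B S" "a \<in> S" "s \<in> B a"
  shows "(\<Sum>b\<in>S. indicator (B b) s * g b) = g a"
proof -
  have "indicator (B b) s * g b = (if b = a then g a else 0)" if "b \<in> S" for b
    using assms that by (auto simp: disjoint_family_on_def indicator_def)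
  then have "(\<Sum>b\<in>S. indicator (B b) s * g b) = (\<Sum>b\<in>S. if b = a then g a else 0)"
    by (rule sum.cong[OF refl])
  then show ?thesis
    using assms by simp
qed

text \<open>
  A Fubini theorem for a Radon measure on \<open>X\<close> and a positive functional on \<open>Y\<close>. A compactly
  supported \<open>F\<close> is uniformly close to a step function \<open>\<Sum>a. 1\<^bsub>P a\<^esub>(s) F(a, y)\<close> of \<open>s\<close>, for which both
  sides are the same finite sum. If \<open>F\<close> is supported in \<open>K \<times> L\<close>, the error is under control because
  \<open>K\<close> has finite measure and the functional is bounded on functions supported in \<open>L\<close>.
\<close>

theorem functional_integral_exchange:
  assumes X: "Hausdorff_space X" "locally_compact_space X"
    and Y: "Hausdorff_space Y" "locally_compact_space Y"
    and M: "radon_measure X M" and J: "positive_functional Y J"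
    and F: "F \<in> Cc (prod_topology X Y)"
  shows "J (\<lambda>y. \<integral>s. F (s, y) \<partial>M) = (\<integral>s. J (\<lambda>y. F (s, y)) \<partial>M)"
proof -
  obtain K L where KL: "compactin X K" "compactin Y L"
    "\<And>s y. \<lbrakk>s \<in> topspace X; y \<in> topspace Y; s \<notin> K \<or> y \<notin> L\<rbrakk> \<Longrightarrow> F (s, y) = 0"
    by (fact Cc_prod_support[OF F])
  have KX: "K \<subseteq> topspace X" and LY: "L \<subseteq> topspace Y"
    using KL(1,2) compactin_subset_topspace by blast+
  obtain B where B: "0 \<le> B"
    "\<And>f e. \<lbrakk>f \<in> Cc Y; \<And>x. x \<in> L \<Longrightarrow> \<bar>f x\<bar> \<le> e;
       \<And>x. \<lbrakk>x \<in> topspace Y; x \<notin> L\<rbrakk> \<Longrightarrow> f x = 0; 0 \<le> e\<rbrakk> \<Longrightarrow> \<bar>J f\<bar> \<le> e * B"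
    by (fact functional_bound[OF J Y KL(2)])
  have Ks: "K \<in> sets M" and Kf: "emeasure M K < \<infinity>"
    using radon_compact[OF X M KL(1)] radon_compact_finite[OF X M KL(1)] by auto
  define A where "A = (\<lambda>y. \<integral>s. F (s, y) \<partial>M)"
  define j where "j = (\<lambda>s. J (\<lambda>y. F (s, y)))"
  have A: "A \<in> Cc Y"
    unfolding A_def using Cc_slice_functional[OF X radon_positive_functional[OF X M] Cc_swap[OF F]] by simp
  have jC: "j \<in> Cc X"
    unfolding j_def by (rule Cc_slice_functional[OF Y J F])
  have intF: "integrable M (\<lambda>s. F (s, y))" if "y \<in> topspace Y" for y
    using radon_integrable[OF X M Cc_slice[OF Cc_swap[OF F] that]] by simp
  have slice: "(\<lambda>y. F (s, y)) \<in> Cc Y" if "s \<in> topspace X" for s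
    by (rule Cc_slice[OF F that])
  have int_close: "\<bar>(\<integral>s. u s \<partial>M) - (\<integral>s. v s \<partial>M)\<bar> \<le> d * measure M K"
    if u: "integrable M u" and v: "integrable M v"
      and uv: "\<And>s. s \<in> topspace X \<Longrightarrow> \<bar>u s - v s\<bar> \<le> indicator K s * d" for u v :: "'a \<Rightarrow> real" and d
  proof -
    have "\<bar>(\<integral>s. u s \<partial>M) - (\<integral>s. v s \<partial>M)\<bar> = \<bar>\<integral>s. u s - v s \<partial>M\<bar>"
      using u v by simp
    also have "\<dots> \<le> (\<integral>s. \<bar>u s - v s\<bar> \<partial>M)"
      by (rule integral_abs_bound)
    also have "\<dots> \<le> (\<integral>s. indicator K s * d \<partial>M)"
      using u v uv Ks Kf radon_space[OF X M] by (intro integral_mono) auto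
    also have "\<dots> = d * measure M K"
      using Ks Kf by simp
    finally show ?thesis .
  qed
  have bound: "\<bar>J A - (\<integral>s. j s \<partial>M)\<bar> \<le> e * (2 * B * measure M K)" if e: "0 < e" for e
  proof -
    have "\<forall>s\<in>K. \<exists>U. openin X U \<and> s \<in> U \<and> (\<forall>t\<in>U. \<forall>y\<in>topspace Y. \<bar>F (t, y) - F (s, y)\<bar> < e)"
    proof
      fix s assume "s \<in> K"
      then have "s \<in> topspace X" using KX by blast
      show "\<exists>U. openin X U \<and> s \<in> U \<and> (\<forall>t\<in>U. \<forall>y\<in>topspace Y. \<bar>F (t, y) - F (s, y)\<bar> < e)"
        by (rule slices_uniformly_close[OF Cc_continuous[OF F] KL(2) _ \<open>s \<in> topspace X\<close> e])
          (use KL(3) in blast)+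
    qed
    then obtain U where U: "\<And>s. s \<in> K \<Longrightarrow> openin X (U s)" "\<And>s. s \<in> K \<Longrightarrow> s \<in> U s"
      "\<And>s t y. \<lbrakk>s \<in> K; t \<in> U s; y \<in> topspace Y\<rbrakk> \<Longrightarrow> \<bar>F (t, y) - F (s, y)\<bar> < e"
      by metis
    obtain S where S: "finite S" "S \<subseteq> K" "K \<subseteq> (\<Union>s\<in>S. U s)"
    proof -
      have "\<exists>\<F>. finite \<F> \<and> \<F> \<subseteq> U ` K \<and> K \<subseteq> \<Union>\<F>"
        using KL(1) U(1,2) unfolding compactin_def by (elim conjE allE[of _ "U ` K"]) blast
      then show thesis
        using that by (metis finite_subset_image)
    qed
    obtain P where P: "\<And>a. a \<in> S \<Longrightarrow> P a \<in> sets M" "\<And>a. a \<in> S \<Longrightarrow> P a \<subseteq> U a \<inter> K"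
      "disjoint_family_on P S" "(\<Union>a\<in>S. P a) = K"
      by (rule finite_measurable_partition[OF S(1) Ks _ S(3)])
        (use radon_open[OF X M] U(1) S(2) in blast)+
    have Pf: "emeasure M (P a) < \<infinity>" if "a \<in> S" for a
      using emeasure_mono[of "P a" K M] P(2)[OF that] Ks Kf by (auto intro: le_less_trans)
    have SX: "a \<in> topspace X" if "a \<in> S" for a
      using that S(2) KX by blast
    have step: "\<bar>g s - (\<Sum>a\<in>S. indicator (P a) s * g a)\<bar> \<le> indicator K s * d"
      if s: "s \<in> topspace X" and close: "\<And>a. \<lbrakk>a \<in> S; s \<in> U a\<rbrakk> \<Longrightarrow> \<bar>g s - g a\<bar> \<le> d"
        and off: "s \<notin> K \<Longrightarrow> g s = 0" for g :: "'a \<Rightarrow> real" and s d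
    proof (cases "s \<in> K")
      case True
      then obtain a where a: "a \<in> S" "s \<in> P a"
        using P(4) by blast
      then have "s \<in> U a" using P(2) by blast
      then show ?thesis
        using sum_indicator_disjoint_family[OF S(1) P(3) a, of g] close[OF a(1)] True by simp
    next
      case False
      then have "indicator (P a) s = (0::real)" if "a \<in> S" for a
        using P(2)[OF that] by (auto simp: indicator_def)
      then show ?thesis using False off by simp
    qed
    have step_int: "integrable M (\<lambda>s. \<Sum>a\<in>S. indicator (P a) s * g a)"
      "(\<integral>s. (\<Sum>a\<in>S. indicator (P a) s * g a) \<partial>M) = (\<Sum>a\<in>S. measure M (P a) * g a)"
      for g :: "'a \<Rightarrow> real"
      using P(1) Pf by (auto simp: Bochner_Integration.integral_sum)
    define A' where "A' = (\<lambda>y. \<Sum>a\<in>S. measure M (P a) * F (a, y))"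
    have A': "A' \<in> Cc Y"
      unfolding A'_def by (intro Cc_sum Cc_cmult slice SX)
    have JA': "J A' = (\<Sum>a\<in>S. measure M (P a) * j a)"
      unfolding A'_def j_def
      by (subst functional_sum[OF J]) (auto intro!: sum.cong Cc_cmult slice SX simp: functional_cmult[OF J slice[OF SX]])
    have AA': "\<bar>A y - A' y\<bar> \<le> e * measure M K" if y: "y \<in> topspace Y" for y
      unfolding A_def A'_def step_int(2)[symmetric]
    proof (rule int_close[OF intF[OF y] step_int(1)])
      fix s assume s: "s \<in> topspace X"
      show "\<bar>F (s, y) - (\<Sum>a\<in>S. indicator (P a) s * F (a, y))\<bar> \<le> indicator K s * e"
        by (rule step[OF s]) (use S(2) y s KL(3) in \<open>auto intro!: less_imp_le U(3)\<close>)
    qed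
    have "\<bar>J (\<lambda>y. A y - A' y)\<bar> \<le> (e * measure M K) * B"
    proof (rule B(2)[OF Cc_diff[OF A A']])
      show "A x - A' x = 0" if "x \<in> topspace Y" "x \<notin> L" for x
      proof -
        have "A x = (\<integral>s. 0 \<partial>M)"
          unfolding A_def using that KL(3) radon_space[OF X M] by (intro Bochner_Integration.integral_cong) auto
        moreover have "A' x = 0"
          unfolding A'_def using that KL(3) SX by (intro sum.neutral) auto
        ultimately show ?thesis by simp
      qed
    qed (use AA' LY e in auto)
    then have 1: "\<bar>J A - J A'\<bar> \<le> (e * measure M K) * B"
      using functional_diff[OF J A A'] by simp
    have jj: "\<bar>j s - j a\<bar> \<le> e * B" if a: "a \<in> S" "s \<in> U a" for s a
    proof -
      have s: "s \<in> topspace X"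
        using a U(1) S(2) openin_subset by blast
      have "\<bar>J (\<lambda>y. F (s, y) - F (a, y))\<bar> \<le> e * B"
        by (rule B(2)[OF Cc_diff[OF slice[OF s] slice[OF SX[OF a(1)]]]])
          (use U(3)[of a s] a S(2) LY KL(3) s SX e in \<open>auto intro!: less_imp_le\<close>)
      then show ?thesis
        using functional_diff[OF J slice[OF s] slice[OF SX[OF a(1)]]] by (simp add: j_def)
    qed
    have j0: "j s = 0" if "s \<in> topspace X" "s \<notin> K" for s
      unfolding j_def using functional_cong[OF J slice[OF that(1)] Cc_zero] functional_zero[OF J] KL(3) that by auto
    have 2: "\<bar>(\<integral>s. j s \<partial>M) - J A'\<bar> \<le> (e * B) * measure M K"
      unfolding JA' step_int(2)[symmetric]
    proof (rule int_close[OF radon_integrable[OF X M jC] step_int(1)])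
      fix s assume s: "s \<in> topspace X"
      show "\<bar>j s - (\<Sum>a\<in>S. indicator (P a) s * j a)\<bar> \<le> indicator K s * (e * B)"
        by (rule step[OF s]) (use jj j0 s in auto)
    qed
    show ?thesis
      using 1 2 by (simp add: algebra_simps)
  qed
  have "\<bar>J A - (\<integral>s. j s \<partial>M)\<bar> \<le> 0"
  proof (rule field_le_epsilon)
    fix d :: real assume d: "0 < d"
    define c where "c = 2 * B * measure M K + 1"
    have c: "0 < c" using B(1) by (simp add: c_def add_nonneg_pos)
    have "\<bar>J A - (\<integral>s. j s \<partial>M)\<bar> \<le> d / c * (2 * B * measure M K)"
      using bound[of "d / c"] c d by simp
    also have "\<dots> \<le> d / c * c"
      using c d by (intro mult_left_mono) (auto simp: c_def)
    finally show "\<bar>J A - (\<integral>s. j s \<partial>M)\<bar> \<le> 0 + d"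
      using c by simp
  qed
  then show ?thesis
    by (simp add: A_def j_def)
qed

section \<open>Translations and uniqueness of Haar measure\<close>

lemma integral_homeomorphic_scaled:
  assumes T: "Hausdorff_space T" "locally_compact_space T" and M: "radon_measure T M"
    and \<theta>: "homeomorphic_map T T \<theta>" and r: "0 < r"
    and scale: "\<And>E. E \<in> sets M \<Longrightarrow> emeasure M (\<theta> ` E) = ennreal r * emeasure M E"
    and f: "f \<in> Cc T"
  shows "(\<integral>x. f x \<partial>M) = r * (\<integral>x. f (\<theta> x) \<partial>M)"
proof -
  have meas: "\<theta> \<in> M \<rightarrow>\<^sub>M M"
    using continuous_map_measurable_borel_on[OF homeomorphic_imp_continuous_map[OF \<theta>]]
      radon_sets[OF T M] measurable_cong_sets by blast
  have "M = density (distr M M \<theta>) (\<lambda>_. ennreal r)"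
  proof (rule measure_eqI)
    fix E assume E: "E \<in> sets M"
    have sub: "E \<subseteq> topspace T"
      using sets.sets_into_space[OF E] radon_space[OF T M] by simp
    have img: "\<theta> ` (\<theta> -` E \<inter> space M) = E"
    proof -
      have "\<theta> ` (\<theta> -` E \<inter> space M) = E \<inter> \<theta> ` topspace T"
        using radon_space[OF T M] by auto
      then show ?thesis
        using homeomorphic_imp_surjective_map[OF \<theta>] sub by auto
    qed
    have "emeasure M E = ennreal r * emeasure M (\<theta> -` E \<inter> space M)"
      using scale[of "\<theta> -` E \<inter> space M"] img measurable_sets[OF meas E] by simp
    then show "emeasure M E = emeasure (density (distr M M \<theta>) (\<lambda>_. ennreal r)) E"
      using E meas by (simp add: emeasure_distr emeasure_density_const)
  qed simp
  then have "(\<integral>x. f x \<partial>M) = (\<integral>x. f x \<partial>density (distr M M \<theta>) (\<lambda>_. ennreal r))"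
    by simp
  also have "\<dots> = r * (\<integral>x. f x \<partial>distr M M \<theta>)"
    using r radon_measurable[OF T M f] by (subst integral_density) auto
  also have "(\<integral>x. f x \<partial>distr M M \<theta>) = (\<integral>x. f (\<theta> x) \<partial>M)"
    by (rule integral_distr[OF meas radon_measurable[OF T M f]])
  finally show ?thesis .
qed

lemma l_coset_image: "a <#\<^bsub>G\<^esub> E = (\<lambda>x. a \<otimes>\<^bsub>G\<^esub> x) ` E"
  by (auto simp: l_coset_def)

lemma r_coset_image: "E #>\<^bsub>G\<^esub> a = (\<lambda>x. x \<otimes>\<^bsub>G\<^esub> a) ` E"
  by (auto simp: r_coset_def)

definition left_invariant_functional ::
  "('a, 'm) monoid_scheme \<Rightarrow> 'a topology \<Rightarrow> (('a \<Rightarrow> real) \<Rightarrow> real) \<Rightarrow> bool" where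
  "left_invariant_functional G T J \<longleftrightarrow> positive_functional T J \<and>
     (\<forall>a\<in>carrier G. \<forall>f\<in>Cc T. J (\<lambda>x. f (a \<otimes>\<^bsub>G\<^esub> x)) = J f)"

context locally_compact_group
begin

lemma continuous_map_mult:
  assumes "continuous_map X T f" "continuous_map X T g"
  shows "continuous_map X T (\<lambda>x. f x \<otimes> g x)"
  using continuous_map_compose[OF continuous_map_pairedI[OF assms] continuous_mult] by (simp add: o_def)

lemma continuous_map_inverse:
  assumes "continuous_map X T f" shows "continuous_map X T (\<lambda>x. inv (f x))"
  using continuous_map_compose[OF assms continuous_inv] by (simp add: o_def)

lemma homeomorphic_left_translation:
  assumes "a \<in> carrier G" shows "homeomorphic_map T T (\<lambda>x. a \<otimes> x)"
  unfolding homeomorphic_map_maps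
  by (rule exI[of _ "\<lambda>x. inv a \<otimes> x"])
    (use assms in \<open>auto simp: homeomorphic_maps_def topspace_eq_carrier m_assoc[symmetric]
      intro!: continuous_map_mult\<close>)

lemma homeomorphic_right_translation:
  assumes "a \<in> carrier G" shows "homeomorphic_map T T (\<lambda>x. x \<otimes> a)"
  unfolding homeomorphic_map_maps
  by (rule exI[of _ "\<lambda>x. x \<otimes> inv a"])
    (use assms in \<open>auto simp: homeomorphic_maps_def topspace_eq_carrier m_assoc
      intro!: continuous_map_mult\<close>)

lemma homeomorphic_inverse: "homeomorphic_map T T (\<lambda>x. inv x)"
  unfolding homeomorphic_map_maps
  by (rule exI[of _ "\<lambda>x. inv x"])
    (auto simp: homeomorphic_maps_def topspace_eq_carrier continuous_inv)

text \<open>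
  The two shears turn tensor products of functions on \<open>G\<close> into the compactly supported
  functions of two variables that occur in the uniqueness proof.
\<close>

lemma homeomorphic_shear_left:
  "homeomorphic_map (prod_topology T T) (prod_topology T T) (\<lambda>(s, t). (s, inv s \<otimes> t))"
  unfolding homeomorphic_map_maps
  by (rule exI[of _ "\<lambda>(s, t). (s, s \<otimes> t)"])
    (auto simp: homeomorphic_maps_def topspace_eq_carrier m_assoc[symmetric] case_prod_beta'
      intro!: continuous_map_pairedI continuous_map_mult continuous_map_inverse
        continuous_map_fst continuous_map_snd)

lemma homeomorphic_shear_right:
  "homeomorphic_map (prod_topology T T) (prod_topology T T) (\<lambda>(s, t). (s, t \<otimes> s))"
  unfolding homeomorphic_map_maps
  by (rule exI[of _ "\<lambda>(s, t). (s, t \<otimes> inv s)"])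
    (auto simp: homeomorphic_maps_def topspace_eq_carrier m_assoc case_prod_beta'
      intro!: continuous_map_pairedI continuous_map_mult continuous_map_inverse
        continuous_map_fst continuous_map_snd)

lemma openin_left_translate:
  assumes "a \<in> carrier G" "openin T U" shows "openin T (a <# U)"
  using homeomorphic_imp_open_map[OF homeomorphic_left_translation[OF assms(1)]] assms(2)
  by (simp add: l_coset_image open_map_def)

lemma left_haar_radon: "left_haar_measure G T M \<Longrightarrow> radon_measure T M"
  by (simp add: left_haar_measure_iff_radon)

lemma left_haar_invariant:
  "\<lbrakk>left_haar_measure G T M; a \<in> carrier G; E \<in> sets M\<rbrakk> \<Longrightarrow> emeasure M (a <# E) = emeasure M E"
  by (simp add: left_haar_measure_iff_radon)

lemmas lch = Hausdorff locally_compact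

lemma left_haar_sets_image:
  "\<lbrakk>left_haar_measure G T M; homeomorphic_map T T \<theta>; E \<in> sets M\<rbrakk> \<Longrightarrow> \<theta> ` E \<in> sets M"
  using borel_homeomorphic_image[of T \<theta> E] radon_sets[OF lch left_haar_radon[of M]] by simp

lemma left_haar_sets_subset: "left_haar_measure G T M \<Longrightarrow> E \<in> sets M \<Longrightarrow> E \<subseteq> carrier G"
  using sets.sets_into_space[of E M] radon_space[OF lch left_haar_radon[of M]] topspace_eq_carrier by simp

lemma left_haar_functional:
  assumes "left_haar_measure G T M"
  shows "left_invariant_functional G T (\<lambda>f. \<integral>x. f x \<partial>M)"
  unfolding left_invariant_functional_def
proof (intro conjI ballI)
  show "positive_functional T (\<lambda>f. \<integral>x. f x \<partial>M)"
    by (rule radon_positive_functional[OF lch left_haar_radon[OF assms]])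
  fix a f assume "a \<in> carrier G" "f \<in> Cc T"
  then show "(\<integral>x. f (a \<otimes> x) \<partial>M) = (\<integral>x. f x \<partial>M)"
    using integral_homeomorphic_scaled[OF lch left_haar_radon[OF assms] homeomorphic_left_translation, of a 1 f]
      left_haar_invariant[OF assms] by (simp add: l_coset_image)
qed

text \<open>
  Finitely many translates of \<open>U\<close> cover any compact set, so a null \<open>U\<close>
  would make every compact set null.
\<close>

lemma left_haar_open_pos:
  assumes M: "left_haar_measure G T M" and U: "openin T U" "U \<noteq> {}"
  shows "emeasure M U \<noteq> 0"
proof
  assume 0: "emeasure M U = 0"
  obtain u where u: "u \<in> U" "u \<in> carrier G"
    using U openin_subset topspace_eq_carrier by fastforce
  have UM: "U \<in> sets M"
    by (rule radon_open[OF lch left_haar_radon[OF M] U(1)])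
  have "emeasure M K = 0" if K: "compactin T K" for K
  proof -
    have KG: "K \<subseteq> carrier G"
      using K compactin_subset_topspace topspace_eq_carrier by blast
    define V where "V = (\<lambda>x. (x \<otimes> inv u) <# U)"
    have V: "openin T (V x)" "x \<in> V x" "emeasure M (V x) = 0" if "x \<in> K" for x
    proof -
      have x: "x \<in> carrier G" using that KG by blast
      show "openin T (V x)"
        unfolding V_def using x u U by (intro openin_left_translate) auto
      have "x = x \<otimes> inv u \<otimes> u"
        using x u by (simp add: m_assoc)
      then show "x \<in> V x"
        unfolding V_def l_coset_image using u by blast
      show "emeasure M (V x) = 0"
        unfolding V_def using x u left_haar_invariant[OF M _ UM] 0 by simp
    qed
    have "\<exists>\<F>. finite \<F> \<and> \<F> \<subseteq> V ` K \<and> K \<subseteq> \<Union>\<F>"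
      using K V(1,2) unfolding compactin_def by (elim conjE allE[of _ "V ` K"]) blast
    then obtain S where S: "finite S" "S \<subseteq> K" "K \<subseteq> \<Union>(V ` S)"
      by (metis finite_subset_image)
    have VM: "V x \<in> sets M" if "x \<in> K" for x
      by (rule radon_open[OF lch left_haar_radon[OF M] V(1)[OF that]])
    have "emeasure M K \<le> emeasure M (\<Union>(V ` S))"
      using S VM by (intro emeasure_mono sets.finite_UN) auto
    also have "\<dots> \<le> (\<Sum>x\<in>S. emeasure M (V x))"
      using S VM by (intro emeasure_subadditive_finite) auto
    also have "\<dots> = 0"
      using S V(3) by (intro sum.neutral) auto
    finally show ?thesis by simp
  qed
  then have "(SUP K\<in>{K. compactin T K \<and> K \<subseteq> topspace T}. emeasure M K) = 0"
    by (intro antisym SUP_least) auto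
  moreover have "emeasure M (topspace T) = (SUP K\<in>{K. compactin T K \<and> K \<subseteq> topspace T}. emeasure M K)"
    using left_haar_radon[OF M] openin_topspace[of T] unfolding radon_measure_def by blast
  ultimately show False
    using M radon_space[OF lch left_haar_radon[OF M]] by (simp add: left_haar_measure_iff_radon)
qed

lemma left_haar_integral_zero:
  assumes M: "left_haar_measure G T M" and f: "f \<in> Cc T" "\<And>x. x \<in> carrier G \<Longrightarrow> 0 \<le> f x"
    and zero: "(\<integral>x. f x \<partial>M) = 0" and x: "x \<in> carrier G"
  shows "f x = 0"
proof -
  note R = left_haar_radon[OF M]
  define U where "U = {x \<in> topspace T. f x \<in> - {0}}"
  have U: "openin T U"
    unfolding U_def by (rule openin_continuous_map_preimage[OF Cc_continuous[OF f(1)]]) auto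
  have "AE x in M. f x = 0"
    using zero integral_nonneg_eq_0_iff_AE[OF radon_integrable[OF lch R f(1)]] f(2)
      radon_space[OF lch R] topspace_eq_carrier by auto
  then have "emeasure M U = 0"
    using radon_open[OF lch R U] radon_space[OF lch R]
    by (subst (asm) AE_iff_measurable[of U]) (auto simp: U_def)
  then have "U = {}"
    using left_haar_open_pos[OF M U] by blast
  then show ?thesis
    using x topspace_eq_carrier by (auto simp: U_def)
qed

lemma one_bump:
  obtains b where "b \<in> Cc T" "\<And>x. x \<in> carrier G \<Longrightarrow> 0 \<le> b x" "b \<one> = 1"
proof -
  have "compactin T {\<one>}" "{\<one>} \<subseteq> topspace T"
    using topspace_eq_carrier by auto
  then show thesis
    using Cc_bump[OF lch _ openin_topspace, of "{\<one>}"] that topspace_eq_carrier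
    by (metis insertI1)
qed

text \<open>
  Let \<open>I\<close> be integration against \<open>M\<close>. Formally, \<open>I f * J g\<close> is \<open>J\<^sub>t I\<^sub>s (f(s) g(s\<inverse> t))\<close> by invariance of \<open>J\<close>; the substitution
  \<open>s \<mapsto> t s\<close> under \<open>I\<close> gives \<open>J\<^sub>t I\<^sub>s (f(t s) g(s\<inverse>))\<close>, in which \<open>g\<close> no longer depends on \<open>t\<close>. Two
  exchanges of \<open>I\<close> and \<open>J\<close> make this precise.
\<close>

lemma left_haar_convolution_identity:
  assumes M: "left_haar_measure G T M" and J: "left_invariant_functional G T J"
    and f: "f \<in> Cc T" and g: "g \<in> Cc T"
  shows "(\<lambda>s. g (inv s) * J (\<lambda>t. f (t \<otimes> s))) \<in> Cc T"
    "(\<integral>x. f x \<partial>M) * J g = (\<integral>s. g (inv s) * J (\<lambda>t. f (t \<otimes> s)) \<partial>M)"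
proof -
  note R = left_haar_radon[OF M]
  have Jp: "positive_functional T J"
    and Ji: "\<And>a f. \<lbrakk>a \<in> carrier G; f \<in> Cc T\<rbrakk> \<Longrightarrow> J (\<lambda>x. f (a \<otimes> x)) = J f"
    using J by (auto simp: left_invariant_functional_def)
  have Ii: "(\<integral>x. h (a \<otimes> x) \<partial>M) = (\<integral>x. h x \<partial>M)" if "a \<in> carrier G" "h \<in> Cc T" for a h
    using left_haar_functional[OF M] that by (simp add: left_invariant_functional_def)
  have sp: "space M = carrier G"
    using radon_space[OF lch R] topspace_eq_carrier by simp
  define F1 where "F1 = (\<lambda>(s, t). f s * g (inv s \<otimes> t))"
  define F2 where "F2 = (\<lambda>(s, t). g (inv s) * f (t \<otimes> s))"
  have F1: "F1 \<in> Cc (prod_topology T T)"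
    using Cc_homeomorphic[OF Cc_tensor[OF f g] homeomorphic_shear_left]
    by (simp add: F1_def case_prod_beta')
  have F2: "F2 \<in> Cc (prod_topology T T)"
    using Cc_homeomorphic[OF Cc_tensor[OF Cc_homeomorphic[OF g homeomorphic_inverse] f] homeomorphic_shear_right]
    by (simp add: F2_def case_prod_beta')
  have ft: "(\<lambda>t. f (t \<otimes> s)) \<in> Cc T" if "s \<in> carrier G" for s
    by (rule Cc_homeomorphic[OF f homeomorphic_right_translation[OF that]])
  have gt: "(\<lambda>t. g (inv s \<otimes> t)) \<in> Cc T" if "s \<in> carrier G" for s
    using that by (intro Cc_homeomorphic[OF g homeomorphic_left_translation]) simp
  have J2: "J (\<lambda>t. F2 (s, t)) = g (inv s) * J (\<lambda>t. f (t \<otimes> s))" if "s \<in> carrier G" for s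
    by (simp add: F2_def functional_cmult[OF Jp ft[OF that]])
  have J1: "J (\<lambda>t. F1 (s, t)) = f s * J g" if "s \<in> carrier G" for s
    using Ji[OF _ g, of "inv s"] that by (simp add: F1_def functional_cmult[OF Jp gt[OF that]])
  have "(\<lambda>s. J (\<lambda>t. F2 (s, t))) \<in> Cc T"
    by (rule Cc_slice_functional[OF lch Jp F2])
  then show "(\<lambda>s. g (inv s) * J (\<lambda>t. f (t \<otimes> s))) \<in> Cc T"
    by (rule Cc_cong) (simp add: J2 topspace_eq_carrier)
  have "(\<integral>x. f x \<partial>M) * J g = (\<integral>s. f s * J g \<partial>M)"
    by simp
  also have "\<dots> = (\<integral>s. J (\<lambda>t. F1 (s, t)) \<partial>M)"
    using J1 sp by (intro Bochner_Integration.integral_cong) auto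
  also have "\<dots> = J (\<lambda>t. \<integral>s. F1 (s, t) \<partial>M)"
    by (rule functional_integral_exchange[OF lch lch R Jp F1, symmetric])
  also have "\<dots> = J (\<lambda>t. \<integral>s. F2 (s, t) \<partial>M)"
  proof (rule functional_cong[OF Jp])
    show "(\<lambda>t. \<integral>s. F1 (s, t) \<partial>M) \<in> Cc T" "(\<lambda>t. \<integral>s. F2 (s, t) \<partial>M) \<in> Cc T"
      using Cc_slice_functional[OF lch radon_positive_functional[OF lch R] Cc_swap[OF F1]]
        Cc_slice_functional[OF lch radon_positive_functional[OF lch R] Cc_swap[OF F2]] by auto
    fix t assume "t \<in> topspace T"
    then have t: "t \<in> carrier G" using topspace_eq_carrier by simp
    have "(\<lambda>s. F1 (s, t)) \<in> Cc T"
      using Cc_slice[OF Cc_swap[OF F1], of t] \<open>t \<in> topspace T\<close> by simp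
    then have "(\<integral>s. F1 (s, t) \<partial>M) = (\<integral>s. F1 (t \<otimes> s, t) \<partial>M)"
      using Ii[OF t, of "\<lambda>s. F1 (s, t)"] by simp
    also have "\<dots> = (\<integral>s. F2 (s, t) \<partial>M)"
      using t sp by (intro Bochner_Integration.integral_cong)
        (auto simp: F1_def F2_def inv_mult_group m_assoc)
    finally show "(\<integral>s. F1 (s, t) \<partial>M) = (\<integral>s. F2 (s, t) \<partial>M)" .
  qed
  also have "\<dots> = (\<integral>s. J (\<lambda>t. F2 (s, t)) \<partial>M)"
    by (rule functional_integral_exchange[OF lch lch R Jp F2])
  also have "\<dots> = (\<integral>s. g (inv s) * J (\<lambda>t. f (t \<otimes> s)) \<partial>M)"
    using J2 sp by (intro Bochner_Integration.integral_cong) auto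
  finally show "(\<integral>x. f x \<partial>M) * J g = (\<integral>s. g (inv s) * J (\<lambda>t. f (t \<otimes> s)) \<partial>M)" .
qed

text \<open>
  By the convolution identity, \<open>I\<^sub>s (g(s\<inverse>) (I b * J\<^sub>t f(t s) - I f * J\<^sub>t b(t s))) = 0\<close> for
  every \<open>g\<close>, where \<open>I\<close> is integration against \<open>M\<close>. Since \<open>I\<close> is strictly positive, a suitable
  \<open>g\<close> shows that the difference vanishes at the identity, where it is \<open>I b * J f - I f * J b\<close>.
\<close>

theorem left_invariant_functional_unique:
  assumes M: "left_haar_measure G T M" and J: "left_invariant_functional G T J"
  obtains r where "0 \<le> r" "\<And>f. f \<in> Cc T \<Longrightarrow> J f = r * (\<integral>x. f x \<partial>M)"
proof -
  note R = left_haar_radon[OF M]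
  have Jp: "positive_functional T J"
    using J by (auto simp: left_invariant_functional_def)
  obtain b where b: "b \<in> Cc T" "\<And>x. x \<in> carrier G \<Longrightarrow> 0 \<le> b x" "b \<one> = 1"
    using one_bump by blast
  have Ib: "0 < (\<integral>x. b x \<partial>M)"
  proof -
    have "0 \<le> (\<integral>x. b x \<partial>M)"
      using functional_nonneg[OF radon_positive_functional[OF lch R] b(1)] b(2) topspace_eq_carrier by simp
    moreover have "(\<integral>x. b x \<partial>M) \<noteq> 0"
      using left_haar_integral_zero[OF M b(1,2), of \<one>] b(3) by auto
    ultimately show ?thesis by simp
  qed
  have cross: "(\<integral>x. b x \<partial>M) * J f = (\<integral>x. f x \<partial>M) * J b" if f: "f \<in> Cc T" for f
  proof -
    define d where "d = (\<lambda>s. (\<integral>x. b x \<partial>M) * J (\<lambda>t. f (t \<otimes> s)) - (\<integral>x. f x \<partial>M) * J (\<lambda>t. b (t \<otimes> s)))"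
    have gd: "(\<lambda>s. g (inv s) * d s) \<in> Cc T \<and> (\<integral>s. g (inv s) * d s \<partial>M) = 0" if g: "g \<in> Cc T" for g
    proof -
      let ?u = "\<lambda>s. g (inv s) * J (\<lambda>t. f (t \<otimes> s))" and ?v = "\<lambda>s. g (inv s) * J (\<lambda>t. b (t \<otimes> s))"
      note u = left_haar_convolution_identity[OF M J f g]
      note v = left_haar_convolution_identity[OF M J b(1) g]
      have eq: "(\<lambda>s. g (inv s) * d s) = (\<lambda>s. (\<integral>x. b x \<partial>M) * ?u s - (\<integral>x. f x \<partial>M) * ?v s)"
        by (auto simp: d_def algebra_simps)
      have "(\<integral>s. (\<integral>x. b x \<partial>M) * ?u s - (\<integral>x. f x \<partial>M) * ?v s \<partial>M)
          = (\<integral>x. b x \<partial>M) * (\<integral>s. ?u s \<partial>M) - (\<integral>x. f x \<partial>M) * (\<integral>s. ?v s \<partial>M)"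
        using radon_integrable[OF lch R u(1)] radon_integrable[OF lch R v(1)] by simp
      also have "\<dots> = 0"
        by (simp add: u(2)[symmetric] v(2)[symmetric])
      finally show ?thesis
        unfolding eq using Cc_diff[OF Cc_cmult[OF u(1)] Cc_cmult[OF v(1)]] by simp
    qed
    \<comment> \<open>The difference \<open>d\<close> is continuous but need not have compact support, hence the cut-off by \<open>b\<close>.
      The choice of \<open>g\<close> below turns \<open>g(s\<inverse>) d(s)\<close> into the square of \<open>\<delta>(s)\<close>.\<close>
    define b' where "b' = (\<lambda>x. b (inv x))"
    have b': "b' \<in> Cc T"
      unfolding b'_def by (rule Cc_homeomorphic[OF b(1) homeomorphic_inverse])
    define \<delta> where "\<delta> = (\<lambda>s. b s * d s)"
    have \<delta>: "\<delta> \<in> Cc T"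
      by (rule Cc_cong[OF conjunct1[OF gd[OF b']]]) (simp add: b'_def \<delta>_def topspace_eq_carrier)
    define g where "g = (\<lambda>x. b (inv x) * \<delta> (inv x))"
    have g: "g \<in> Cc T"
      unfolding g_def using Cc_homeomorphic[OF Cc_mult_continuous[OF b(1) Cc_continuous[OF \<delta>]] homeomorphic_inverse] .
    have "(\<integral>s. \<delta> s * \<delta> s \<partial>M) = (\<integral>s. g (inv s) * d s \<partial>M)"
      using radon_space[OF lch R] topspace_eq_carrier
      by (intro Bochner_Integration.integral_cong) (auto simp: g_def \<delta>_def)
    then have "(\<integral>s. \<delta> s * \<delta> s \<partial>M) = 0"
      using gd[OF g] by simp
    then have "\<delta> \<one> * \<delta> \<one> = 0"
      by (intro left_haar_integral_zero[OF M Cc_mult_continuous[OF \<delta> Cc_continuous[OF \<delta>]]]) auto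
    then have "d \<one> = 0"
      by (simp add: \<delta>_def b(3))
    moreover have "J (\<lambda>t. h (t \<otimes> \<one>)) = J h" if "h \<in> Cc T" for h
      using functional_cong[OF Jp Cc_homeomorphic[OF that homeomorphic_right_translation] that, of \<one>]
        topspace_eq_carrier by simp
    ultimately show ?thesis
      using f b(1) by (simp add: d_def)
  qed
  show thesis
  proof (rule that[of "J b / (\<integral>x. b x \<partial>M)"])
    show "0 \<le> J b / (\<integral>x. b x \<partial>M)"
      using functional_nonneg[OF Jp b(1)] b(2) topspace_eq_carrier Ib by simp
    show "J f = J b / (\<integral>x. b x \<partial>M) * (\<integral>x. f x \<partial>M)" if "f \<in> Cc T" for f
      using cross[OF that] Ib by (simp add: field_simps)
  qed
qed

theorem left_haar_measure_unique:
  assumes M: "left_haar_measure G T M" and M': "left_haar_measure G T M'"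
  obtains r where "0 < r" "\<And>E. E \<in> sets M \<Longrightarrow> emeasure M' E = ennreal r * emeasure M E"
proof -
  obtain r where r: "0 \<le> r" "\<And>f. f \<in> Cc T \<Longrightarrow> (\<integral>x. f x \<partial>M') = r * (\<integral>x. f x \<partial>M)"
    by (fact left_invariant_functional_unique[OF M left_haar_functional[OF M']])
  obtain b where b: "b \<in> Cc T" "\<And>x. x \<in> carrier G \<Longrightarrow> 0 \<le> b x" "b \<one> = 1"
    using one_bump by blast
  have "r \<noteq> 0"
    using left_haar_integral_zero[OF M' b(1,2), of \<one>] b(3) r(2)[OF b(1)] by auto
  with r(1) have "0 < r" by simp
  moreover have "sets M = sets M'"
    using M M' by (simp add: left_haar_measure_def)
  ultimately show thesis
    using radon_measure_proportional[OF lch left_haar_radon[OF M'] left_haar_radon[OF M] _ r(2)] that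
    by blast
qed

lemma sets_l_coset:
  assumes "radon_measure T M" "x \<in> carrier G" "E \<in> sets M"
  shows "x <# E \<in> sets M"
  using borel_homeomorphic_image[OF homeomorphic_left_translation[OF assms(2)], of E]
    assms(3) radon_sets[OF lch assms(1)] by (simp add: l_coset_image)

text \<open>
  The measure \<open>E \<mapsto> M (\<theta> ` E)\<close> is again a left Haar measure, hence proportional to \<open>M\<close>. The
  hypothesis covers right translations (with \<open>x' = x\<close>) and automorphisms (with \<open>x' = \<theta> x\<close>).
\<close>

lemma left_haar_measure_transport:
  assumes M: "left_haar_measure G T M" and \<theta>: "homeomorphic_map T T \<theta>"
    and equi: "\<And>x. x \<in> carrier G \<Longrightarrow> \<exists>x'\<in>carrier G. \<forall>y\<in>carrier G. \<theta> (x \<otimes> y) = x' \<otimes> \<theta> y"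
  obtains r where "0 < r" "\<And>E. E \<in> sets M \<Longrightarrow> emeasure M (\<theta> ` E) = ennreal r * emeasure M E"
proof -
  note R = left_haar_radon[OF M]
  obtain \<eta> where \<eta>: "homeomorphic_maps T T \<theta> \<eta>"
    using \<theta> by (auto simp: homeomorphic_map_maps)
  have \<theta>\<eta>: "\<And>x. x \<in> topspace T \<Longrightarrow> \<eta> (\<theta> x) = x" "\<And>x. x \<in> topspace T \<Longrightarrow> \<theta> (\<eta> x) = x"
    "\<And>x. x \<in> topspace T \<Longrightarrow> \<theta> x \<in> topspace T" "\<And>x. x \<in> topspace T \<Longrightarrow> \<eta> x \<in> topspace T"
    using \<eta> by (auto simp: homeomorphic_maps_def continuous_map_def)
  have sp: "space M = topspace T"
    by (rule radon_space[OF lch R])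
  have \<eta>h: "homeomorphic_map T T \<eta>"
    using \<eta> homeomorphic_map_maps homeomorphic_maps_sym by blast
  have meas: "\<eta> \<in> M \<rightarrow>\<^sub>M M"
    using continuous_map_measurable_borel_on[OF homeomorphic_imp_continuous_map[OF \<eta>h]]
      radon_sets[OF lch R] measurable_cong_sets by blast
  define M' where "M' = distr M M \<eta>"
  have img: "\<eta> -` E \<inter> space M = \<theta> ` E" if "E \<subseteq> topspace T" for E
    using that \<theta>\<eta> sp by (auto simp: image_iff) (metis subsetD)
  have img': "\<theta> ` (\<eta> ` E) = E" "\<eta> ` (\<theta> ` E) = E" if "E \<subseteq> topspace T" for E
    using that \<theta>\<eta> by (force simp: image_iff)+
  have sub: "E \<subseteq> topspace T" if "E \<in> sets M" for E
    using sets.sets_into_space[OF that] sp by simp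
  have M'E: "emeasure M' E = emeasure M (\<theta> ` E)" if "E \<in> sets M" for E
    using that meas img[OF sub[OF that]] by (simp add: M'_def emeasure_distr)
  have \<theta>sets: "\<theta> ` E \<in> sets M" if "E \<in> sets M" for E
    by (rule left_haar_sets_image[OF M \<theta> that])
  have op: "openin T (\<theta> ` U)" "openin T (\<eta> ` U)" if "openin T U" for U
    using homeomorphic_imp_open_map[OF \<theta>] homeomorphic_imp_open_map[OF \<eta>h] that by (auto simp: open_map_def)
  have co: "compactin T (\<theta> ` K)" "compactin T (\<eta> ` K)" if "compactin T K" for K
    using image_compactin[OF that homeomorphic_imp_continuous_map[OF \<theta>]]
      image_compactin[OF that homeomorphic_imp_continuous_map[OF \<eta>h]] by auto
  have "left_haar_measure G T M'"
    unfolding left_haar_measure_iff_radon radon_measure_def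
  proof (intro conjI allI impI ballI)
    show sets': "sets M' = sets (borel_on T)"
      by (simp add: M'_def radon_sets[OF lch R])
    have sets_eq: "sets M' = sets M"
      by (simp add: M'_def)
    show "emeasure M' K < \<infinity>" if "compactin T K" for K
      using M'E[OF radon_compact[OF lch R that]] radon_compact_finite[OF lch R co(1)[OF that]] by simp
    show "emeasure M' E = (INF U\<in>{U. openin T U \<and> E \<subseteq> U}. emeasure M' U)" if "E \<in> sets M'" for E
    proof -
      have E: "E \<in> sets M" using that sets_eq by simp
      have "{U. openin T U \<and> \<theta> ` E \<subseteq> U} = (\<lambda>V. \<theta> ` V) ` {V. openin T V \<and> E \<subseteq> V}" (is "?A = ?B")
      proof (intro equalityI subsetI)
        fix U assume U: "U \<in> ?A"
        then have "U = \<theta> ` (\<eta> ` U)"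
          using img'(1)[of U] openin_subset[of T U] by auto
        moreover have "E \<subseteq> \<eta> ` U"
          using image_mono[of "\<theta> ` E" U \<eta>] U img'(2)[OF sub[OF E]] by simp
        ultimately show "U \<in> ?B"
          using U op by (intro image_eqI[of _ _ "\<eta> ` U"]) auto
      qed (use op in auto)
      moreover have "emeasure M (\<theta> ` E) = (INF U\<in>{U. openin T U \<and> \<theta> ` E \<subseteq> U}. emeasure M U)"
        using R \<theta>sets[OF E] by (simp add: radon_measure_def)
      ultimately have "emeasure M' E = (INF V\<in>{V. openin T V \<and> E \<subseteq> V}. emeasure M (\<theta> ` V))"
        by (simp only: M'E[OF E] image_image)
      also have "\<dots> = (INF V\<in>{V. openin T V \<and> E \<subseteq> V}. emeasure M' V)"
        by (intro INF_cong) (auto simp: M'E radon_open[OF lch R])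
      finally show ?thesis .
    qed
    show "emeasure M' U = (SUP K\<in>{K. compactin T K \<and> K \<subseteq> U}. emeasure M' K)" if U: "openin T U" for U
    proof -
      have "{K. compactin T K \<and> K \<subseteq> \<theta> ` U} = (\<lambda>K. \<theta> ` K) ` {K. compactin T K \<and> K \<subseteq> U}" (is "?A = ?B")
      proof (intro equalityI subsetI)
        fix K assume K: "K \<in> ?A"
        then have "K = \<theta> ` (\<eta> ` K)"
          using img'(1)[of K] compactin_subset_topspace[of T K] by auto
        moreover have "\<eta> ` K \<subseteq> U"
          using image_mono[of K "\<theta> ` U" \<eta>] K img'(2)[OF openin_subset[OF U]] by simp
        ultimately show "K \<in> ?B"
          using K co by (intro image_eqI[of _ _ "\<eta> ` K"]) auto
      qed (use co in auto)
      moreover have "emeasure M (\<theta> ` U) = (SUP K\<in>{K. compactin T K \<and> K \<subseteq> \<theta> ` U}. emeasure M K)"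
        using R op(1)[OF U] by (simp add: radon_measure_def)
      ultimately have "emeasure M' U = (SUP K\<in>{K. compactin T K \<and> K \<subseteq> U}. emeasure M (\<theta> ` K))"
        by (simp only: M'E[OF radon_open[OF lch R U]] image_image)
      also have "\<dots> = (SUP K\<in>{K. compactin T K \<and> K \<subseteq> U}. emeasure M' K)"
        by (intro SUP_cong) (auto simp: M'E radon_compact[OF lch R])
      finally show ?thesis .
    qed
    show "emeasure M' (space M') \<noteq> 0"
    proof -
      have "\<theta> ` space M = space M"
        using homeomorphic_imp_surjective_map[OF \<theta>] sp by simp
      then show ?thesis
        using M M'E[of "space M"] by (simp add: left_haar_measure_iff_radon M'_def)
    qed
    show "emeasure M' (x <# E) = emeasure M' E" if x: "x \<in> carrier G" and "E \<in> sets M'" for x E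
    proof -
      have E: "E \<in> sets M" using that sets_eq by simp
      obtain x' where x': "x' \<in> carrier G" "\<And>y. y \<in> carrier G \<Longrightarrow> \<theta> (x \<otimes> y) = x' \<otimes> \<theta> y"
        using equi[OF x] by blast
      have "\<theta> ` (x <# E) = x' <# (\<theta> ` E)"
        unfolding l_coset_image image_image using x'(2) sub[OF E] topspace_eq_carrier
        by (intro image_cong) auto
      moreover have "x <# E \<in> sets M"
        by (rule sets_l_coset[OF R x E])
      ultimately show ?thesis
        using M'E E left_haar_invariant[OF M x'(1) \<theta>sets[OF E]] by simp
    qed
  qed
  then obtain r where "0 < r" "\<And>E. E \<in> sets M \<Longrightarrow> emeasure M' E = ennreal r * emeasure M E"
    using left_haar_measure_unique[OF M] by blast
  then show thesis
    using that M'E by simp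
qed

end

section \<open>Radon measures from contents\<close>

text \<open>A content in the sense of Halmos.\<close>

definition compact_content :: "'a topology \<Rightarrow> ('a set \<Rightarrow> real) \<Rightarrow> bool" where
  "compact_content T h \<longleftrightarrow>
     (\<forall>K. compactin T K \<longrightarrow> 0 \<le> h K) \<and>
     (\<forall>K L. compactin T K \<longrightarrow> compactin T L \<longrightarrow> K \<subseteq> L \<longrightarrow> h K \<le> h L) \<and>
     (\<forall>K L. compactin T K \<longrightarrow> compactin T L \<longrightarrow> h (K \<union> L) \<le> h K + h L) \<and>
     (\<forall>K L. compactin T K \<longrightarrow> compactin T L \<longrightarrow> disjnt K L \<longrightarrow> h (K \<union> L) = h K + h L)"

text \<open>The measure that the content will assign to open sets.\<close>

definition inner_content :: "'a topology \<Rightarrow> ('a set \<Rightarrow> real) \<Rightarrow> 'a set \<Rightarrow> ennreal" where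
  "inner_content T h U = (SUP K\<in>{K. compactin T K \<and> K \<subseteq> U}. ennreal (h K))"

definition outer_content :: "'a topology \<Rightarrow> ('a set \<Rightarrow> real) \<Rightarrow> 'a set \<Rightarrow> ennreal" where
  "outer_content T h A = (INF U\<in>{U. openin T U \<and> A \<subseteq> U}. inner_content T h U)"

text \<open>
  Separate the disjoint compact sets \<open>K - V\<close> and \<open>K - U\<close> by open sets
  and remove these from \<open>K\<close>.
\<close>

lemma compactin_split:
  assumes T: "Hausdorff_space T" and K: "compactin T K"
    and UV: "openin T U" "openin T V" "K \<subseteq> U \<union> V"
  obtains K1 K2 where "compactin T K1" "compactin T K2" "K1 \<subseteq> U" "K2 \<subseteq> V" "K = K1 \<union> K2"
proof -
  have cd: "compactin T (K - W)" if "openin T W" for W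
  proof -
    have "K - W = K \<inter> (topspace T - W)"
      using compactin_subset_topspace[OF K] by blast
    then show ?thesis
      using compact_Int_closedin[OF K, of "topspace T - W"] that by auto
  qed
  have "disjnt (K - V) (K - U)"
    using UV(3) by (auto simp: disjnt_def)
  then obtain W1 W2 where W: "openin T W1" "openin T W2" "K - V \<subseteq> W1" "K - U \<subseteq> W2" "disjnt W1 W2"
    using Hausdorff_space_compact_separation[OF T cd[OF UV(2)] cd[OF UV(1)]] by metis
  show thesis
    by (rule that[OF cd[OF W(2)] cd[OF W(1)]]) (use W in \<open>auto simp: disjnt_def\<close>)
qed

context
  fixes T :: "'a topology" and h :: "'a set \<Rightarrow> real"
  assumes T: "Hausdorff_space T" "locally_compact_space T" and h: "compact_content T h"
begin

lemma content_nonneg: "compactin T K \<Longrightarrow> 0 \<le> h K"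
  and content_mono: "\<lbrakk>compactin T K; compactin T L; K \<subseteq> L\<rbrakk> \<Longrightarrow> h K \<le> h L"
  and content_subadd: "\<lbrakk>compactin T K; compactin T L\<rbrakk> \<Longrightarrow> h (K \<union> L) \<le> h K + h L"
  and content_add: "\<lbrakk>compactin T K; compactin T L; disjnt K L\<rbrakk> \<Longrightarrow> h (K \<union> L) = h K + h L"
  using h unfolding compact_content_def by blast+

lemma content_empty: "h {} = 0"
  using content_add[of "{}" "{}"] by simp

lemma inner_content_upper: "\<lbrakk>compactin T K; K \<subseteq> U\<rbrakk> \<Longrightarrow> ennreal (h K) \<le> inner_content T h U"
  unfolding inner_content_def by (rule SUP_upper) simp

lemma inner_content_mono: "U \<subseteq> V \<Longrightarrow> inner_content T h U \<le> inner_content T h V"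
  unfolding inner_content_def by (rule SUP_subset_mono) auto

lemma inner_content_le:
  "(\<And>K. \<lbrakk>compactin T K; K \<subseteq> U\<rbrakk> \<Longrightarrow> ennreal (h K) \<le> a) \<Longrightarrow> inner_content T h U \<le> a"
  unfolding inner_content_def by (rule SUP_least) simp

lemma outer_content_lower: "\<lbrakk>openin T U; A \<subseteq> U\<rbrakk> \<Longrightarrow> outer_content T h A \<le> inner_content T h U"
  unfolding outer_content_def by (rule INF_lower) simp

lemma outer_content_ge:
  "(\<And>U. \<lbrakk>openin T U; A \<subseteq> U\<rbrakk> \<Longrightarrow> a \<le> inner_content T h U) \<Longrightarrow> a \<le> outer_content T h A"
  unfolding outer_content_def by (rule INF_greatest) simp

lemma outer_content_less:
  "outer_content T h A < a \<Longrightarrow> \<exists>U. openin T U \<and> A \<subseteq> U \<and> inner_content T h U < a"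
  unfolding outer_content_def INF_less_iff by auto

lemma outer_content_open: "openin T U \<Longrightarrow> outer_content T h U = inner_content T h U"
  by (intro antisym outer_content_lower outer_content_ge inner_content_mono) auto

lemma content_le_sum_inner:
  assumes "finite I" "compactin T K" "\<And>i. i \<in> I \<Longrightarrow> openin T (U i)" "K \<subseteq> (\<Union>i\<in>I. U i)"
  shows "ennreal (h K) \<le> (\<Sum>i\<in>I. inner_content T h (U i))"
  using assms
proof (induction I arbitrary: K rule: finite_induct)
  case empty
  then show ?case by (simp add: content_empty)
next
  case (insert a I)
  have "openin T (U a)" "openin T (\<Union>i\<in>I. U i)" "K \<subseteq> U a \<union> (\<Union>i\<in>I. U i)"
    using insert.prems by auto
  then obtain K1 K2 where K: "compactin T K1" "compactin T K2" "K1 \<subseteq> U a" "K2 \<subseteq> (\<Union>i\<in>I. U i)" "K = K1 \<union> K2"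
    using compactin_split[OF T(1) insert.prems(1)] by metis
  have "ennreal (h K) \<le> ennreal (h K1) + ennreal (h K2)"
    using content_subadd[OF K(1,2)] content_nonneg K by (simp flip: ennreal_plus)
  also have "\<dots> \<le> inner_content T h (U a) + (\<Sum>i\<in>I. inner_content T h (U i))"
    using K insert.prems by (intro add_mono inner_content_upper insert.IH) auto
  finally show ?case
    using insert.hyps by simp
qed

lemma inner_content_Union_le:
  fixes U :: "nat \<Rightarrow> 'a set"
  assumes "\<And>i. openin T (U i)"
  shows "inner_content T h (\<Union>i. U i) \<le> (\<Sum>i. inner_content T h (U i))"
proof (rule inner_content_le)
  fix K assume K: "compactin T K" "K \<subseteq> (\<Union>i. U i)"
  have "\<exists>\<F>. finite \<F> \<and> \<F> \<subseteq> range U \<and> K \<subseteq> \<Union>\<F>"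
    using K assms unfolding compactin_def by (elim conjE allE[of _ "range U"]) blast
  then obtain I where I: "finite I" "K \<subseteq> (\<Union>i\<in>I. U i)"
    by (metis finite_subset_image)
  have "ennreal (h K) \<le> (\<Sum>i\<in>I. inner_content T h (U i))"
    by (rule content_le_sum_inner[OF I(1) K(1) assms I(2)])
  also have "\<dots> \<le> (\<Sum>i. inner_content T h (U i))"
    by (rule sum_le_suminf) (use I in auto)
  finally show "ennreal (h K) \<le> (\<Sum>i. inner_content T h (U i))" .
qed

lemma outer_content_outer_measure: "outer_measure_space (Pow (topspace T)) (outer_content T h)"
  unfolding outer_measure_space_def
proof (intro conjI)
  have "inner_content T h {} = 0"
    by (intro antisym inner_content_le) (auto simp: content_empty)
  then show "positive (Pow (topspace T)) (outer_content T h)"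
    using outer_content_open[of "{}"] by (simp add: positive_def)
  show "increasing (Pow (topspace T)) (outer_content T h)"
    unfolding increasing_def outer_content_def by (auto intro!: INF_superset_mono)
  show "countably_subadditive (Pow (topspace T)) (outer_content T h)"
    unfolding countably_subadditive_def
  proof (intro allI impI)
    fix A :: "nat \<Rightarrow> 'a set"
    show "outer_content T h (\<Union>i. A i) \<le> (\<Sum>i. outer_content T h (A i))"
    proof (rule ennreal_le_epsilon)
      fix e :: real assume e: "0 < e" and fin: "(\<Sum>i. outer_content T h (A i)) < top_class.top"
      then have "outer_content T h (A n) < outer_content T h (A n) + e * (1/2)^Suc n" for n
        by (auto simp add: less_top dest!: ennreal_suminf_lessD)
      then have "\<exists>U. openin T U \<and> A n \<subseteq> U \<and> inner_content T h U < outer_content T h (A n) + e * (1/2)^Suc n" for n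
        using outer_content_less by blast
      then obtain U where U: "\<And>n. openin T (U n)" "\<And>n. A n \<subseteq> U n"
        "\<And>n. inner_content T h (U n) < outer_content T h (A n) + e * (1/2)^Suc n"
        by metis
      have "outer_content T h (\<Union>i. A i) \<le> inner_content T h (\<Union>i. U i)"
        using U by (intro outer_content_lower) auto
      also have "\<dots> \<le> (\<Sum>i. inner_content T h (U i))"
        by (rule inner_content_Union_le[OF U(1)])
      also have "\<dots> \<le> (\<Sum>n. outer_content T h (A n) + e * (1/2)^Suc n)"
        using U(3) by (intro suminf_le allI less_imp_le) auto
      also have "\<dots> = (\<Sum>n. outer_content T h (A n)) + (\<Sum>n. ennreal e * ennreal ((1/2) ^ Suc n))"
        using e by (subst suminf_add[symmetric])
          (auto simp del: ennreal_suminf_cmult simp add: ennreal_mult[symmetric])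
      also have "\<dots> = (\<Sum>n. outer_content T h (A n)) + e"
        unfolding ennreal_suminf_cmult
        by (subst suminf_ennreal_eq[OF zero_le_power power_half_series]) auto
      finally show "outer_content T h (\<Union>i. A i) \<le> (\<Sum>n. outer_content T h (A n)) + e" .
    qed
  qed
qed

text \<open>
  For open \<open>V\<close>, exhaust \<open>U \<inter> V\<close> by a compact \<open>K\<close> and then the rest \<open>V - K\<close> by a compact \<open>L\<close>.
  As \<open>K\<close> and \<open>L\<close> are disjoint, additivity bounds \<open>h K + h L\<close> by the inner content of \<open>V\<close>.
\<close>

lemma open_in_lambda_system:
  assumes U: "openin T U"
  shows "U \<in> lambda_system (topspace T) (Pow (topspace T)) (outer_content T h)"
  unfolding lambda_system_def
proof (safe intro!: antisym)
  show "x \<in> topspace T" if "x \<in> U" for x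
    using openin_subset[OF U] that by blast
  fix A assume A: "A \<subseteq> topspace T"
  show "outer_content T h (U \<inter> A) + outer_content T h ((topspace T - U) \<inter> A) \<le> outer_content T h A"
  proof (rule outer_content_ge)
    fix V assume V: "openin T V" "A \<subseteq> V"
    let ?c = "outer_content T h ((topspace T - U) \<inter> A)"
    have KL: "ennreal (h K) + ?c \<le> inner_content T h V" if K: "compactin T K" "K \<subseteq> U \<inter> V" for K
    proof -
      have VK: "openin T (V - K)"
        using V(1) compactin_imp_closedin[OF T(1) K(1)] by blast
      have "ennreal (h K) + inner_content T h (V - K)
          = (SUP L\<in>{L. compactin T L \<and> L \<subseteq> V - K}. ennreal (h K) + ennreal (h L))"
        unfolding inner_content_def by (rule ennreal_SUP_add_right) (auto intro: exI[of _ "{}"])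
      also have "\<dots> \<le> inner_content T h V"
      proof (rule SUP_least, clarify)
        fix L assume L: "compactin T L" "L \<subseteq> V - K"
        have "disjnt K L"
          using L(2) by (auto simp: disjnt_def)
        then have "ennreal (h K) + ennreal (h L) = ennreal (h (K \<union> L))"
          using content_add[OF K(1) L(1)] content_nonneg[OF K(1)] content_nonneg[OF L(1)]
          by simp
        also have "\<dots> \<le> inner_content T h V"
          using K L by (intro inner_content_upper compactin_Un) auto
        finally show "ennreal (h K) + ennreal (h L) \<le> inner_content T h V" .
      qed
      finally have 1: "ennreal (h K) + inner_content T h (V - K) \<le> inner_content T h V" .
      have "?c \<le> inner_content T h (V - K)"
        using V K by (intro outer_content_lower VK) auto
      then show ?thesis
        using 1 add_left_mono order_trans by blast
    qed
    have "outer_content T h (U \<inter> A) + ?c \<le> inner_content T h (U \<inter> V) + ?c"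
      using U V by (intro add_right_mono outer_content_lower) auto
    also have "\<dots> = (SUP K\<in>{K. compactin T K \<and> K \<subseteq> U \<inter> V}. ennreal (h K) + ?c)"
      unfolding inner_content_def by (rule ennreal_SUP_add_left[symmetric]) (auto intro: exI[of _ "{}"])
    also have "\<dots> \<le> inner_content T h V"
      by (rule SUP_least) (use KL in auto)
    finally show "outer_content T h (U \<inter> A) + ?c \<le> inner_content T h V" .
  qed
  interpret sigma_algebra "topspace T" "Pow (topspace T)"
    by (rule sigma_algebra_Pow)
  have "subadditive (Pow (topspace T)) (outer_content T h)"
    using outer_content_outer_measure countably_subadditive_subadditive
    by (auto simp: outer_measure_space_def)
  then have "outer_content T h ((U \<inter> A) \<union> ((topspace T - U) \<inter> A))
      \<le> outer_content T h (U \<inter> A) + outer_content T h ((topspace T - U) \<inter> A)"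
    using A by (intro subadditiveD) auto
  moreover have "(U \<inter> A) \<union> ((topspace T - U) \<inter> A) = A"
    using A by blast
  ultimately show "outer_content T h A \<le> outer_content T h (U \<inter> A) + outer_content T h ((topspace T - U) \<inter> A)"
    by simp
qed

text \<open>
  Caratheodory's theorem for the outer measure of the content; regularity is built into the two
  definitions.
\<close>

theorem content_radon_measure:
  obtains M where "radon_measure T M" "\<And>U. openin T U \<Longrightarrow> emeasure M U = inner_content T h U"
proof -
  let ?\<Omega> = "topspace T" and ?\<O> = "{U. openin T U}"
  let ?L = "lambda_system ?\<Omega> (Pow ?\<Omega>) (outer_content T h)"
  define M where "M = measure_of ?\<Omega> ?\<O> (outer_content T h)"
  have L: "measure_space ?\<Omega> ?L (outer_content T h)"
    by (rule sigma_algebra.caratheodory_lemma[OF sigma_algebra_Pow outer_content_outer_measure])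
  then have sL: "sigma_algebra ?\<Omega> ?L"
    by (simp add: measure_space_def)
  have Osub: "?\<O> \<subseteq> Pow ?\<Omega>"
    by (auto dest: openin_subset)
  have "sigma_sets ?\<Omega> ?\<O> \<subseteq> ?L"
    using open_in_lambda_system by (intro sigma_algebra.sigma_sets_subset[OF sL]) auto
  then have ms: "measure_space ?\<Omega> (sigma_sets ?\<Omega> ?\<O>) (outer_content T h)"
    by (rule measure_down[OF L sigma_algebra_sigma_sets[OF Osub]])
  have sets_M: "sets M = sigma_sets ?\<Omega> ?\<O>" and sets_M': "sets M = sets (borel_on T)"
    using Osub by (auto simp: M_def)
  have em: "emeasure M E = outer_content T h E" if "E \<in> sets M" for E
    using that ms unfolding M_def sets_M[unfolded M_def]
    by (simp add: emeasure_measure_of_conv Osub)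
  have open_M: "emeasure M U = inner_content T h U" if "openin T U" for U
    using em[of U] that outer_content_open openin_sets_borel_on[OF that] sets_M' by simp
  have compact_M: "K \<in> sets M" if "compactin T K" for K
    using compactin_sets_borel_on[OF T(1) that] sets_M' by simp
  have "radon_measure T M"
    unfolding radon_measure_def
  proof (intro conjI allI impI ballI)
    show "sets M = sets (borel_on T)" by (fact sets_M')
    show "emeasure M K < \<infinity>" if K: "compactin T K" for K
    proof -
      obtain V C where V: "openin T V" "compactin T C" "K \<subseteq> V" "V \<subseteq> C"
        using T K locally_compact_space_compact_closed_compact[of T] by blast
      have "emeasure M K \<le> inner_content T h V"
        using em[OF compact_M[OF K]] outer_content_lower[OF V(1,3)] by simp
      also have "\<dots> \<le> ennreal (h C)"
        using V by (intro inner_content_le ennreal_leI content_mono) auto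
      also have "\<dots> < \<infinity>" by simp
      finally show ?thesis .
    qed
    show "emeasure M E = (INF U\<in>{U. openin T U \<and> E \<subseteq> U}. emeasure M U)" if "E \<in> sets M" for E
      unfolding em[OF that] outer_content_def by (intro INF_cong) (auto simp: open_M)
    show "emeasure M U = (SUP K\<in>{K. compactin T K \<and> K \<subseteq> U}. emeasure M K)" if U: "openin T U" for U
    proof (rule antisym)
      show "(SUP K\<in>{K. compactin T K \<and> K \<subseteq> U}. emeasure M K) \<le> emeasure M U"
        using openin_sets_borel_on[OF U] sets_M' by (intro SUP_least emeasure_mono) auto
      show "emeasure M U \<le> (SUP K\<in>{K. compactin T K \<and> K \<subseteq> U}. emeasure M K)"
        unfolding open_M[OF U]
      proof (rule inner_content_le)
        fix K assume K: "compactin T K" "K \<subseteq> U"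
        have "ennreal (h K) \<le> emeasure M K"
          unfolding em[OF compact_M[OF K(1)]]
          by (rule outer_content_ge) (rule inner_content_upper[OF K(1)])
        also have "\<dots> \<le> (SUP K\<in>{K. compactin T K \<and> K \<subseteq> U}. emeasure M K)"
          using K by (intro SUP_upper) auto
        finally show "ennreal (h K) \<le> (SUP K\<in>{K. compactin T K \<and> K \<subseteq> U}. emeasure M K)" .
      qed
    qed
  qed
  then show thesis
    using open_M by (rule that)
qed

end

section \<open>Existence of Haar measure\<close>

context locally_compact_group
begin

text \<open>
  Invariance passes from compact to open sets by suprema, and from these to Borel sets by outer
  regularity.
\<close>

lemma left_haar_measure_from_content:
  assumes h: "compact_content T h" and inv: "\<And>a K. \<lbrakk>a \<in> carrier G; compactin T K\<rbrakk> \<Longrightarrow> h (a <# K) = h K"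
    and pos: "compactin T K0" "0 < h K0"
  obtains M where "left_haar_measure G T M"
proof -
  obtain M where M: "radon_measure T M" and open_M: "\<And>U. openin T U \<Longrightarrow> emeasure M U = inner_content T h U"
    by (fact content_radon_measure[OF lch h])
  have sub: "A \<subseteq> carrier G" if "compactin T A \<or> openin T A \<or> A \<in> sets M" for A
    using that compactin_subset_topspace openin_subset sets.sets_into_space radon_space[OF lch M]
      topspace_eq_carrier by metis
  have cc: "compactin T (a <# K)" if "a \<in> carrier G" "compactin T K" for a K
    unfolding l_coset_image
    using image_compactin[OF that(2) homeomorphic_imp_continuous_map[OF homeomorphic_left_translation[OF that(1)]]] .
  have open_le: "emeasure M U \<le> emeasure M (a <# U)" if a: "a \<in> carrier G" and U: "openin T U" for a U
    unfolding open_M[OF U]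
  proof (rule inner_content_le[OF lch h])
    fix K assume K: "compactin T K" "K \<subseteq> U"
    have "ennreal (h (a <# K)) \<le> inner_content T h (a <# U)"
      using K by (intro inner_content_upper[OF lch h] cc a) (auto simp: l_coset_image)
    then show "ennreal (h K) \<le> emeasure M (a <# U)"
      using inv[OF a K(1)] open_M[OF openin_left_translate[OF a U]] by simp
  qed
  have untranslate: "inv a <# (a <# A) = A" if "a \<in> carrier G" "A \<subseteq> carrier G" for a A
    using that by (simp add: lcos_m_assoc lcos_mult_one)
  have open_eq: "emeasure M (a <# U) = emeasure M U" if a: "a \<in> carrier G" and U: "openin T U" for a U
    using open_le[OF a U] open_le[OF inv_closed[OF a] openin_left_translate[OF a U]] untranslate[OF a sub] U by simp
  have le: "emeasure M (a <# E) \<le> emeasure M E" if a: "a \<in> carrier G" and E: "E \<in> sets M" for a E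
  proof -
    have "emeasure M E = (INF U\<in>{U. openin T U \<and> E \<subseteq> U}. emeasure M U)"
      using M E by (simp add: radon_measure_def)
    moreover have "emeasure M (a <# E) \<le> emeasure M U" if U: "openin T U" "E \<subseteq> U" for U
    proof -
      have "emeasure M (a <# E) \<le> emeasure M (a <# U)"
        using U by (intro emeasure_mono radon_open[OF lch M] openin_left_translate a) (auto simp: l_coset_image)
      then show ?thesis using open_eq[OF a U(1)] by simp
    qed
    ultimately show ?thesis
      by (auto intro: INF_greatest)
  qed
  have "emeasure M (a <# E) = emeasure M E" if a: "a \<in> carrier G" and E: "E \<in> sets M" for a E
    using le[OF a E] le[OF inv_closed[OF a] sets_l_coset[OF M a E]] untranslate[OF a sub] E by simp
  moreover have "emeasure M (space M) \<noteq> 0"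
  proof -
    have "ennreal (h K0) \<le> inner_content T h (topspace T)"
      using pos compactin_subset_topspace by (intro inner_content_upper[OF lch h]) auto
    then show ?thesis
      using pos(2) open_M[of "topspace T"] radon_space[OF lch M] by (auto simp: ennreal_eq_0_iff)
  qed
  ultimately have "left_haar_measure G T M"
    using M by (simp add: left_haar_measure_iff_radon)
  then show thesis by (rule that)
qed

definition covering_number :: "'a set \<Rightarrow> 'a set \<Rightarrow> nat" where
  "covering_number A V = (LEAST n. \<exists>S. finite S \<and> S \<subseteq> carrier G \<and> A \<subseteq> (\<Union>s\<in>S. s <# V) \<and> card S = n)"

definition identity_nbhds :: "'a set set" where
  "identity_nbhds = {V. openin T V \<and> \<one> \<in> V}"

lemma covering_number_le:
  "\<lbrakk>finite S; S \<subseteq> carrier G; A \<subseteq> (\<Union>s\<in>S. s <# V)\<rbrakk> \<Longrightarrow> covering_number A V \<le> card S"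
  unfolding covering_number_def by (rule Least_le) auto

lemma covering_number_attained:
  assumes V: "V \<in> identity_nbhds" and A: "compactin T K" "A \<subseteq> K"
  obtains S where "finite S" "S \<subseteq> carrier G" "A \<subseteq> (\<Union>s\<in>S. s <# V)" "card S = covering_number A V"
proof -
  have KG: "K \<subseteq> carrier G"
    using A compactin_subset_topspace topspace_eq_carrier by blast
  have "openin T (s <# V)" "s \<in> s <# V" if "s \<in> K" for s
  proof -
    have s: "s \<in> carrier G" using that KG by blast
    show "openin T (s <# V)"
      using V s by (intro openin_left_translate) (auto simp: identity_nbhds_def)
    show "s \<in> s <# V"
      unfolding l_coset_image using V s by (intro image_eqI[of _ _ \<one>]) (auto simp: identity_nbhds_def)
  qed
  then have "\<exists>\<F>. finite \<F> \<and> \<F> \<subseteq> (\<lambda>s. s <# V) ` K \<and> K \<subseteq> \<Union>\<F>"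
    using A(1) unfolding compactin_def by (elim conjE allE[of _ "(\<lambda>s. s <# V) ` K"]) blast
  then obtain S where S: "finite S" "S \<subseteq> K" "K \<subseteq> (\<Union>s\<in>S. s <# V)"
    by (metis finite_subset_image)
  then have "\<exists>n S. finite S \<and> S \<subseteq> carrier G \<and> A \<subseteq> (\<Union>s\<in>S. s <# V) \<and> card S = n"
    using A(2) KG by (intro exI[of _ "card S"] exI[of _ S]) auto
  then have "\<exists>S. finite S \<and> S \<subseteq> carrier G \<and> A \<subseteq> (\<Union>s\<in>S. s <# V) \<and> card S = covering_number A V"
    unfolding covering_number_def by (rule LeastI_ex)
  then show thesis using that by blast
qed

lemma covering_number_mono:
  assumes "V \<in> identity_nbhds" "compactin T L" "K \<subseteq> L"
  shows "covering_number K V \<le> covering_number L V"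
proof -
  obtain S where "finite S" "S \<subseteq> carrier G" "L \<subseteq> (\<Union>s\<in>S. s <# V)" "card S = covering_number L V"
    by (fact covering_number_attained[OF assms(1,2) order_refl])
  then show ?thesis
    using covering_number_le[of S K V] assms(3) by auto
qed

lemma covering_number_Un_le:
  assumes "V \<in> identity_nbhds" "compactin T K" "compactin T L"
  shows "covering_number (K \<union> L) V \<le> covering_number K V + covering_number L V"
proof -
  obtain S where S: "finite S" "S \<subseteq> carrier G" "K \<subseteq> (\<Union>s\<in>S. s <# V)" "card S = covering_number K V"
    by (fact covering_number_attained[OF assms(1,2) order_refl])
  obtain R where R: "finite R" "R \<subseteq> carrier G" "L \<subseteq> (\<Union>s\<in>R. s <# V)" "card R = covering_number L V"
    by (fact covering_number_attained[OF assms(1,3) order_refl])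
  have "covering_number (K \<union> L) V \<le> card (S \<union> R)"
    using S R by (intro covering_number_le) auto
  also have "\<dots> \<le> card S + card R"
    by (rule card_Un_le)
  finally show ?thesis
    using S R by simp
qed

text \<open>
  No translate of \<open>V\<close> meets both sets, so a cover of the union splits into covers
  of the parts.
\<close>

lemma covering_number_Un_eq:
  assumes V: "V \<in> identity_nbhds" and KL: "compactin T K" "compactin T L"
    and sep: "\<And>s. s \<in> carrier G \<Longrightarrow> (s <# V) \<inter> K = {} \<or> (s <# V) \<inter> L = {}"
  shows "covering_number (K \<union> L) V = covering_number K V + covering_number L V"
proof (rule antisym[OF covering_number_Un_le[OF V KL]])
  obtain S where S: "finite S" "S \<subseteq> carrier G" "K \<union> L \<subseteq> (\<Union>s\<in>S. s <# V)" "card S = covering_number (K \<union> L) V"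
    by (fact covering_number_attained[OF V compactin_Un[OF KL] order_refl])
  define S1 where "S1 = {s \<in> S. (s <# V) \<inter> K \<noteq> {}}"
  define S2 where "S2 = {s \<in> S. (s <# V) \<inter> L \<noteq> {}}"
  have "K \<subseteq> (\<Union>s\<in>S1. s <# V)" "L \<subseteq> (\<Union>s\<in>S2. s <# V)"
    using S(3) unfolding S1_def S2_def by blast+
  then have "covering_number K V \<le> card S1" "covering_number L V \<le> card S2"
    using S(1,2) by (auto intro!: covering_number_le simp: S1_def S2_def)
  moreover have "card S1 + card S2 = card (S1 \<union> S2)"
    using S(1,2) sep by (intro card_Un_disjoint[symmetric]) (auto simp: S1_def S2_def)
  moreover have "card (S1 \<union> S2) \<le> card S"
    using S(1) by (intro card_mono) (auto simp: S1_def S2_def)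
  ultimately show "covering_number K V + covering_number L V \<le> covering_number (K \<union> L) V"
    using S(4) by simp
qed

lemma covering_number_translate:
  assumes V: "V \<in> identity_nbhds" and a: "a \<in> carrier G" and K: "compactin T K"
  shows "covering_number (a <# K) V = covering_number K V"
proof -
  have le: "covering_number (b <# C) V \<le> covering_number C V" if b: "b \<in> carrier G" and C: "compactin T C" for b C
  proof -
    obtain S where S: "finite S" "S \<subseteq> carrier G" "C \<subseteq> (\<Union>s\<in>S. s <# V)" "card S = covering_number C V"
      by (fact covering_number_attained[OF V C order_refl])
    have VG: "V \<subseteq> carrier G"
      using V openin_subset topspace_eq_carrier by (fastforce simp: identity_nbhds_def)
    have "covering_number (b <# C) V \<le> card ((\<lambda>s. b \<otimes> s) ` S)"
    proof (rule covering_number_le)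
      show "b <# C \<subseteq> (\<Union>s\<in>(\<lambda>s. b \<otimes> s) ` S. s <# V)"
      proof
        fix x assume "x \<in> b <# C"
        then obtain y where y: "y \<in> C" "x = b \<otimes> y"
          by (auto simp: l_coset_image)
        then obtain s v where sv: "s \<in> S" "v \<in> V" "y = s \<otimes> v"
          using S(3) by (fastforce simp: l_coset_image)
        then have "x = (b \<otimes> s) \<otimes> v"
          using y b m_assoc[OF b subsetD[OF S(2) sv(1)] subsetD[OF VG sv(2)]] by simp
        then show "x \<in> (\<Union>s\<in>(\<lambda>s. b \<otimes> s) ` S. s <# V)"
          using sv by (auto simp: l_coset_image)
      qed
    qed (use S b in auto)
    also have "\<dots> \<le> card S"
      by (rule card_image_le[OF S(1)])
    finally show ?thesis using S(4) by simp
  qed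
  have "K \<subseteq> carrier G"
    using K compactin_subset_topspace topspace_eq_carrier by blast
  then have "inv a <# (a <# K) = K"
    using a by (simp add: lcos_m_assoc lcos_mult_one)
  moreover have "compactin T (a <# K)"
    unfolding l_coset_image
    using image_compactin[OF K homeomorphic_imp_continuous_map[OF homeomorphic_left_translation[OF a]]] .
  ultimately show ?thesis
    using le[OF a K] le[OF inv_closed[OF a], of "a <# K"] by simp
qed

text \<open>
  Cover each of the translates of \<open>W \<subseteq> C\<close> by translates of \<open>V\<close>. This bounds the normalized covering
  numbers independently of \<open>V\<close>.
\<close>

lemma covering_number_product:
  assumes V: "V \<in> identity_nbhds" and W: "W \<in> identity_nbhds" "W \<subseteq> C" and C: "compactin T C" and K: "compactin T K"
  shows "covering_number K V \<le> covering_number K W * covering_number C V"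
proof -
  obtain S where S: "finite S" "S \<subseteq> carrier G" "K \<subseteq> (\<Union>s\<in>S. s <# W)" "card S = covering_number K W"
    by (fact covering_number_attained[OF W(1) K order_refl])
  obtain R where R: "finite R" "R \<subseteq> carrier G" "C \<subseteq> (\<Union>s\<in>R. s <# V)" "card R = covering_number C V"
    by (fact covering_number_attained[OF V C order_refl])
  have VG: "V \<subseteq> carrier G"
    using V openin_subset topspace_eq_carrier by (fastforce simp: identity_nbhds_def)
  have "covering_number K V \<le> card ((\<lambda>(s, t). s \<otimes> t) ` (S \<times> R))"
  proof (rule covering_number_le)
    show "K \<subseteq> (\<Union>s\<in>(\<lambda>(s, t). s \<otimes> t) ` (S \<times> R). s <# V)"
    proof
      fix x assume "x \<in> K"
      then obtain s w where s: "s \<in> S" "w \<in> W" "x = s \<otimes> w"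
        using S(3) by (fastforce simp: l_coset_image)
      then obtain t v where t: "t \<in> R" "v \<in> V" "w = t \<otimes> v"
        using R(3) W(2) by (fastforce simp: l_coset_image)
      have "x = (s \<otimes> t) \<otimes> v"
        using s(3) t(3) m_assoc[OF subsetD[OF S(2) s(1)] subsetD[OF R(2) t(1)] subsetD[OF VG t(2)]] by simp
      then show "x \<in> (\<Union>s\<in>(\<lambda>(s, t). s \<otimes> t) ` (S \<times> R). s <# V)"
        using s t by (auto simp: l_coset_image)
    qed
  qed (use S R in auto)
  also have "\<dots> \<le> card (S \<times> R)"
    using S R by (intro card_image_le) auto
  finally show ?thesis
    using S R by (simp add: card_cartesian_product)
qed

text \<open>
  If \<open>s u \<in> K\<close> and \<open>s v \<in> L\<close> then \<open>u\<inverse> v\<close> lies in the compact set \<open>K\<inverse> L\<close>, which misses the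
  identity; so \<open>u\<close> and \<open>v\<close> cannot both be close to the identity.
\<close>

lemma disjoint_compacts_separated:
  assumes K: "compactin T K" and L: "compactin T L" and disj: "disjnt K L"
  obtains V where "V \<in> identity_nbhds"
    "\<And>U s. \<lbrakk>U \<subseteq> V; s \<in> carrier G\<rbrakk> \<Longrightarrow> (s <# U) \<inter> K = {} \<or> (s <# U) \<inter> L = {}"
proof -
  have KG: "K \<subseteq> carrier G" and LG: "L \<subseteq> carrier G"
    using K L compactin_subset_topspace topspace_eq_carrier by blast+
  let ?q = "\<lambda>z. inv (fst z) \<otimes> snd z"
  have q: "continuous_map (prod_topology T T) T ?q"
    by (intro continuous_map_mult continuous_map_inverse continuous_map_fst continuous_map_snd)
  define C where "C = ?q ` (K \<times> L)"
  have "compactin T C"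
    unfolding C_def using K L by (intro image_compactin[OF _ q]) (simp add: compactin_Times)
  then have "closedin T C"
    using compactin_imp_closedin[OF Hausdorff] by blast
  define R where "R = {z \<in> topspace (prod_topology T T). ?q z \<in> topspace T - C}"
  have "openin (prod_topology T T) R"
    unfolding R_def using \<open>closedin T C\<close> by (intro openin_continuous_map_preimage[OF q]) auto
  moreover have "\<one> \<notin> C"
  proof
    assume "\<one> \<in> C"
    then obtain k l where "k \<in> K" "l \<in> L" "\<one> = inv k \<otimes> l"
      by (auto simp: C_def)
    moreover from this have "k \<in> carrier G" "l \<in> carrier G"
      using KG LG by auto
    then have "l = k \<otimes> (inv k \<otimes> l)"
      by (simp add: m_assoc[symmetric])
    ultimately have "k = l"
      using \<open>k \<in> carrier G\<close> by (metis r_one)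
    then show False
      using \<open>k \<in> K\<close> \<open>l \<in> L\<close> disj by (auto simp: disjnt_def)
  qed
  then have "(\<one>, \<one>) \<in> R"
    by (auto simp: R_def topspace_eq_carrier)
  ultimately obtain A B where AB: "openin T A" "openin T B" "\<one> \<in> A" "\<one> \<in> B" "A \<times> B \<subseteq> R"
    using openin_prod_topology_alt[of T T R, THEN iffD1, rule_format, of \<one> \<one>] by auto
  show thesis
  proof (rule that[of "A \<inter> B"])
    show "A \<inter> B \<in> identity_nbhds"
      using AB by (auto simp: identity_nbhds_def)
    fix U s assume U: "U \<subseteq> A \<inter> B" and s: "s \<in> carrier G"
    show "(s <# U) \<inter> K = {} \<or> (s <# U) \<inter> L = {}"
    proof (rule ccontr)
      assume "\<not> ?thesis"
      then obtain u v where uv: "u \<in> U" "v \<in> U" "s \<otimes> u \<in> K" "s \<otimes> v \<in> L"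
        by (auto simp: l_coset_image)
      have uvG: "u \<in> carrier G" "v \<in> carrier G"
        using uv U AB openin_subset topspace_eq_carrier by fast+
      have "inv u \<otimes> v = inv (s \<otimes> u) \<otimes> (s \<otimes> v)"
        using s uvG by (simp add: inv_mult_group m_assoc) (simp add: m_assoc[symmetric])
      then have "inv u \<otimes> v \<in> C"
        unfolding C_def using uv by (intro image_eqI[of _ _ "(s \<otimes> u, s \<otimes> v)"]) auto
      moreover have "(u, v) \<in> R"
        using AB(5) uv U by auto
      ultimately show False
        by (simp add: R_def)
    qed
  qed
qed

text \<open>
  Weil's argument. The ratios \<open>(K : V) / (K0 : V)\<close> of covering numbers are invariant and
  subadditive, and additive on two given disjoint compact sets once \<open>V\<close> is small. They lie in a
  compact product of intervals, so they have a cluster point as \<open>V\<close> shrinks, and each of these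
  properties is a closed condition that the cluster point inherits.
\<close>

theorem left_haar_measure_exists: obtains M where "left_haar_measure G T M"
proof -
  have one: "\<one> \<in> topspace T"
    by (simp add: topspace_eq_carrier)
  obtain W K0 where W: "openin T W" "compactin T K0" "\<one> \<in> W" "W \<subseteq> K0"
    using locally_compact one unfolding locally_compact_space_def by blast
  have Wn: "W \<in> identity_nbhds"
    using W by (simp add: identity_nbhds_def)
  \<comment> \<open>The product of intervals is indexed by all sets, so \<open>hV\<close> and the bound are \<open>0\<close> off the compact sets.\<close>
  define hV where "hV = (\<lambda>V K. if compactin T K then real (covering_number K V) / real (covering_number K0 V) else 0)"
  define b where "b = (\<lambda>K. if compactin T K then real (covering_number K W) else 0)"
  have pos: "0 < covering_number K0 V" if V: "V \<in> identity_nbhds" for V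
  proof -
    obtain S where S: "finite S" "S \<subseteq> carrier G" "K0 \<subseteq> (\<Union>s\<in>S. s <# V)" "card S = covering_number K0 V"
      by (fact covering_number_attained[OF V W(2) order_refl])
    have "S \<noteq> {}" using S(3) W by auto
    then show ?thesis using S by (metis card_gt_0_iff)
  qed
  have hV_eq: "hV V K * real (covering_number K0 V) = real (covering_number K V)"
    if "V \<in> identity_nbhds" "compactin T K" for V K
    using pos[OF that(1)] that(2) by (simp add: hV_def)
  define P where "P = PiE UNIV (\<lambda>K. {0..b K})"
  have P: "compact P"
  proof -
    have "compactin (product_topology (\<lambda>i. euclidean) UNIV) P"
      unfolding P_def compactin_PiE by simp
    then show ?thesis by (simp add: euclidean_product_topology)
  qed
  have hP: "hV V \<in> P" if V: "V \<in> identity_nbhds" for V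
  proof -
    have "0 \<le> hV V K \<and> hV V K \<le> b K" for K
    proof (cases "compactin T K")
      case True
      have "real (covering_number K V) \<le> real (covering_number K W) * real (covering_number K0 V)"
        using covering_number_product[OF V Wn W(4,2) True] by (simp flip: of_nat_mult)
      then show ?thesis
        using pos[OF V] True by (simp add: hV_def b_def field_simps)
    qed (simp add: hV_def b_def)
    then show ?thesis by (simp add: P_def PiE_def Pi_def)
  qed
  define C where "C = (\<lambda>V. closure {hV U | U. U \<in> identity_nbhds \<and> U \<subseteq> V})"
  have "P \<inter> (\<Inter>V\<in>identity_nbhds. C V) \<noteq> {}"
  proof (rule compact_imp_fip_image[OF P])
    show "closed (C V)" for V by (simp add: C_def)
    fix I assume I: "finite I" "I \<subseteq> identity_nbhds"
    define V where "V = topspace T \<inter> \<Inter>I"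
    have V: "V \<in> identity_nbhds"
    proof -
      have "openin T V"
        unfolding V_def using I by (cases "I = {}") (auto simp: identity_nbhds_def intro!: openin_Int openin_Inter)
      then show ?thesis
        using I one by (auto simp: identity_nbhds_def V_def)
    qed
    have "hV V \<in> C U" if "U \<in> I" for U
      unfolding C_def using V that by (intro subsetD[OF closure_subset]) (auto simp: V_def)
    then show "P \<inter> (\<Inter>i\<in>I. C i) \<noteq> {}"
      using hP[OF V] by blast
  qed
  then obtain h where hC: "\<And>V. V \<in> identity_nbhds \<Longrightarrow> h \<in> C V" and hP': "h \<in> P"
    by blast
  have transfer: "h \<in> Q" if "closed Q" "V \<in> identity_nbhds"
    "\<And>U. \<lbrakk>U \<in> identity_nbhds; U \<subseteq> V\<rbrakk> \<Longrightarrow> hV U \<in> Q" for Q V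
    using hC[OF that(2)] closure_minimal[of "{hV U | U. U \<in> identity_nbhds \<and> U \<subseteq> V}" Q] that
    unfolding C_def by blast
  have content: "compact_content T h"
    unfolding compact_content_def
  proof (intro conjI allI impI)
    show "0 \<le> h K" for K
      using hP' by (auto simp: P_def PiE_def Pi_def)
    show "h K \<le> h L" if "compactin T K" "compactin T L" "K \<subseteq> L" for K L
    proof -
      have "h \<in> {h. h K \<le> h L}"
        by (rule transfer[OF _ Wn])
          (use that covering_number_mono in \<open>auto intro!: closed_Collect_le divide_right_mono simp: hV_def\<close>)
      then show ?thesis by simp
    qed
    show "h (K \<union> L) \<le> h K + h L" if "compactin T K" "compactin T L" for K L
    proof -
      have "h \<in> {h. h (K \<union> L) \<le> h K + h L}"
      proof (rule transfer[OF _ Wn])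
        show "closed {h :: 'a set \<Rightarrow> real. h (K \<union> L) \<le> h K + h L}"
          by (intro closed_Collect_le continuous_intros) simp_all
        fix U assume U: "U \<in> identity_nbhds"
        have "real (covering_number (K \<union> L) U) \<le> real (covering_number K U) + real (covering_number L U)"
          using covering_number_Un_le[OF U that] by (simp flip: of_nat_add)
        then show "hV U \<in> {h. h (K \<union> L) \<le> h K + h L}"
          using that compactin_Un[OF that] by (simp add: hV_def add_divide_distrib[symmetric] divide_right_mono)
      qed
      then show ?thesis by simp
    qed
    show "h (K \<union> L) = h K + h L" if KL: "compactin T K" "compactin T L" "disjnt K L" for K L
    proof -
      obtain V where V: "V \<in> identity_nbhds"
        "\<And>U s. \<lbrakk>U \<subseteq> V; s \<in> carrier G\<rbrakk> \<Longrightarrow> (s <# U) \<inter> K = {} \<or> (s <# U) \<inter> L = {}"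
        by (fact disjoint_compacts_separated[OF KL])
      have "h \<in> {h. h (K \<union> L) = h K + h L}"
      proof (rule transfer[OF _ V(1)])
        show "closed {h :: 'a set \<Rightarrow> real. h (K \<union> L) = h K + h L}"
          by (intro closed_Collect_eq continuous_intros) simp_all
        fix U assume U: "U \<in> identity_nbhds" "U \<subseteq> V"
        show "hV U \<in> {h. h (K \<union> L) = h K + h L}"
          using covering_number_Un_eq[OF U(1) KL(1,2) V(2)[OF U(2)]] KL compactin_Un[OF KL(1,2)]
          by (simp add: hV_def add_divide_distrib)
      qed
      then show ?thesis by simp
    qed
  qed
  have inv: "h (a <# K) = h K" if "a \<in> carrier G" "compactin T K" for a K
  proof -
    have "compactin T (a <# K)"
      unfolding l_coset_image
      using image_compactin[OF that(2) homeomorphic_imp_continuous_map[OF homeomorphic_left_translation[OF that(1)]]] .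
    then have "h \<in> {h. h (a <# K) = h K}"
      by (intro transfer[OF _ Wn])
        (use that covering_number_translate in \<open>auto intro!: closed_Collect_eq simp: hV_def\<close>)
    then show ?thesis by simp
  qed
  have "h \<in> {h. h K0 = 1}"
    by (rule transfer[OF _ Wn]) (use W pos in \<open>auto intro!: closed_Collect_eq simp: hV_def\<close>)
  then have "0 < h K0" by simp
  then show thesis
    using left_haar_measure_from_content[OF content inv W(2)] that by blast
qed

end

section \<open>The modular function and the modulus of an automorphism\<close>

lemma (in group) injective_idempotent_hom_identity:
  assumes f: "f \<in> hom G G" "inj_on f (carrier G)" and idem: "\<And>x. x \<in> carrier G \<Longrightarrow> f (f x) = f x"
    and x: "x \<in> carrier G"
  shows "f x = x"
proof (rule inj_onD[OF f(2) idem[OF x] _ x])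
  show "f x \<in> carrier G"
    by (rule hom_in_carrier[OF f(1) x])
qed

context locally_compact_group
begin

text \<open>
  Some set has positive finite measure, namely an open neighbourhood of the identity inside a
  compact set.
\<close>

lemma left_haar_scale_unique:
  assumes M: "left_haar_measure G T M" and r: "0 < r" "0 < q"
    and eq: "\<And>E. E \<in> sets M \<Longrightarrow> ennreal r * emeasure M E = ennreal q * emeasure M E"
  shows "r = q"
proof -
  have "\<one> \<in> topspace T"
    by (simp add: topspace_eq_carrier)
  then obtain U K where U: "openin T U" "compactin T K" "\<one> \<in> U" "U \<subseteq> K"
    using locally_compact unfolding locally_compact_space_def by blast
  note R = left_haar_radon[OF M]
  have pos: "emeasure M U \<noteq> 0"
    using left_haar_open_pos[OF M U(1)] U(3) by blast
  have "emeasure M U \<le> emeasure M K"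
    using U by (intro emeasure_mono radon_compact[OF lch R])
  then have "emeasure M U < \<infinity>"
    using radon_compact_finite[OF lch R U(2)] by (rule le_less_trans)
  then obtain a where a: "emeasure M U = ennreal a" "0 \<le> a"
    by (cases "emeasure M U") auto
  then have "ennreal (r * a) = ennreal (q * a)"
    using eq[OF radon_open[OF lch R U(1)]] r by (simp add: ennreal_mult)
  then show ?thesis
    using a r pos by (auto simp: ennreal_inj)
qed

text \<open>
  The description that defines the modular function is satisfied by exactly one number: existence
  and uniqueness of Haar measure make the factor found for one measure valid for all.
\<close>

lemma modular_function_spec:
  assumes s: "s \<in> carrier G"
  shows "0 < modular_function G T s \<and> (\<forall>M. left_haar_measure G T M \<longrightarrow>
    (\<forall>E\<in>sets M. emeasure M (E #> s) = ennreal (modular_function G T s) * emeasure M E))"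
  unfolding modular_function_def
proof (rule theI')
  let ?P = "\<lambda>r. 0 < r \<and> (\<forall>M. left_haar_measure G T M \<longrightarrow>
    (\<forall>E\<in>sets M. emeasure M (E #> s) = ennreal r * emeasure M E))"
  obtain M where M: "left_haar_measure G T M"
    by (fact left_haar_measure_exists)
  obtain r where r: "0 < r"
    "\<And>E. E \<in> sets M \<Longrightarrow> emeasure M ((\<lambda>x. x \<otimes> s) ` E) = ennreal r * emeasure M E"
    by (rule left_haar_measure_transport[OF M homeomorphic_right_translation[OF s]]) (use s m_assoc in blast)+
  have "emeasure M' (E #> s) = ennreal r * emeasure M' E" if M': "left_haar_measure G T M'" and E: "E \<in> sets M'" for M' E
  proof -
    obtain k where k: "0 < k" "\<And>E. E \<in> sets M \<Longrightarrow> emeasure M' E = ennreal k * emeasure M E"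
      by (fact left_haar_measure_unique[OF M M'])
    have E': "E \<in> sets M"
      using E M M' by (simp add: left_haar_measure_def)
    then have "E #> s \<in> sets M"
      unfolding r_coset_image by (rule left_haar_sets_image[OF M homeomorphic_right_translation[OF s]])
    then show ?thesis
      using k(2) r(2) E' by (simp add: r_coset_image mult.left_commute)
  qed
  then have ex: "?P r" using r(1) by blast
  show "\<exists>!r. ?P r"
  proof (rule ex1I[of ?P r])
    show "?P r" by (fact ex)
    fix q assume "?P q"
    then show "q = r"
      using left_haar_scale_unique[OF M] ex M by metis
  qed
qed

lemma modular_function_pos: "s \<in> carrier G \<Longrightarrow> 0 < modular_function G T s"
  using modular_function_spec by blast

lemma emeasure_right_translate:
  "\<lbrakk>s \<in> carrier G; left_haar_measure G T M; E \<in> sets M\<rbrakk> \<Longrightarrow>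
    emeasure M (E #> s) = ennreal (modular_function G T s) * emeasure M E"
  using modular_function_spec by blast

lemma modular_function_eqI:
  assumes "s \<in> carrier G" "left_haar_measure G T M" "0 < r"
    "\<And>E. E \<in> sets M \<Longrightarrow> emeasure M (E #> s) = ennreal r * emeasure M E"
  shows "modular_function G T s = r"
  using assms left_haar_scale_unique[OF assms(2) modular_function_pos[OF assms(1)] assms(3)]
    emeasure_right_translate by metis

lemma modular_function_one: "modular_function G T \<one> = 1"
proof -
  obtain M where M: "left_haar_measure G T M"
    by (fact left_haar_measure_exists)
  show ?thesis
    using left_haar_sets_subset[OF M] by (intro modular_function_eqI[OF one_closed M]) auto
qed

lemma modular_function_mult:
  assumes "s \<in> carrier G" "t \<in> carrier G"
  shows "modular_function G T (s \<otimes> t) = modular_function G T s * modular_function G T t"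
proof -
  obtain M where M: "left_haar_measure G T M"
    by (fact left_haar_measure_exists)
  show ?thesis
  proof (rule modular_function_eqI[OF _ M])
    fix E assume E: "E \<in> sets M"
    have "E #> (s \<otimes> t) = (E #> s) #> t"
      using left_haar_sets_subset[OF M E] assms by (simp add: coset_mult_assoc)
    moreover have "E #> s \<in> sets M"
      unfolding r_coset_image
      by (rule left_haar_sets_image[OF M homeomorphic_right_translation[OF assms(1)] E])
    ultimately show "emeasure M (E #> (s \<otimes> t)) = ennreal (modular_function G T s * modular_function G T t) * emeasure M E"
      using assms E emeasure_right_translate[OF _ M] modular_function_pos
      by (simp add: ennreal_mult less_imp_le mult_ac)
  qed (use assms modular_function_pos in auto)
qed

lemma modular_function_inv:
  assumes "s \<in> carrier G" shows "modular_function G T (inv s) = 1 / modular_function G T s"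
  using modular_function_mult[OF assms inv_closed[OF assms]] modular_function_one modular_function_pos[OF assms] assms
  by (simp add: field_simps)

lemma integral_right_translate:
  assumes "s \<in> carrier G" "left_haar_measure G T M" "f \<in> Cc T"
  shows "(\<integral>x. f x \<partial>M) = modular_function G T s * (\<integral>x. f (x \<otimes> s) \<partial>M)"
  using emeasure_right_translate[OF assms(1,2)]
  by (intro integral_homeomorphic_scaled[OF lch left_haar_radon[OF assms(2)]
        homeomorphic_right_translation[OF assms(1)] modular_function_pos[OF assms(1)] _ assms(3)])
    (simp add: r_coset_image)

text \<open>
  The kernel is a subgroup, and translates of a neighbourhood of the identity in it stay in it.
\<close>

lemma modular_kernel_open_iff:
  "openin T {s \<in> carrier G. modular_function G T s = 1} \<longleftrightarrow>
     (\<exists>V. openin T V \<and> \<one> \<in> V \<and> (\<forall>s\<in>V. modular_function G T s = 1))" (is "openin T ?K \<longleftrightarrow> ?R")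
proof
  assume "openin T ?K"
  then show ?R
    using modular_function_one by (intro exI[of _ ?K]) auto
next
  assume ?R
  then obtain V where V: "openin T V" "\<one> \<in> V" "\<And>s. s \<in> V \<Longrightarrow> modular_function G T s = 1"
    by blast
  have VG: "V \<subseteq> carrier G"
    using openin_subset[OF V(1)] topspace_eq_carrier by simp
  show "openin T ?K"
  proof (subst openin_subopen, intro ballI)
    fix s assume "s \<in> ?K"
    then have s: "s \<in> carrier G" "modular_function G T s = 1" by auto
    have "s \<in> s <# V"
      unfolding l_coset_image using s V(2) by (intro image_eqI[of _ _ \<one>]) auto
    moreover have "s <# V \<subseteq> ?K"
      using s V(3) VG modular_function_mult by (auto simp: l_coset_image)
    ultimately show "\<exists>W. openin T W \<and> s \<in> W \<and> W \<subseteq> ?K"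
      using openin_left_translate[OF s(1) V(1)] by blast
  qed
qed

lemma topological_automorphism_homeo:
  "f \<in> topological_automorphisms G T \<Longrightarrow> homeomorphic_map T T f"
  by (simp add: topological_automorphisms_def)

lemma topological_automorphism_hom: "f \<in> topological_automorphisms G T \<Longrightarrow> f \<in> hom G G"
  by (simp add: topological_automorphisms_def iso_def)

lemma haar_ratio_spec:
  assumes M: "left_haar_measure G T M" and f: "f \<in> topological_automorphisms G T"
  shows "0 < haar_ratio M f \<and> (\<forall>E\<in>sets M. emeasure M (f ` E) = ennreal (haar_ratio M f) * emeasure M E)"
  unfolding haar_ratio_def
proof (rule theI')
  let ?P = "\<lambda>r. 0 < r \<and> (\<forall>E\<in>sets M. emeasure M (f ` E) = ennreal r * emeasure M E)"
  have "\<exists>x'\<in>carrier G. \<forall>y\<in>carrier G. f (x \<otimes> y) = x' \<otimes> f y" if "x \<in> carrier G" for x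
    using topological_automorphism_hom[OF f] that by (auto simp: hom_def Pi_iff)
  then obtain r where r: "0 < r" "\<And>E. E \<in> sets M \<Longrightarrow> emeasure M (f ` E) = ennreal r * emeasure M E"
    using left_haar_measure_transport[OF M topological_automorphism_homeo[OF f]] by metis
  show "\<exists>!r. ?P r"
  proof (rule ex1I[of _ r])
    show "q = r" if "?P q" for q
      using left_haar_scale_unique[OF M, of q r] that r by metis
  qed (use r in blast)
qed

lemma haar_ratio_pos:
  "\<lbrakk>left_haar_measure G T M; f \<in> topological_automorphisms G T\<rbrakk> \<Longrightarrow> 0 < haar_ratio M f"
  using haar_ratio_spec by blast

lemma emeasure_automorphism_image:
  "\<lbrakk>left_haar_measure G T M; f \<in> topological_automorphisms G T; E \<in> sets M\<rbrakk> \<Longrightarrow>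
    emeasure M (f ` E) = ennreal (haar_ratio M f) * emeasure M E"
  using haar_ratio_spec by blast

lemma integral_automorphism:
  assumes "left_haar_measure G T M" "f \<in> topological_automorphisms G T" "g \<in> Cc T"
  shows "(\<integral>x. g x \<partial>M) = haar_ratio M f * (\<integral>x. g (f x) \<partial>M)"
  using emeasure_automorphism_image[OF assms(1,2)]
  by (intro integral_homeomorphic_scaled[OF lch left_haar_radon[OF assms(1)]
        topological_automorphism_homeo[OF assms(2)] haar_ratio_pos[OF assms(1,2)] _ assms(3)])

text \<open>
  Conjugation by \<open>a\<close> is a left translation, which preserves the measure, followed by a right
  translation by \<open>a\<inverse>\<close>, which scales it by \<open>\<Delta>(a)\<inverse>\<close>.
\<close>

lemma haar_ratio_comp_eq_conjugate:
  assumes M: "left_haar_measure G T M" and a: "a \<in> carrier G"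
    and fgh: "f \<in> topological_automorphisms G T" "g \<in> topological_automorphisms G T"
      "h \<in> topological_automorphisms G T"
    and eq: "\<And>x. x \<in> carrier G \<Longrightarrow> f (g x) = a \<otimes> h x \<otimes> inv a"
  shows "modular_function G T a * haar_ratio M f * haar_ratio M g = haar_ratio M h"
proof (rule left_haar_scale_unique[OF M])
  fix E assume E: "E \<in> sets M"
  note img = left_haar_sets_image[OF M topological_automorphism_homeo]
  have "f ` (g ` E) = (a <# (h ` E)) #> inv a"
    unfolding l_coset_image r_coset_image image_image
    using eq left_haar_sets_subset[OF M E] by (intro image_cong) auto
  moreover have "a <# (h ` E) \<in> sets M"
    by (rule sets_l_coset[OF left_haar_radon[OF M] a img[OF fgh(3) E]])
  moreover have "emeasure M (a <# (h ` E)) = emeasure M (h ` E)"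
    by (rule left_haar_invariant[OF M a img[OF fgh(3) E]])
  ultimately have "ennreal (haar_ratio M f) * (ennreal (haar_ratio M g) * emeasure M E)
      = ennreal (1 / modular_function G T a) * (ennreal (haar_ratio M h) * emeasure M E)"
    using emeasure_automorphism_image[OF M] fgh E img a emeasure_right_translate[OF inv_closed[OF a] M]
      modular_function_inv by metis
  then have "ennreal (modular_function G T a) * (ennreal (haar_ratio M f) * (ennreal (haar_ratio M g) * emeasure M E))
      = ennreal (modular_function G T a) * (ennreal (1 / modular_function G T a) * (ennreal (haar_ratio M h) * emeasure M E))"
    by simp
  then show "ennreal (modular_function G T a * haar_ratio M f * haar_ratio M g) * emeasure M E
      = ennreal (haar_ratio M h) * emeasure M E"
    using modular_function_pos[OF a] haar_ratio_pos[OF M] fgh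
    by (simp add: ennreal_mult[symmetric] mult.assoc[symmetric] less_imp_le)
qed (use assms modular_function_pos haar_ratio_pos in simp_all)

end

section \<open>The cocycle semidirect product\<close>

context continuous_cocycle_action
begin

abbreviation semidirect :: "('a \<times> 'b) monoid" where
  "semidirect \<equiv> cocycle_semidirect H N \<alpha> c"

abbreviation Tprod :: "('a \<times> 'b) topology" where
  "Tprod \<equiv> prod_topology TH TN"

lemma action_hom: "s \<in> carrier H \<Longrightarrow> \<alpha> s \<in> hom N N"
  using N.topological_automorphism_hom action_closed by blast

lemma action_in: "\<lbrakk>s \<in> carrier H; x \<in> carrier N\<rbrakk> \<Longrightarrow> \<alpha> s x \<in> carrier N"
  using hom_in_carrier[OF action_hom] .

lemma action_distrib:
  "\<lbrakk>s \<in> carrier H; x \<in> carrier N; y \<in> carrier N\<rbrakk> \<Longrightarrow> \<alpha> s (x \<otimes>\<^bsub>N\<^esub> y) = \<alpha> s x \<otimes>\<^bsub>N\<^esub> \<alpha> s y"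
  using hom_mult[OF action_hom] .

lemma action_inv:
  assumes "s \<in> carrier H" "x \<in> carrier N" shows "\<alpha> s (inv\<^bsub>N\<^esub> x) = inv\<^bsub>N\<^esub> (\<alpha> s x)"
proof -
  interpret group_hom N N "\<alpha> s"
    using action_hom[OF assms(1)] by (simp add: group_hom_def group_hom_axioms_def N.is_group)
  show ?thesis using hom_inv[OF assms(2)] .
qed

text \<open>
  \<open>\<alpha>(e) \<alpha>(e) = \<alpha>(e)\<close> because \<open>c(e, e) = e\<close>, and
  \<open>\<alpha>(e)\<close> is injective.
\<close>

lemma action_unit:
  assumes x: "x \<in> carrier N" shows "\<alpha> \<one>\<^bsub>H\<^esub> x = x"
proof (rule N.injective_idempotent_hom_identity[OF _ _ _ x])
  show "\<alpha> \<one>\<^bsub>H\<^esub> \<in> hom N N"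
    by (rule action_hom) simp
  show "inj_on (\<alpha> \<one>\<^bsub>H\<^esub>) (carrier N)"
    using action_closed[OF H.one_closed]
    by (simp add: topological_automorphisms_def iso_def bij_betw_def)
  show "\<alpha> \<one>\<^bsub>H\<^esub> (\<alpha> \<one>\<^bsub>H\<^esub> y) = \<alpha> \<one>\<^bsub>H\<^esub> y" if "y \<in> carrier N" for y
    using action_mult[OF H.one_closed H.one_closed that] cocycle_one_left[OF H.one_closed] that
      action_in[OF H.one_closed that] by simp
qed

text \<open>The cocycle identity for \<open>s\<inverse>, s, s\<inverse>\<close>.\<close>

lemma action_cocycle_inv:
  assumes s: "s \<in> carrier H"
  shows "\<alpha> (inv\<^bsub>H\<^esub> s) (c s (inv\<^bsub>H\<^esub> s)) = c (inv\<^bsub>H\<^esub> s) s"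
  using cocycle[of "inv\<^bsub>H\<^esub> s" s "inv\<^bsub>H\<^esub> s"] cocycle_one_right cocycle_one_left s
    cocycle_closed action_in by simp

lemma semidirect_carrier: "carrier semidirect = carrier H \<times> carrier N"
  by (simp add: cocycle_semidirect_def)

lemma semidirect_one: "\<one>\<^bsub>semidirect\<^esub> = (\<one>\<^bsub>H\<^esub>, \<one>\<^bsub>N\<^esub>)"
  by (simp add: cocycle_semidirect_def)

lemma semidirect_mult:
  "(s, x) \<otimes>\<^bsub>semidirect\<^esub> (t, y) = (s \<otimes>\<^bsub>H\<^esub> t,
     inv\<^bsub>N\<^esub> (c (inv\<^bsub>H\<^esub> t) (inv\<^bsub>H\<^esub> s)) \<otimes>\<^bsub>N\<^esub> \<alpha> (inv\<^bsub>H\<^esub> t) x \<otimes>\<^bsub>N\<^esub> y)"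
  by (simp add: cocycle_semidirect_def)

text \<open>
  The part of associativity that uses the cocycle identity; here \<open>a\<close>, \<open>b\<close>, \<open>d\<close> stand for the
  inverses of the three first coordinates, from right to left.
\<close>

lemma semidirect_assoc_aux:
  assumes abd: "a \<in> carrier H" "b \<in> carrier H" "d \<in> carrier H" and x: "x \<in> carrier N"
  shows "inv\<^bsub>N\<^esub> (c a (b \<otimes>\<^bsub>H\<^esub> d)) \<otimes>\<^bsub>N\<^esub> \<alpha> a (inv\<^bsub>N\<^esub> (c b d) \<otimes>\<^bsub>N\<^esub> \<alpha> b x)
    = inv\<^bsub>N\<^esub> (c (a \<otimes>\<^bsub>H\<^esub> b) d) \<otimes>\<^bsub>N\<^esub> \<alpha> (a \<otimes>\<^bsub>H\<^esub> b) x \<otimes>\<^bsub>N\<^esub> inv\<^bsub>N\<^esub> (c a b)"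
proof -
  define p where "p = c a b"
  define q where "q = c (a \<otimes>\<^bsub>H\<^esub> b) d"
  define u where "u = \<alpha> a (c b d)"
  define v where "v = c a (b \<otimes>\<^bsub>H\<^esub> d)"
  define z where "z = \<alpha> (a \<otimes>\<^bsub>H\<^esub> b) x"
  have cl: "p \<in> carrier N" "q \<in> carrier N" "u \<in> carrier N" "v \<in> carrier N" "z \<in> carrier N"
    using abd x by (auto simp: p_def q_def u_def v_def z_def cocycle_closed action_in)
  have coc: "p \<otimes>\<^bsub>N\<^esub> q = u \<otimes>\<^bsub>N\<^esub> v"
    unfolding p_def q_def u_def v_def by (rule cocycle[OF abd])
  have "inv\<^bsub>N\<^esub> v \<otimes>\<^bsub>N\<^esub> \<alpha> a (inv\<^bsub>N\<^esub> (c b d) \<otimes>\<^bsub>N\<^esub> \<alpha> b x)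
      = inv\<^bsub>N\<^esub> v \<otimes>\<^bsub>N\<^esub> (inv\<^bsub>N\<^esub> u \<otimes>\<^bsub>N\<^esub> (p \<otimes>\<^bsub>N\<^esub> z \<otimes>\<^bsub>N\<^esub> inv\<^bsub>N\<^esub> p))"
    using abd x by (simp add: action_distrib action_in action_inv cocycle_closed action_mult u_def p_def z_def)
  also have "\<dots> = inv\<^bsub>N\<^esub> (u \<otimes>\<^bsub>N\<^esub> v) \<otimes>\<^bsub>N\<^esub> (p \<otimes>\<^bsub>N\<^esub> z \<otimes>\<^bsub>N\<^esub> inv\<^bsub>N\<^esub> p)"
    using cl by (simp add: N.inv_mult_group N.m_assoc)
  also have "\<dots> = inv\<^bsub>N\<^esub> q \<otimes>\<^bsub>N\<^esub> z \<otimes>\<^bsub>N\<^esub> inv\<^bsub>N\<^esub> p"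
  proof -
    have "inv\<^bsub>N\<^esub> p \<otimes>\<^bsub>N\<^esub> (p \<otimes>\<^bsub>N\<^esub> (z \<otimes>\<^bsub>N\<^esub> inv\<^bsub>N\<^esub> p)) = z \<otimes>\<^bsub>N\<^esub> inv\<^bsub>N\<^esub> p"
      using cl N.m_assoc[of "inv\<^bsub>N\<^esub> p" p "z \<otimes>\<^bsub>N\<^esub> inv\<^bsub>N\<^esub> p"] by simp
    then show ?thesis
      unfolding coc[symmetric] using cl by (simp add: N.inv_mult_group N.m_assoc)
  qed
  finally show ?thesis
    by (simp add: v_def q_def z_def p_def)
qed

lemma semidirect_left_inverse:
  assumes s: "s \<in> carrier H" and x: "x \<in> carrier N"
  shows "(inv\<^bsub>H\<^esub> s, inv\<^bsub>N\<^esub> (\<alpha> s x) \<otimes>\<^bsub>N\<^esub> c s (inv\<^bsub>H\<^esub> s)) \<otimes>\<^bsub>semidirect\<^esub> (s, x) = \<one>\<^bsub>semidirect\<^esub>"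
proof -
  let ?t = "inv\<^bsub>H\<^esub> s"
  define p where "p = c ?t s"
  have p: "p \<in> carrier N"
    using s by (simp add: p_def cocycle_closed)
  have "\<alpha> ?t (inv\<^bsub>N\<^esub> (\<alpha> s x) \<otimes>\<^bsub>N\<^esub> c s ?t) = inv\<^bsub>N\<^esub> (p \<otimes>\<^bsub>N\<^esub> x \<otimes>\<^bsub>N\<^esub> inv\<^bsub>N\<^esub> p) \<otimes>\<^bsub>N\<^esub> p"
    using s x action_mult[of ?t s x] action_unit[OF x]
    by (simp add: action_distrib action_in action_inv cocycle_closed action_cocycle_inv p_def)
  also have "\<dots> = p \<otimes>\<^bsub>N\<^esub> inv\<^bsub>N\<^esub> x"
    using p x by (simp add: N.inv_mult_group N.m_assoc)
  finally have "inv\<^bsub>N\<^esub> p \<otimes>\<^bsub>N\<^esub> \<alpha> ?t (inv\<^bsub>N\<^esub> (\<alpha> s x) \<otimes>\<^bsub>N\<^esub> c s ?t) \<otimes>\<^bsub>N\<^esub> x = \<one>\<^bsub>N\<^esub>"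
    using p x by (simp add: N.m_assoc[symmetric])
  then show ?thesis
    using s by (simp add: semidirect_mult semidirect_one p_def)
qed

lemma semidirect_group: "group semidirect"
proof (rule groupI)
  show "\<one>\<^bsub>semidirect\<^esub> \<in> carrier semidirect"
    by (simp add: semidirect_carrier semidirect_one)
  fix g assume "g \<in> carrier semidirect"
  then obtain s x where g: "g = (s, x)" "s \<in> carrier H" "x \<in> carrier N"
    by (auto simp: semidirect_carrier)
  show "\<one>\<^bsub>semidirect\<^esub> \<otimes>\<^bsub>semidirect\<^esub> g = g"
  proof -
    have "\<alpha> (inv\<^bsub>H\<^esub> s) \<one>\<^bsub>N\<^esub> = \<one>\<^bsub>N\<^esub>"
      using hom_one[OF action_hom N.is_group N.is_group, of "inv\<^bsub>H\<^esub> s"] g by simp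
    then show ?thesis
      using g by (simp add: semidirect_one semidirect_mult cocycle_one_right)
  qed
  show "\<exists>k\<in>carrier semidirect. k \<otimes>\<^bsub>semidirect\<^esub> g = \<one>\<^bsub>semidirect\<^esub>"
    using semidirect_left_inverse[OF g(2,3)] g
    by (intro bexI[of _ "(inv\<^bsub>H\<^esub> s, inv\<^bsub>N\<^esub> (\<alpha> s x) \<otimes>\<^bsub>N\<^esub> c s (inv\<^bsub>H\<^esub> s))"])
      (auto simp: semidirect_carrier action_in cocycle_closed)
  fix k assume "k \<in> carrier semidirect"
  then obtain t y where k: "k = (t, y)" "t \<in> carrier H" "y \<in> carrier N"
    by (auto simp: semidirect_carrier)
  show "g \<otimes>\<^bsub>semidirect\<^esub> k \<in> carrier semidirect"
    using g k by (simp add: semidirect_carrier semidirect_mult cocycle_closed action_in)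
  fix l assume "l \<in> carrier semidirect"
  then obtain r z where l: "l = (r, z)" "r \<in> carrier H" "z \<in> carrier N"
    by (auto simp: semidirect_carrier)
  define a where "a = inv\<^bsub>H\<^esub> r"
  define b where "b = inv\<^bsub>H\<^esub> t"
  define d where "d = inv\<^bsub>H\<^esub> s"
  have abd: "a \<in> carrier H" "b \<in> carrier H" "d \<in> carrier H"
    using g k l by (auto simp: a_def b_def d_def)
  define w where "w = inv\<^bsub>N\<^esub> (c b d) \<otimes>\<^bsub>N\<^esub> \<alpha> b x"
  have w: "w \<in> carrier N" "\<alpha> a w \<in> carrier N" "\<alpha> a y \<in> carrier N" "\<alpha> (a \<otimes>\<^bsub>H\<^esub> b) x \<in> carrier N"
    using abd g k by (auto simp: w_def cocycle_closed action_in)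
  have cc: "c a b \<in> carrier N" "c (a \<otimes>\<^bsub>H\<^esub> b) d \<in> carrier N" "c a (b \<otimes>\<^bsub>H\<^esub> d) \<in> carrier N"
    using abd by (auto simp: cocycle_closed)
  have "snd (g \<otimes>\<^bsub>semidirect\<^esub> k \<otimes>\<^bsub>semidirect\<^esub> l)
      = inv\<^bsub>N\<^esub> (c a (b \<otimes>\<^bsub>H\<^esub> d)) \<otimes>\<^bsub>N\<^esub> \<alpha> a (w \<otimes>\<^bsub>N\<^esub> y) \<otimes>\<^bsub>N\<^esub> z"
    using g k l by (simp add: semidirect_mult a_def b_def d_def w_def H.inv_mult_group)
  also have "\<dots> = (inv\<^bsub>N\<^esub> (c a (b \<otimes>\<^bsub>H\<^esub> d)) \<otimes>\<^bsub>N\<^esub> \<alpha> a w) \<otimes>\<^bsub>N\<^esub> \<alpha> a y \<otimes>\<^bsub>N\<^esub> z"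
    using abd w k l cc by (simp add: action_distrib N.m_assoc)
  also have "\<dots> = (inv\<^bsub>N\<^esub> (c (a \<otimes>\<^bsub>H\<^esub> b) d) \<otimes>\<^bsub>N\<^esub> \<alpha> (a \<otimes>\<^bsub>H\<^esub> b) x \<otimes>\<^bsub>N\<^esub> inv\<^bsub>N\<^esub> (c a b)) \<otimes>\<^bsub>N\<^esub> \<alpha> a y \<otimes>\<^bsub>N\<^esub> z"
    unfolding w_def by (subst semidirect_assoc_aux[OF abd g(3)]) simp
  also have "\<dots> = inv\<^bsub>N\<^esub> (c (a \<otimes>\<^bsub>H\<^esub> b) d) \<otimes>\<^bsub>N\<^esub> \<alpha> (a \<otimes>\<^bsub>H\<^esub> b) x \<otimes>\<^bsub>N\<^esub> (inv\<^bsub>N\<^esub> (c a b) \<otimes>\<^bsub>N\<^esub> \<alpha> a y \<otimes>\<^bsub>N\<^esub> z)"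
    using w l cc by (simp add: N.m_assoc)
  also have "\<dots> = snd (g \<otimes>\<^bsub>semidirect\<^esub> (k \<otimes>\<^bsub>semidirect\<^esub> l))"
    using g k l by (simp add: semidirect_mult a_def b_def d_def H.inv_mult_group)
  finally show "g \<otimes>\<^bsub>semidirect\<^esub> k \<otimes>\<^bsub>semidirect\<^esub> l = g \<otimes>\<^bsub>semidirect\<^esub> (k \<otimes>\<^bsub>semidirect\<^esub> l)"
    using g k l by (intro prod_eqI) (simp_all add: semidirect_mult H.m_assoc)
qed

lemma semidirect_inv:
  assumes "s \<in> carrier H" "x \<in> carrier N"
  shows "inv\<^bsub>semidirect\<^esub> (s, x) = (inv\<^bsub>H\<^esub> s, inv\<^bsub>N\<^esub> (\<alpha> s x) \<otimes>\<^bsub>N\<^esub> c s (inv\<^bsub>H\<^esub> s))"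
  using assms by (intro group.inv_equality[OF semidirect_group semidirect_left_inverse])
    (auto simp: semidirect_carrier action_in cocycle_closed)

lemma continuous_map_action:
  assumes "continuous_map X TH f" "continuous_map X TN g"
  shows "continuous_map X TN (\<lambda>z. \<alpha> (f z) (g z))"
  using continuous_map_compose[OF continuous_map_pairedI[OF assms] continuous_action] by (simp add: o_def)

lemma continuous_map_cocycle:
  assumes "continuous_map X TH f" "continuous_map X TH g"
  shows "continuous_map X TN (\<lambda>z. c (f z) (g z))"
  using continuous_map_compose[OF continuous_map_pairedI[OF assms] continuous_cocycle] by (simp add: o_def)

lemma semidirect_locally_compact_group: "locally_compact_group semidirect Tprod"
proof -
  interpret G: group semidirect by (rule semidirect_group)
  show ?thesis
  proof (unfold_locales)
    show "topspace Tprod = carrier semidirect"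
      by (simp add: semidirect_carrier H.topspace_eq_carrier N.topspace_eq_carrier)
    show "Hausdorff_space Tprod"
      using H.Hausdorff N.Hausdorff by (simp add: Hausdorff_space_prod_topology)
    show "locally_compact_space Tprod"
      using H.locally_compact N.locally_compact by (simp add: locally_compact_space_prod_topology)
    let ?P = "prod_topology Tprod Tprod"
    have 1: "continuous_map ?P TH (\<lambda>z. fst (fst z))" "continuous_map ?P TN (\<lambda>z. snd (fst z))"
      "continuous_map ?P TH (\<lambda>z. fst (snd z))" "continuous_map ?P TN (\<lambda>z. snd (snd z))"
      using continuous_map_compose[OF continuous_map_fst continuous_map_fst]
        continuous_map_compose[OF continuous_map_fst continuous_map_snd]
        continuous_map_compose[OF continuous_map_snd continuous_map_fst]
        continuous_map_compose[OF continuous_map_snd continuous_map_snd] by (simp_all add: o_def)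
    have "continuous_map ?P Tprod (\<lambda>z. (fst (fst z) \<otimes>\<^bsub>H\<^esub> fst (snd z),
        inv\<^bsub>N\<^esub> (c (inv\<^bsub>H\<^esub> (fst (snd z))) (inv\<^bsub>H\<^esub> (fst (fst z)))) \<otimes>\<^bsub>N\<^esub>
          \<alpha> (inv\<^bsub>H\<^esub> (fst (snd z))) (snd (fst z)) \<otimes>\<^bsub>N\<^esub> snd (snd z)))"
      by (intro continuous_map_pairedI H.continuous_map_mult N.continuous_map_mult
          N.continuous_map_inverse H.continuous_map_inverse continuous_map_action continuous_map_cocycle 1)
    then show "continuous_map ?P Tprod (\<lambda>(x, y). x \<otimes>\<^bsub>semidirect\<^esub> y)"
      by (simp add: cocycle_semidirect_def case_prod_beta')
    have "continuous_map Tprod Tprod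
        (\<lambda>z. (inv\<^bsub>H\<^esub> (fst z), inv\<^bsub>N\<^esub> (\<alpha> (fst z) (snd z)) \<otimes>\<^bsub>N\<^esub> c (fst z) (inv\<^bsub>H\<^esub> (fst z))))"
      by (intro continuous_map_pairedI N.continuous_map_mult N.continuous_map_inverse
          H.continuous_map_inverse continuous_map_action continuous_map_cocycle continuous_map_fst continuous_map_snd)
    then show "continuous_map Tprod Tprod (\<lambda>x. inv\<^bsub>semidirect\<^esub> x)"
      by (rule continuous_map_eq)
        (auto simp: semidirect_inv H.topspace_eq_carrier N.topspace_eq_carrier)
  qed
qed

definition iterated_integral :: "'a measure \<Rightarrow> 'b measure \<Rightarrow> ('a \<times> 'b \<Rightarrow> real) \<Rightarrow> real" where
  "iterated_integral P Q f = (\<integral>s. (\<integral>x. f (s, x) \<partial>Q) \<partial>P)"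

context
  fixes P Q
  assumes P: "left_haar_measure H TH P" and Q: "left_haar_measure N TN Q"
begin

lemma inner_integral_Cc:
  "f \<in> Cc Tprod \<Longrightarrow> (\<lambda>s. \<integral>x. f (s, x) \<partial>Q) \<in> Cc TH"
  by (rule Cc_slice_functional[OF N.lch radon_positive_functional[OF N.lch N.left_haar_radon[OF Q]]])

lemma slice_Cc: "\<lbrakk>f \<in> Cc Tprod; s \<in> carrier H\<rbrakk> \<Longrightarrow> (\<lambda>x. f (s, x)) \<in> Cc TN"
  using Cc_slice[of f TH TN s] by (simp add: H.topspace_eq_carrier)

lemma space_P: "space P = carrier H"
  using radon_space[OF H.lch H.left_haar_radon[OF P]] H.topspace_eq_carrier by simp

lemma space_Q: "space Q = carrier N"
  using radon_space[OF N.lch N.left_haar_radon[OF Q]] N.topspace_eq_carrier by simp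

lemma integral_left_translate_N:
  "\<lbrakk>a \<in> carrier N; f \<in> Cc TN\<rbrakk> \<Longrightarrow> (\<integral>x. f (a \<otimes>\<^bsub>N\<^esub> x) \<partial>Q) = (\<integral>x. f x \<partial>Q)"
  using N.left_haar_functional[OF Q] by (simp add: left_invariant_functional_def)

lemma integral_left_translate_H:
  "\<lbrakk>a \<in> carrier H; f \<in> Cc TH\<rbrakk> \<Longrightarrow> (\<integral>x. f (a \<otimes>\<^bsub>H\<^esub> x) \<partial>P) = (\<integral>x. f x \<partial>P)"
  using H.left_haar_functional[OF P] by (simp add: left_invariant_functional_def)

lemma iterated_integral_left_invariant:
  "left_invariant_functional semidirect Tprod (iterated_integral P Q)"
  unfolding left_invariant_functional_def positive_functional_def
proof (intro conjI ballI allI impI)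
  note int_P = radon_integrable[OF H.lch H.left_haar_radon[OF P] inner_integral_Cc]
  note int_Q = radon_integrable[OF N.lch N.left_haar_radon[OF Q] slice_Cc]
  fix f assume f: "f \<in> Cc Tprod"
  show "iterated_integral P Q (\<lambda>x. f x + g x) = iterated_integral P Q f + iterated_integral P Q g"
    if g: "g \<in> Cc Tprod" for g
  proof -
    have "iterated_integral P Q (\<lambda>x. f x + g x) = (\<integral>s. (\<integral>x. f (s, x) \<partial>Q) + (\<integral>x. g (s, x) \<partial>Q) \<partial>P)"
      unfolding iterated_integral_def
      using int_Q[OF f] int_Q[OF g] by (intro Bochner_Integration.integral_cong) (auto simp: space_P)
    then show ?thesis
      using int_P[OF f] int_P[OF g] by (simp add: iterated_integral_def)
  qed
  show "iterated_integral P Q (\<lambda>x. a * f x) = a * iterated_integral P Q f" for a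
    by (simp add: iterated_integral_def)
  show "0 \<le> iterated_integral P Q f" if "\<forall>x\<in>topspace Tprod. 0 \<le> f x"
    unfolding iterated_integral_def using that
    by (intro Bochner_Integration.integral_nonneg)
      (auto simp: space_P space_Q H.topspace_eq_carrier N.topspace_eq_carrier)
  fix g assume "g \<in> carrier semidirect"
  then obtain s x where g: "g = (s, x)" "s \<in> carrier H" "x \<in> carrier N"
    by (auto simp: semidirect_carrier)
  have "iterated_integral P Q (\<lambda>k. f (g \<otimes>\<^bsub>semidirect\<^esub> k)) = (\<integral>t. (\<integral>y. f (s \<otimes>\<^bsub>H\<^esub> t, y) \<partial>Q) \<partial>P)"
    unfolding iterated_integral_def
  proof (rule Bochner_Integration.integral_cong[OF refl])
    fix t assume "t \<in> space P"
    then have t: "t \<in> carrier H" by (simp add: space_P)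
    show "(\<integral>y. f (g \<otimes>\<^bsub>semidirect\<^esub> (t, y)) \<partial>Q) = (\<integral>y. f (s \<otimes>\<^bsub>H\<^esub> t, y) \<partial>Q)"
      using integral_left_translate_N[OF _ slice_Cc[OF f, of "s \<otimes>\<^bsub>H\<^esub> t"],
          of "inv\<^bsub>N\<^esub> (c (inv\<^bsub>H\<^esub> t) (inv\<^bsub>H\<^esub> s)) \<otimes>\<^bsub>N\<^esub> \<alpha> (inv\<^bsub>H\<^esub> t) x"] g t
      by (simp add: semidirect_mult cocycle_closed action_in)
  qed
  also have "\<dots> = iterated_integral P Q f"
    unfolding iterated_integral_def by (rule integral_left_translate_H[OF g(2) inner_integral_Cc[OF f]])
  finally show "iterated_integral P Q (\<lambda>k. f (g \<otimes>\<^bsub>semidirect\<^esub> k)) = iterated_integral P Q f" .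
qed

text \<open>
  Above each \<open>s\<close>, right translation by \<open>(t, y)\<close> is \<open>x \<mapsto> k \<alpha>(t\<inverse>)(x) y\<close> with \<open>k\<close> depending on \<open>s\<close>
  and \<open>t\<close> only. The left factor \<open>k\<close> has no effect on the integral, and the other two maps
  contribute their moduli.
\<close>

lemma iterated_integral_right_translate:
  assumes f: "f \<in> Cc Tprod" and t: "t \<in> carrier H" and y: "y \<in> carrier N"
  shows "iterated_integral P Q f = modular_function H TH t * modular_function N TN y *
    haar_ratio Q (\<alpha> (inv\<^bsub>H\<^esub> t)) * iterated_integral P Q (\<lambda>k. f (k \<otimes>\<^bsub>semidirect\<^esub> (t, y)))"
proof -
  let ?\<beta> = "\<alpha> (inv\<^bsub>H\<^esub> t)"
  have \<beta>: "?\<beta> \<in> topological_automorphisms N TN"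
    using t by (intro action_closed) simp
  let ?m = "modular_function N TN y * haar_ratio Q ?\<beta>"
  have inner: "(\<integral>x. f (s \<otimes>\<^bsub>H\<^esub> t, x) \<partial>Q) = ?m * (\<integral>x. f ((s, x) \<otimes>\<^bsub>semidirect\<^esub> (t, y)) \<partial>Q)"
    if s: "s \<in> carrier H" for s
  proof -
    define k where "k = inv\<^bsub>N\<^esub> (c (inv\<^bsub>H\<^esub> t) (inv\<^bsub>H\<^esub> s))"
    have k: "k \<in> carrier N"
      using s t by (simp add: k_def cocycle_closed)
    let ?g = "\<lambda>x. f (s \<otimes>\<^bsub>H\<^esub> t, x)"
    have g: "?g \<in> Cc TN"
      using slice_Cc[OF f] s t by simp
    have gy: "(\<lambda>x. ?g (x \<otimes>\<^bsub>N\<^esub> y)) \<in> Cc TN"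
      by (rule Cc_homeomorphic[OF g N.homeomorphic_right_translation[OF y]])
    have gky: "(\<lambda>x. ?g (k \<otimes>\<^bsub>N\<^esub> x \<otimes>\<^bsub>N\<^esub> y)) \<in> Cc TN"
      by (rule Cc_homeomorphic[OF gy N.homeomorphic_left_translation[OF k]])
    have "(\<integral>x. ?g x \<partial>Q) = modular_function N TN y * (\<integral>x. ?g (x \<otimes>\<^bsub>N\<^esub> y) \<partial>Q)"
      by (rule N.integral_right_translate[OF y Q g])
    also have "(\<integral>x. ?g (x \<otimes>\<^bsub>N\<^esub> y) \<partial>Q) = (\<integral>x. ?g (k \<otimes>\<^bsub>N\<^esub> x \<otimes>\<^bsub>N\<^esub> y) \<partial>Q)"
      by (rule integral_left_translate_N[OF k gy, symmetric])
    also have "\<dots> = haar_ratio Q ?\<beta> * (\<integral>x. ?g (k \<otimes>\<^bsub>N\<^esub> ?\<beta> x \<otimes>\<^bsub>N\<^esub> y) \<partial>Q)"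
      by (rule N.integral_automorphism[OF Q \<beta> gky])
    finally show ?thesis
      by (simp add: semidirect_mult k_def)
  qed
  have "iterated_integral P Q f = modular_function H TH t * (\<integral>s. (\<integral>x. f (s \<otimes>\<^bsub>H\<^esub> t, x) \<partial>Q) \<partial>P)"
    unfolding iterated_integral_def by (rule H.integral_right_translate[OF t P inner_integral_Cc[OF f]])
  also have "(\<integral>s. (\<integral>x. f (s \<otimes>\<^bsub>H\<^esub> t, x) \<partial>Q) \<partial>P)
      = (\<integral>s. ?m * (\<integral>x. f ((s, x) \<otimes>\<^bsub>semidirect\<^esub> (t, y)) \<partial>Q) \<partial>P)"
    using inner by (intro Bochner_Integration.integral_cong) (auto simp: space_P)
  finally show ?thesis
    by (simp add: iterated_integral_def)
qed

lemma iterated_integral_nonzero: obtains f where "f \<in> Cc Tprod" "iterated_integral P Q f \<noteq> 0"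
proof -
  obtain b where b: "b \<in> Cc TH" "\<And>x. x \<in> carrier H \<Longrightarrow> 0 \<le> b x" "b \<one>\<^bsub>H\<^esub> = 1"
    by (fact H.one_bump)
  obtain d where d: "d \<in> Cc TN" "\<And>x. x \<in> carrier N \<Longrightarrow> 0 \<le> d x" "d \<one>\<^bsub>N\<^esub> = 1"
    by (fact N.one_bump)
  have "(\<integral>x. b x \<partial>P) \<noteq> 0" "(\<integral>x. d x \<partial>Q) \<noteq> 0"
    using H.left_haar_integral_zero[OF P b(1,2) _ H.one_closed] b(3)
      N.left_haar_integral_zero[OF Q d(1,2) _ N.one_closed] d(3) by auto
  then show thesis
    by (intro that[OF Cc_tensor[OF b(1) d(1)]]) (simp add: iterated_integral_def)
qed

text \<open>
  The iterated integral is a multiple of Haar integration on the product, so both scale alike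
  under right translations.
\<close>

theorem semidirect_modular_function:
  assumes t: "t \<in> carrier H" and y: "y \<in> carrier N"
  shows "modular_function semidirect Tprod (t, y) =
    modular_function H TH t * modular_function N TN y * haar_ratio Q (\<alpha> (inv\<^bsub>H\<^esub> t))"
proof -
  interpret G: locally_compact_group semidirect Tprod
    by (rule semidirect_locally_compact_group)
  have ty: "(t, y) \<in> carrier semidirect"
    using t y by (simp add: semidirect_carrier)
  obtain M where M: "left_haar_measure semidirect Tprod M"
    by (fact G.left_haar_measure_exists)
  obtain r where r: "\<And>f. f \<in> Cc Tprod \<Longrightarrow> iterated_integral P Q f = r * (\<integral>z. f z \<partial>M)"
    using G.left_invariant_functional_unique[OF M iterated_integral_left_invariant] by blast
  obtain f where f: "f \<in> Cc Tprod" "iterated_integral P Q f \<noteq> 0"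
    by (fact iterated_integral_nonzero)
  let ?f = "\<lambda>k. f (k \<otimes>\<^bsub>semidirect\<^esub> (t, y))"
  have "?f \<in> Cc Tprod"
    by (rule Cc_homeomorphic[OF f(1) G.homeomorphic_right_translation[OF ty]])
  then have "iterated_integral P Q f = modular_function semidirect Tprod (t, y) * iterated_integral P Q ?f"
    using G.integral_right_translate[OF ty M f(1)] r f(1) by simp
  then show ?thesis
    using iterated_integral_right_translate[OF f(1) t y] f(2) by auto
qed

end

section \<open>Openness of the kernel\<close>

lemma haar_ratio_action_one:
  assumes Q: "left_haar_measure N TN Q" shows "haar_ratio Q (\<alpha> \<one>\<^bsub>H\<^esub>) = 1"
proof (rule N.left_haar_scale_unique[OF Q])
  fix E assume E: "E \<in> sets Q"
  have "\<alpha> \<one>\<^bsub>H\<^esub> x = x" if "x \<in> E" for x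
    using action_unit N.left_haar_sets_subset[OF Q E] that by blast
  then have "\<alpha> \<one>\<^bsub>H\<^esub> ` E = E"
    by simp
  then show "ennreal (haar_ratio Q (\<alpha> \<one>\<^bsub>H\<^esub>)) * emeasure Q E = ennreal 1 * emeasure Q E"
    using N.emeasure_automorphism_image[OF Q action_closed[OF H.one_closed] E] by simp
qed (use N.haar_ratio_pos[OF Q action_closed[OF H.one_closed]] in auto)

lemma haar_ratio_action_mult:
  assumes Q: "left_haar_measure N TN Q" and st: "s \<in> carrier H" "t \<in> carrier H"
  shows "modular_function N TN (c s t) * haar_ratio Q (\<alpha> s) * haar_ratio Q (\<alpha> t) = haar_ratio Q (\<alpha> (s \<otimes>\<^bsub>H\<^esub> t))"
  by (rule N.haar_ratio_comp_eq_conjugate[OF Q cocycle_closed[OF st] action_closed[OF st(1)]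
      action_closed[OF st(2)] action_closed[OF H.m_closed[OF st]] action_mult[OF st]])

text \<open>
  Identifies the quantity in the theorem with the modulus that occurs in the modular function of
  the product.
\<close>

lemma haar_ratio_cocycle_inverse:
  assumes Q: "left_haar_measure N TN Q" and s: "s \<in> carrier H"
  shows "modular_function N TN (c s (inv\<^bsub>H\<^esub> s)) * haar_ratio Q (\<alpha> s) = 1 / haar_ratio Q (\<alpha> (inv\<^bsub>H\<^esub> s))"
  using haar_ratio_action_mult[OF Q s H.inv_closed[OF s]] haar_ratio_action_one[OF Q]
    N.haar_ratio_pos[OF Q action_closed[OF H.inv_closed[OF s]]] s by (simp add: field_simps)

text \<open>
  For \<open>a\<close> in the level set, \<open>mod(\<alpha>(a\<inverse> s\<inverse>)) = \<Delta>\<^sub>N(c(a\<inverse>, s\<inverse>)) mod(\<alpha>(a\<inverse>)) mod(\<alpha>(s\<inverse>))\<close>. By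
  continuity \<open>c(a\<inverse>, s\<inverse>)\<close> stays in the open kernel of \<open>\<Delta>\<^sub>N\<close> for \<open>s\<close> near the identity, so \<open>s a\<close>
  remains in the level set.
\<close>

lemma ratio_level_set_open_iff:
  assumes Q: "left_haar_measure N TN Q" and N: "almost_unimodular N TN"
  shows "openin TH {s \<in> carrier H. modular_function N TN (c s (inv\<^bsub>H\<^esub> s)) * haar_ratio Q (\<alpha> s) = 1} \<longleftrightarrow>
    (\<exists>V. openin TH V \<and> \<one>\<^bsub>H\<^esub> \<in> V \<and> (\<forall>s\<in>V. haar_ratio Q (\<alpha> (inv\<^bsub>H\<^esub> s)) = 1))"
    (is "openin TH ?A \<longleftrightarrow> ?R")
proof -
  define A where "A = {s \<in> carrier H. haar_ratio Q (\<alpha> (inv\<^bsub>H\<^esub> s)) = 1}"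
  have A: "?A = A"
    using haar_ratio_cocycle_inverse[OF Q] by (auto simp: A_def)
  show ?thesis
    unfolding A
  proof
    assume "openin TH A"
    then show ?R
      using haar_ratio_action_one[OF Q] by (intro exI[of _ A]) (auto simp: A_def)
  next
    assume ?R
    then obtain V where V: "openin TH V" "\<one>\<^bsub>H\<^esub> \<in> V" "\<And>s. s \<in> V \<Longrightarrow> haar_ratio Q (\<alpha> (inv\<^bsub>H\<^esub> s)) = 1"
      by blast
    have VH: "V \<subseteq> carrier H"
      using openin_subset[OF V(1)] H.topspace_eq_carrier by simp
    show "openin TH A"
    proof (subst openin_subopen, intro ballI)
      fix a assume "a \<in> A"
      then have a: "a \<in> carrier H" "haar_ratio Q (\<alpha> (inv\<^bsub>H\<^esub> a)) = 1"
        by (auto simp: A_def)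
      define U where "U = {s \<in> topspace TH. c (inv\<^bsub>H\<^esub> a) (inv\<^bsub>H\<^esub> s) \<in> {y \<in> carrier N. modular_function N TN y = 1}}"
      have "continuous_map TH TN (\<lambda>s. c (inv\<^bsub>H\<^esub> a) (inv\<^bsub>H\<^esub> s))"
        using a by (intro continuous_map_cocycle H.continuous_inv) (simp add: H.topspace_eq_carrier)
      then have U: "openin TH U"
        unfolding U_def using almost_unimodular.openin_kernel[OF N] by (rule openin_continuous_map_preimage)
      have "\<one>\<^bsub>H\<^esub> \<in> U"
        using a N.modular_function_one by (simp add: U_def H.topspace_eq_carrier cocycle_one_right)
      let ?W = "(\<lambda>s. s \<otimes>\<^bsub>H\<^esub> a) ` (U \<inter> V)"
      have "openin TH ?W"
        using homeomorphic_imp_open_map[OF H.homeomorphic_right_translation[OF a(1)]] openin_Int[OF U V(1)]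
        by (simp add: open_map_def)
      moreover have "a \<in> ?W"
        using a \<open>\<one>\<^bsub>H\<^esub> \<in> U\<close> V(2) by (intro image_eqI[of _ _ "\<one>\<^bsub>H\<^esub>"]) auto
      moreover have "?W \<subseteq> A"
      proof (rule image_subsetI)
        fix s assume s: "s \<in> U \<inter> V"
        then have sH: "s \<in> carrier H" using VH by blast
        show "s \<otimes>\<^bsub>H\<^esub> a \<in> A"
          using haar_ratio_action_mult[OF Q, of "inv\<^bsub>H\<^esub> a" "inv\<^bsub>H\<^esub> s"] s sH a V(3)
          by (simp add: A_def U_def H.inv_mult_group)
      qed
      ultimately show "\<exists>W. openin TH W \<and> a \<in> W \<and> W \<subseteq> A"
        by blast
    qed
  qed
qed

text \<open>
  Near the identity the factors \<open>\<Delta>\<^sub>H\<close> and \<open>\<Delta>\<^sub>N\<close> of the modular function are \<open>1\<close>, so only the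
  modulus of the action is left.
\<close>

lemma semidirect_kernel_open_iff:
  assumes Q: "left_haar_measure N TN Q" and H: "almost_unimodular H TH" and N: "almost_unimodular N TN"
  shows "almost_unimodular semidirect Tprod \<longleftrightarrow>
    (\<exists>V. openin TH V \<and> \<one>\<^bsub>H\<^esub> \<in> V \<and> (\<forall>s\<in>V. haar_ratio Q (\<alpha> (inv\<^bsub>H\<^esub> s)) = 1))"
proof -
  interpret G: locally_compact_group semidirect Tprod
    by (rule semidirect_locally_compact_group)
  obtain P where P: "left_haar_measure H TH P"
    by (fact H.left_haar_measure_exists)
  note mod_eq = semidirect_modular_function[OF P Q]
  let ?KH = "{s \<in> carrier H. modular_function H TH s = 1}"
  let ?KN = "{y \<in> carrier N. modular_function N TN y = 1}"
  have KH: "openin TH ?KH" and KN: "openin TN ?KN"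
    using almost_unimodular.openin_kernel H N by blast+
  have "almost_unimodular semidirect Tprod \<longleftrightarrow>
    (\<exists>V. openin Tprod V \<and> \<one>\<^bsub>semidirect\<^esub> \<in> V \<and> (\<forall>g\<in>V. modular_function semidirect Tprod g = 1))"
    unfolding almost_unimodular_def almost_unimodular_axioms_def G.modular_kernel_open_iff
    using semidirect_locally_compact_group by simp
  also have "\<dots> \<longleftrightarrow> (\<exists>V. openin TH V \<and> \<one>\<^bsub>H\<^esub> \<in> V \<and> (\<forall>s\<in>V. haar_ratio Q (\<alpha> (inv\<^bsub>H\<^esub> s)) = 1))"
  proof
    assume "\<exists>V. openin Tprod V \<and> \<one>\<^bsub>semidirect\<^esub> \<in> V \<and> (\<forall>g\<in>V. modular_function semidirect Tprod g = 1)"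
    then obtain V where V: "openin Tprod V" "(\<one>\<^bsub>H\<^esub>, \<one>\<^bsub>N\<^esub>) \<in> V"
      "\<And>g. g \<in> V \<Longrightarrow> modular_function semidirect Tprod g = 1"
      by (auto simp: semidirect_one)
    obtain A B where AB: "openin TH A" "openin TN B" "\<one>\<^bsub>H\<^esub> \<in> A" "\<one>\<^bsub>N\<^esub> \<in> B" "A \<times> B \<subseteq> V"
      using openin_prod_topology_alt[of TH TN V, THEN iffD1, rule_format, OF V(1,2)] by auto
    show "\<exists>V. openin TH V \<and> \<one>\<^bsub>H\<^esub> \<in> V \<and> (\<forall>s\<in>V. haar_ratio Q (\<alpha> (inv\<^bsub>H\<^esub> s)) = 1)"
    proof (intro exI[of _ "A \<inter> ?KH"] conjI ballI)
      show "openin TH (A \<inter> ?KH)" by (rule openin_Int[OF AB(1) KH])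
      show "\<one>\<^bsub>H\<^esub> \<in> A \<inter> ?KH" using AB(3) H.modular_function_one by simp
      fix s assume "s \<in> A \<inter> ?KH"
      then have "s \<in> carrier H" "modular_function H TH s = 1" "(s, \<one>\<^bsub>N\<^esub>) \<in> V"
        using AB by auto
      then show "haar_ratio Q (\<alpha> (inv\<^bsub>H\<^esub> s)) = 1"
        using mod_eq[of s "\<one>\<^bsub>N\<^esub>"] V(3) N.modular_function_one by simp
    qed
  next
    assume "\<exists>V. openin TH V \<and> \<one>\<^bsub>H\<^esub> \<in> V \<and> (\<forall>s\<in>V. haar_ratio Q (\<alpha> (inv\<^bsub>H\<^esub> s)) = 1)"
    then obtain V where V: "openin TH V" "\<one>\<^bsub>H\<^esub> \<in> V" "\<And>s. s \<in> V \<Longrightarrow> haar_ratio Q (\<alpha> (inv\<^bsub>H\<^esub> s)) = 1"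
      by blast
    show "\<exists>V. openin Tprod V \<and> \<one>\<^bsub>semidirect\<^esub> \<in> V \<and> (\<forall>g\<in>V. modular_function semidirect Tprod g = 1)"
    proof (intro exI[of _ "(V \<inter> ?KH) \<times> ?KN"] conjI ballI)
      show "openin Tprod ((V \<inter> ?KH) \<times> ?KN)"
        using openin_Int[OF V(1) KH] KN by (simp add: openin_prod_Times_iff)
      show "\<one>\<^bsub>semidirect\<^esub> \<in> (V \<inter> ?KH) \<times> ?KN"
        using V(2) H.modular_function_one N.modular_function_one by (simp add: semidirect_one)
      show "modular_function semidirect Tprod g = 1" if "g \<in> (V \<inter> ?KH) \<times> ?KN" for g
        using that mod_eq V(3) by (cases g) simp
    qed
  qed
  finally show ?thesis .
qed

end

theorem proposition3p5:
  fixes H :: "('a, 'm) monoid_scheme" and TH :: "'a topology"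
    and N :: "('b, 'n) monoid_scheme" and TN :: "'b topology"
    and \<alpha> :: "'a \<Rightarrow> 'b \<Rightarrow> 'b" and c :: "'a \<Rightarrow> 'a \<Rightarrow> 'b"
  assumes "almost_unimodular H TH"
    and "almost_unimodular N TN"
    and "continuous_cocycle_action H TH N TN \<alpha> c"
  shows "(\<forall>\<mu>\<^sub>N. left_haar_measure N TN \<mu>\<^sub>N \<longrightarrow>
            (almost_unimodular (cocycle_semidirect H N \<alpha> c) (prod_topology TH TN) \<longleftrightarrow>
             openin TH {s \<in> carrier H.
               modular_function N TN (c s (inv\<^bsub>H\<^esub> s)) * haar_ratio \<mu>\<^sub>N (\<alpha> s) = 1})) \<and>
         (TH = discrete_topology (carrier H) \<longrightarrow>
            almost_unimodular (cocycle_semidirect H N \<alpha> c) (prod_topology TH TN))"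
proof -
  interpret continuous_cocycle_action H TH N TN \<alpha> c by (rule assms(3))
  show ?thesis
  proof (intro conjI allI impI)
    fix \<mu> assume \<mu>: "left_haar_measure N TN \<mu>"
    show "almost_unimodular semidirect Tprod \<longleftrightarrow>
        openin TH {s \<in> carrier H. modular_function N TN (c s (inv\<^bsub>H\<^esub> s)) * haar_ratio \<mu> (\<alpha> s) = 1}"
      unfolding semidirect_kernel_open_iff[OF \<mu> assms(1,2)] ratio_level_set_open_iff[OF \<mu> assms(2)] ..
  next
    assume discrete: "TH = discrete_topology (carrier H)"
    obtain \<mu> where \<mu>: "left_haar_measure N TN \<mu>"
      by (fact N.left_haar_measure_exists)
    have "openin TH {\<one>\<^bsub>H\<^esub>}"
      by (simp add: discrete)
    then show "almost_unimodular semidirect Tprod"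
      unfolding semidirect_kernel_open_iff[OF \<mu> assms(1,2)]
      using haar_ratio_action_one[OF \<mu>] by (intro exI[of _ "{\<one>\<^bsub>H\<^esub>}"]) simp
  qed
qed

end
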